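(* Let $\Omega:=S^1\times S^1$ be the flat $2$-torus, let $p>2$, and let $r\in L^\infty(\Omega)$ satisfy $\operatorname{ess\,inf}_{x\in\Omega} r(x)>0$. Then, for any $\mu>0$, the nonlinear equation $$\Delta^2u=\lambda u+r(x)|u|^{p-2}u\qquad\text{in }\Omega$$ admits infinitely many normalized sign-changing solutions with mass $\|u\|_{L^2(\Omega)}^2=\mu$ associated to a sequence of parameters $\lambda$ converging to $+\infty$; that is, there are a sequence of real numbers $\Lambda_j\to+\infty$ and sign-changing functions $u_j$ solving the equation with $\lambda=\Lambda_j$ and with $\|u_j\|_{L^2(\Omega)}^2=\mu$ for all $j$.
   Context: $S^1=\mathbb{R}/2\pi\mathbb{Z}$ and $\Omega$ carries the flat product metric and measure. Functions are real-valued. Solutions are understood in the weak sense: $u\in H^2(\Omega)$ with $\int_\Omega\Delta u\,\Delta v\,dx=\lambda\int_\Omega uv\,dx+\int_\Omega r|u|^{p-2}uv\,dx$ for all $v\in H^2(\Omega)$. A function is sign-changing if both its positive and its negative part are nontrivial. *)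

theory Defs
  imports "HOL-Analysis.Analysis" "HOL-Probability.Essential_Supremum"
begin

text \<open>
  Functions on the flat torus \<open>S\<^sup>1 \<times> S\<^sup>1\<close>, \<open>S\<^sup>1 = \<real>/2\<pi>\<int>\<close>, are represented by functions
  on the plane that are \<open>2\<pi>\<close>-periodic in both variables, and are integrated with respect
  to Lebesgue measure on a fundamental domain.
  Elements of the Lebesgue and Sobolev spaces are functions, not classes modulo null sets.
\<close>

type_synonym plane_fun = "real \<times> real \<Rightarrow> real"

definition torus :: "(real \<times> real) measure" where
  "torus = lebesgue_on ({0..<2 * pi} \<times> {0..<2 * pi})"

definition periodic :: "plane_fun \<Rightarrow> bool" where
  "periodic f \<longleftrightarrow>
     (\<forall>x y. f (x + 2 * pi, y) = f (x, y) \<and> f (x, y + 2 * pi) = f (x, y))"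


definition essinf :: "'a measure \<Rightarrow> ('a \<Rightarrow> ereal) \<Rightarrow> ereal" where
  "essinf M f = - esssup M (\<lambda>x. - f x)"

definition Linf_torus :: "plane_fun set" where
  "Linf_torus = {f. periodic f \<and> f \<in> borel_measurable torus \<and>
     esssup torus (\<lambda>x. ereal \<bar>f x\<bar>) < \<infinity>}"

definition L2_torus :: "plane_fun set" where
  "L2_torus = {f. periodic f \<and> f \<in> borel_measurable torus \<and>
     integrable torus (\<lambda>x. (f x)\<^sup>2)}"

definition L2_norm_torus :: "plane_fun \<Rightarrow> real" where
  "L2_norm_torus f = sqrt (\<integral>x. (f x)\<^sup>2 \<partial>torus)"


definition partial1 :: "plane_fun \<Rightarrow> plane_fun" where
  "partial1 f = (\<lambda>(x, y). deriv (\<lambda>t. f (t, y)) x)"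

definition partial2 :: "plane_fun \<Rightarrow> plane_fun" where
  "partial2 f = (\<lambda>(x, y). deriv (\<lambda>t. f (x, t)) y)"

primrec C_k :: "nat \<Rightarrow> plane_fun \<Rightarrow> bool" where
  "C_k 0 f \<longleftrightarrow> continuous_on UNIV f"
| "C_k (Suc k) f \<longleftrightarrow>
     (\<forall>z. f differentiable (at z)) \<and> C_k k (partial1 f) \<and> C_k k (partial2 f)"

definition smooth_torus :: "plane_fun set" where
  "smooth_torus = {\<phi>. periodic \<phi> \<and> (\<forall>k. C_k k \<phi>)}"

text \<open>
  \<open>has_weak_partial a b u w\<close>: \<open>w\<close> is the weak derivative of \<open>u\<close> of order \<open>a\<close> in the first and
  \<open>b\<close> in the second variable. The torus has no boundary, so all smooth functions are
  test functions.
\<close>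

definition has_weak_partial :: "nat \<Rightarrow> nat \<Rightarrow> plane_fun \<Rightarrow> plane_fun \<Rightarrow> bool" where
  "has_weak_partial a b u w \<longleftrightarrow>
     (\<forall>\<phi>\<in>smooth_torus.
        (\<integral>x. u x * (partial1 ^^ a) ((partial2 ^^ b) \<phi>) x \<partial>torus)
          = (- 1) ^ (a + b) * (\<integral>x. w x * \<phi> x \<partial>torus))"

definition H2_torus :: "plane_fun set" where
  "H2_torus = {u \<in> L2_torus. \<forall>a b. a + b \<le> 2 \<longrightarrow> (\<exists>w\<in>L2_torus. has_weak_partial a b u w)}"

text \<open>
  For \<open>u\<close> in \<open>H2_torus\<close> and \<open>a + b \<le> 2\<close> the choice below is unique up to a null set,
  so it does not affect any integral.
\<close>

definition weak_partial :: "nat \<Rightarrow> nat \<Rightarrow> plane_fun \<Rightarrow> plane_fun" where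
  "weak_partial a b u = (SOME w. w \<in> L2_torus \<and> has_weak_partial a b u w)"

definition laplacian :: "plane_fun \<Rightarrow> plane_fun" where
  "laplacian u = (\<lambda>x. weak_partial 2 0 u x + weak_partial 0 2 u x)"

text \<open>
  Weak solutions of \<open>\<Delta>\<^sup>2 u = l u + r |u|\<^sup>p\<^sup>-\<^sup>2 u\<close>. All integrands are integrable when \<open>p > 2\<close> and
  \<open>r\<close> is in \<open>Linf_torus\<close>: in two dimensions functions in \<open>H2_torus\<close> are essentially bounded.
\<close>

definition weak_solution :: "real \<Rightarrow> plane_fun \<Rightarrow> real \<Rightarrow> plane_fun \<Rightarrow> bool" where
  "weak_solution p r l u \<longleftrightarrow> u \<in> H2_torus \<and>
     (\<forall>v\<in>H2_torus.
        (\<integral>x. laplacian u x * laplacian v x \<partial>torus)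
          = l * (\<integral>x. u x * v x \<partial>torus)
            + (\<integral>x. r x * \<bar>u x\<bar> powr (p - 2) * u x * v x \<partial>torus))"

definition sign_changing :: "plane_fun \<Rightarrow> bool" where
  "sign_changing u \<longleftrightarrow>
     \<not> (AE x in torus. max (u x) 0 = 0) \<and> \<not> (AE x in torus. max (- u x) 0 = 0)"

end

theory Submission
  imports Defs
begin

text \<open>
  Write \<open>V\<close> for the eigenspace of the Laplacian with \<open>|k|\<^sup>2 = 4\<^sup>j\<close>. Two facts about lattice points drive the
  proof. The only integer solutions of \<open>a\<^sup>2 + b\<^sup>2 = 4\<^sup>j\<close> have a vanishing coordinate, so \<open>V\<close> has dimension
  four and its functions of a given \<open>L\<^sup>2\<close> norm are bounded independently of \<open>j\<close>. The eigenvalues of the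
  bilaplacian are squares of integers, so \<open>16\<^sup>j\<close> is separated from the others by a gap of at least \<open>4\<^sup>j\<close>.
  Near \<open>V\<close> the nonlinear term is thus a bounded perturbation of an operator with a huge gap.

  This is exploited by a Lyapunov-Schmidt reduction on the sphere of mass \<open>\<mu>\<close>. Write \<open>u = s E a + w\<close> with \<open>a\<close> a
  unit vector of \<open>\<real>\<^sup>4\<close>, \<open>E\<close> an isometry onto \<open>V\<close>, \<open>w\<close> orthogonal to \<open>V\<close> and \<open>s\<^sup>2 = \<mu> - |w|\<^sup>2\<close>. With
  \<open>N(u) = r |u|\<^sup>p\<^sup>-\<^sup>2 u\<close>, \<open>c = \<langle>N(u), E a\<rangle> / s\<close> and \<open>\<lambda> = 16\<^sup>j - c\<close>, the equation becomes the pair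
  \<open>w = K (N(u) - c w)\<close> and \<open>\<langle>N(u), E x\<rangle> = c s (x \<bullet> a)\<close> for all \<open>x\<close>, where \<open>K\<close> inverts \<open>\<Delta>\<^sup>2 - 16\<^sup>j\<close> on the
  complement of \<open>V\<close>. The norm of \<open>K\<close> from \<open>L\<^sup>2\<close> to the sup norm tends to zero (\<open>weight_bound_eventually\<close>),
  so the first equation has a small solution \<open>w(a)\<close> by contraction. The second one holds where the
  reduced energy \<open>a \<mapsto> J(s E a + w(a))\<close> is minimal on the unit sphere of \<open>\<real>\<^sup>4\<close>: since \<open>w(a)\<close> makes the energy
  stationary, the variation of \<open>w(a)\<close> contributes only to second order (\<open>reduced_expansion\<close>), and a linear
  form that is extremal on a sphere up to second order is parallel to the extremal point
  (\<open>linear_functional_parallel\<close>). As \<open>c\<close> is bounded, \<open>\<lambda> \<rightarrow> \<infinity>\<close>. The power is first replaced by a bounded Lipschitz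
  function; the solutions obey a sup bound below the level of truncation, so they do not see it.

  The weak formulation is handled by Fourier coefficients in the real orthonormal basis
  \<open>(cos (k \<cdot> x) + sin (k \<cdot> x)) / 2\<pi>\<close>. With Parseval's identity the weak equation reduces to \<open>|k|\<^sup>4 u\<^sub>k = f\<^sub>k\<close> for
  all \<open>k\<close>, \<open>f\<close> being the right-hand side (\<open>H2_of_coef\<close>, \<open>weak_equation_of_coef\<close>). At \<open>k = 0\<close> it says that \<open>f\<close> has mean
  zero, which is impossible for \<open>\<lambda> > 0\<close> if \<open>u\<close> has one sign: every solution found is sign-changing.
\<close>

section \<open>Reduction of a constrained functional to a sphere\<close>

text \<open>
  The discriminant criterion behind the Cauchy-Schwarz inequality for forms that may be degenerate:
  if \<open>C = 0\<close>, a large \<open>t\<close> of the right sign forces \<open>B = 0\<close>; otherwise \<open>C > 0\<close> and the minimum is at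
  \<open>t = - B / C\<close>.
\<close>

lemma square_le_of_nonneg_quadratic:
  fixes A B C :: real
  assumes "\<And>t. A + 2 * t * B + t\<^sup>2 * C \<ge> 0"
  shows "B\<^sup>2 \<le> A * C"
proof (cases "C = 0")
  case True
  have "B = 0"
  proof (rule ccontr)
    assume "B \<noteq> 0"
    with assms[of "- (A + 1) / (2 * B)"] True show False by (simp add: field_simps)
  qed
  with True show ?thesis by simp
next
  case False
  have "C \<ge> 0"
  proof (rule ccontr)
    assume "\<not> C \<ge> 0"
    \<comment> \<open>At this \<open>t\<close> the quadratic term outweighs the other two.\<close>
    define t where "t = max 1 ((\<bar>A\<bar> + 2 * \<bar>B\<bar> + 1) / (- C))"
    have t: "t \<ge> 1" and "(\<bar>A\<bar> + 2 * \<bar>B\<bar> + 1) / (- C) \<le> t" by (auto simp: t_def)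
    then have "\<bar>A\<bar> + 2 * \<bar>B\<bar> + 1 \<le> t * (- C)"
      using \<open>\<not> C \<ge> 0\<close> by (simp add: field_simps)
    then have "t * (\<bar>A\<bar> + 2 * \<bar>B\<bar> + 1) \<le> t * (t * (- C))"
      using t by (intro mult_left_mono) auto
    moreover have "\<bar>A\<bar> + 1 \<le> t * (\<bar>A\<bar> + 1)"
      using t mult_right_mono[of 1 t "\<bar>A\<bar> + 1"] by auto
    moreover have "t * B \<le> t * \<bar>B\<bar>" using t by (intro mult_left_mono) auto
    ultimately have "A + 2 * t * B + t\<^sup>2 * C < 0"
      by (simp add: algebra_simps power2_eq_square)
    with assms[of t] show False by simp
  qed
  with False have "C > 0" by simp
  with assms[of "- B / C"] show ?thesis
    by (simp add: field_simps power2_eq_square)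
qed

text \<open>
  The functionals that the form \<open>ip\<close> controls. For the \<open>L\<^sup>2\<close> product on bounded continuous functions these
  are the functionals to which Bessel's inequality applies; boundedness in the sup norm would not
  be enough for that.
\<close>

definition functional :: "('x::real_vector \<Rightarrow> 'x \<Rightarrow> real) \<Rightarrow> ('x \<Rightarrow> real) \<Rightarrow> bool" where
  "functional ip \<phi> \<longleftrightarrow> linear \<phi> \<and> (\<exists>C. \<forall>y. \<bar>\<phi> y\<bar> \<le> C * sqrt (ip y y))"

text \<open>
  Two norms are in play. The Banach norm, later the sup norm, is the one in which the contraction
  runs and in which the gradient \<open>DG\<close> of \<open>G\<close> is Lipschitz. The form \<open>ip\<close>, later the \<open>L\<^sup>2\<close> product, defines
  the constraint \<open>ip u u = \<mu>\<close> and measures functionals. The form may be degenerate, because functions on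
  the plane can vanish on the fundamental square.
\<close>

locale constrained_functional =
  fixes ip :: "'x::banach \<Rightarrow> 'x \<Rightarrow> real"
    and G :: "'x \<Rightarrow> real" and DG :: "'x \<Rightarrow> 'x \<Rightarrow> real"
    and \<theta> \<eta> B L \<mu> :: real
  assumes ip_linear: "linear (\<lambda>x. ip x y)"
    and ip_commute: "ip x y = ip y x"
    and ip_nonneg: "ip x x \<ge> 0"
    and ip_bound: "ip x x \<le> (\<theta> * norm x)\<^sup>2"
    and DG_linear: "linear (DG x)"
    and DG_bound: "\<bar>DG x y\<bar> \<le> B * sqrt (ip y y)"
    and DG_Lipschitz: "\<bar>DG x y - DG x' y\<bar> \<le> L * norm (x - x') * sqrt (ip y y)"
    and G_diff: "\<bar>G (x + h) - G x - DG x h\<bar> \<le> L * (norm h)\<^sup>2"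
    and nonneg: "\<theta> \<ge> 1" "\<eta> \<ge> 1" "B \<ge> 1" "L \<ge> 1" "\<mu> > 0"
begin

definition seminorm :: "'x \<Rightarrow> real" where "seminorm x = sqrt (ip x x)"

lemma ip_simps:
  "ip (x + y) z = ip x z + ip y z" "ip z (x + y) = ip z x + ip z y"
  "ip (x - y) z = ip x z - ip y z" "ip z (x - y) = ip z x - ip z y"
  "ip (c *\<^sub>R x) z = c * ip x z" "ip z (c *\<^sub>R x) = c * ip z x" "ip 0 z = 0" "ip z 0 = 0"
  using linear_add[OF ip_linear] linear_diff[OF ip_linear] linear_scale[OF ip_linear]
    linear_0[OF ip_linear] by (simp_all add: ip_commute[of z])

lemma seminorm_nonneg: "seminorm x \<ge> 0" and seminorm_sq: "(seminorm x)\<^sup>2 = ip x x"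
  by (simp_all add: seminorm_def ip_nonneg)

lemma seminorm_le_norm: "seminorm x \<le> \<theta> * norm x"
  unfolding seminorm_def using nonneg by (intro real_le_lsqrt) (auto simp: ip_bound)

lemma ip_le: "\<bar>ip x y\<bar> \<le> seminorm x * seminorm y"
proof -
  have "(ip x y)\<^sup>2 \<le> ip x x * ip y y"
  proof (rule square_le_of_nonneg_quadratic)
    fix t
    have "0 \<le> ip (x + t *\<^sub>R y) (x + t *\<^sub>R y)" by (rule ip_nonneg)
    then show "0 \<le> ip x x + 2 * t * ip x y + t\<^sup>2 * ip y y"
      by (simp add: ip_simps ip_commute[of y x] algebra_simps power2_eq_square)
  qed
  also have "\<dots> = (seminorm x * seminorm y)\<^sup>2" by (simp add: power_mult_distrib seminorm_sq)
  finally have "\<bar>ip x y\<bar> \<le> \<bar>seminorm x * seminorm y\<bar>" by (simp only: abs_le_square_iff)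
  then show ?thesis by (simp add: seminorm_nonneg)
qed

lemma DG_simps: "DG x (y + z) = DG x y + DG x z" "DG x (y - z) = DG x y - DG x z"
  "DG x (c *\<^sub>R y) = c * DG x y"
  using linear_add[OF DG_linear] linear_diff[OF DG_linear] linear_scale[OF DG_linear] by simp_all

text \<open>
  The factor \<open>s\<close> that puts \<open>s E a + w\<close> on the sphere of mass \<open>\<mu>\<close> when \<open>a\<close> is a unit vector and \<open>w\<close> is
  orthogonal to the range of the isometry \<open>E\<close>.
\<close>

definition amplitude :: "'x \<Rightarrow> real" where "amplitude w = sqrt (\<mu> - ip w w)"

definition state :: "('e::euclidean_space \<Rightarrow> 'x) \<Rightarrow> 'e \<Rightarrow> 'x \<Rightarrow> 'x" where
  "state E a w = amplitude w *\<^sub>R E a + w"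

definition multiplier :: "('e::euclidean_space \<Rightarrow> 'x) \<Rightarrow> 'e \<Rightarrow> 'x \<Rightarrow> real" where
  "multiplier E a w = DG (state E a w) (E a) / amplitude w"

text \<open>
  The right-hand side \<open>N(u) - c w\<close> of the equation for \<open>w\<close>, as a functional. The Lagrange multiplier \<open>c\<close> comes
  from the dependence of the amplitude on \<open>w\<close>.
\<close>

definition residual :: "('e::euclidean_space \<Rightarrow> 'x) \<Rightarrow> 'e \<Rightarrow> 'x \<Rightarrow> 'x \<Rightarrow> real" where
  "residual E a w = (\<lambda>y. DG (state E a w) y - multiplier E a w * ip w y)"

text \<open>
  A lower bound for the amplitude when \<open>|w|\<^sup>2 \<le> \<mu> / 4\<close>; it keeps the division by the amplitude harmless.
\<close>

abbreviation "\<sigma> \<equiv> sqrt \<mu> / 2"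

definition "lip_state = (\<theta> * \<eta> + 1) + sqrt \<mu> * \<eta>"
definition "lip_multiplier = (L * lip_state + B) / \<sigma> + B * \<theta> / \<sigma>\<^sup>2"
definition "lip_residual = L * lip_state + lip_multiplier * sqrt \<mu> + B * \<theta> / \<sigma>"

definition small :: "'x \<Rightarrow> bool" where "small w \<longleftrightarrow> norm w \<le> min 1 (\<sigma> / \<theta>)"

lemma \<sigma>_pos: "\<sigma> > 0" using nonneg by simp

lemma lip_pos: "lip_state > 0" "lip_multiplier > 0" "lip_residual > 0"
proof -
  show "lip_state > 0" unfolding lip_state_def using nonneg by (intro add_pos_nonneg) auto
  then show "lip_multiplier > 0" unfolding lip_multiplier_def using nonneg \<sigma>_pos
    by (intro add_pos_nonneg divide_pos_pos) auto
  then show "lip_residual > 0" unfolding lip_residual_def using nonneg \<sigma>_pos \<open>lip_state > 0\<close>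
    by (intro add_pos_nonneg add_nonneg_pos) auto
qed

lemma small_seminorm:
  assumes "small w" shows "seminorm w \<le> \<sigma>"
proof -
  have "seminorm w \<le> \<theta> * norm w" by (rule seminorm_le_norm)
  also have "\<dots> \<le> \<theta> * (\<sigma> / \<theta>)"
    using assms nonneg by (intro mult_left_mono) (auto simp: small_def)
  finally show ?thesis using nonneg by simp
qed

lemma amplitude:
  assumes "small w"
  shows "\<sigma> \<le> amplitude w" "amplitude w \<le> sqrt \<mu>" "(amplitude w)\<^sup>2 = \<mu> - ip w w"
proof -
  have "(seminorm w)\<^sup>2 \<le> \<sigma>\<^sup>2" using small_seminorm[OF assms] seminorm_nonneg by (intro power_mono)
  then have *: "ip w w \<le> \<mu> / 4" using nonneg by (simp add: seminorm_sq power_divide)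
  then show "(amplitude w)\<^sup>2 = \<mu> - ip w w" using nonneg by (simp add: amplitude_def)
  show "amplitude w \<le> sqrt \<mu>" using ip_nonneg[of w] by (simp add: amplitude_def)
  show "\<sigma> \<le> amplitude w" unfolding amplitude_def using * nonneg
    by (intro real_le_rsqrt) (auto simp: power_divide)
qed

lemma amplitude_pos: "small w \<Longrightarrow> amplitude w > 0"
  using amplitude(1)[of w] \<sigma>_pos by linarith

lemma small_seminorm': "small w \<Longrightarrow> seminorm w \<le> sqrt \<mu>"
  using small_seminorm[of w] \<sigma>_pos by linarith

text \<open>
  Conjugation removes the square roots: the difference of the squared amplitudes is \<open>- ip (w - z) (w + z)\<close>,
  and \<open>|w|\<close> and \<open>|z|\<close> are at most the corresponding amplitudes.
\<close>

lemma amplitude_Lipschitz: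
  assumes "small w" "small z"
  shows "\<bar>amplitude w - amplitude z\<bar> \<le> \<theta> * norm (w - z)"
proof -
  have "(amplitude w - amplitude z) * (amplitude w + amplitude z) = ip z z - ip w w"
    using amplitude(3)[OF assms(1)] amplitude(3)[OF assms(2)] by (simp add: algebra_simps power2_eq_square)
  also have "\<dots> = - ip (w - z) (w + z)" by (simp add: ip_simps ip_commute[of z w])
  finally have "\<bar>amplitude w - amplitude z\<bar> * (amplitude w + amplitude z) = \<bar>ip (w - z) (w + z)\<bar>"
    using amplitude(1)[OF assms(1)] amplitude(1)[OF assms(2)] \<sigma>_pos
    by (metis abs_minus_cancel abs_mult abs_of_pos add_pos_pos less_le_trans)
  also have "\<dots> = \<bar>ip (w - z) w + ip (w - z) z\<bar>" by (simp add: ip_simps)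
  also have "\<dots> \<le> seminorm (w - z) * seminorm w + seminorm (w - z) * seminorm z"
    using ip_le[of "w - z" w] ip_le[of "w - z" z] by linarith
  also have "\<dots> = seminorm (w - z) * (seminorm w + seminorm z)" by (simp add: algebra_simps)
  also have "\<dots> \<le> seminorm (w - z) * (amplitude w + amplitude z)"
    using amplitude(1)[OF assms(1)] amplitude(1)[OF assms(2)] small_seminorm[OF assms(1)] small_seminorm[OF assms(2)] seminorm_nonneg
    by (intro mult_left_mono) auto
  finally have "\<bar>amplitude w - amplitude z\<bar> \<le> seminorm (w - z)"
    using amplitude(1)[OF assms(1)] amplitude(1)[OF assms(2)] \<sigma>_pos by (simp add: mult_le_cancel_right)
  then show ?thesis using seminorm_le_norm[of "w - z"] by linarith
qed

end

text \<open>
  \<open>E\<close> parametrises an eigenspace isometrically and \<open>K\<close> plays the role of the inverse of the shifted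
  operator on its orthogonal complement. It is small as a map from \<open>ip\<close>-bounded functionals into the
  Banach space, symmetric, and has range orthogonal to that of \<open>E\<close>.
\<close>

locale spectral_reduction = constrained_functional ip G DG \<theta> \<eta> B L \<mu>
  for ip :: "'x::banach \<Rightarrow> 'x \<Rightarrow> real" and G :: "'x \<Rightarrow> real" and DG :: "'x \<Rightarrow> 'x \<Rightarrow> real"
    and \<theta> \<eta> B L \<mu> :: real +
  fixes E :: "'e::euclidean_space \<Rightarrow> 'x" and K :: "('x \<Rightarrow> real) \<Rightarrow> 'x" and \<kappa> :: real
  assumes E_linear: "linear E"
    and E_iso: "ip (E a) (E b) = a \<bullet> b"
    and E_bound: "norm (E a) \<le> \<eta> * norm a"
    and K_0: "K (\<lambda>y. 0) = 0"
    and K_bound: "functional ip \<phi> \<Longrightarrow> functional ip \<psi> \<Longrightarrow> (\<And>y. \<bar>\<phi> y - \<psi> y\<bar> \<le> C * sqrt (ip y y)) \<Longrightarrow>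
          norm (K \<phi> - K \<psi>) \<le> \<kappa> * C"
    and K_sym: "functional ip \<phi> \<Longrightarrow> functional ip \<psi> \<Longrightarrow> \<phi> (K \<psi>) = \<psi> (K \<phi>)"
    and K_orth: "functional ip \<phi> \<Longrightarrow> ip (K \<phi>) (E a) = 0"
    and \<kappa>_nonneg: "\<kappa> \<ge> 0"
    and \<kappa>_small: "\<kappa> * lip_residual \<le> 1 / 2" "\<kappa> * (3 * B) \<le> min 1 (\<sigma> / \<theta>)"
begin

lemma E_diff: "E (a - b) = E a - E b" using linear_diff[OF E_linear] .

lemma DG_E_bound: "\<bar>DG x (E a)\<bar> \<le> B * norm a"
  using DG_bound[of x "E a"] by (simp add: E_iso norm_eq_sqrt_inner)

lemma multiplier_bound:
  assumes "small w" "norm a = 1"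
  shows "\<bar>multiplier E a w\<bar> \<le> B / \<sigma>"
proof -
  have "\<bar>multiplier E a w\<bar> = \<bar>DG (state E a w) (E a)\<bar> / amplitude w"
    using amplitude_pos[OF assms(1)] by (simp add: multiplier_def)
  also have "\<dots> \<le> B / \<sigma>"
    using DG_E_bound[of "state E a w" a] amplitude(1)[OF assms(1)] assms \<sigma>_pos nonneg
    by (intro frac_le) auto
  finally show ?thesis .
qed

lemma residual_bound:
  assumes "small w" "norm a = 1"
  shows "\<bar>residual E a w y\<bar> \<le> 3 * B * seminorm y"
proof -
  have "\<bar>multiplier E a w * ip w y\<bar> \<le> (B / \<sigma>) * (\<sigma> * seminorm y)"
    unfolding abs_mult using multiplier_bound[OF assms] small_seminorm[OF assms(1)] nonneg \<sigma>_pos seminorm_nonneg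
    by (intro mult_mono order_trans[OF ip_le] mult_right_mono) auto
  also have "\<dots> = B * seminorm y" using \<sigma>_pos by simp
  finally have "\<bar>residual E a w y\<bar> \<le> B * seminorm y + B * seminorm y"
    unfolding residual_def using DG_bound[of "state E a w" y] by (auto simp: seminorm_def)
  also have "\<dots> \<le> 3 * B * seminorm y" using nonneg seminorm_nonneg[of y] by (simp add: algebra_simps)
  finally show ?thesis .
qed

lemma residual_functional:
  assumes "small w" "norm a = 1"
  shows "functional ip (residual E a w)"
proof -
  have "linear (residual E a w)"
    by (rule linearI) (auto simp: residual_def DG_simps ip_simps algebra_simps)
  then show ?thesis using residual_bound[OF assms] unfolding functional_def seminorm_def by blast
qed

lemma functional_0: "functional ip (\<lambda>y. 0)"
  by (auto simp: functional_def intro: linearI exI[of _ 0])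

lemma state_Lipschitz:
  assumes "small w" "small z" "norm a = 1" "norm b = 1"
  shows "norm (state E a w - state E b z) \<le> lip_state * (norm (a - b) + norm (w - z))"
proof -
  let ?d = "norm (a - b)" and ?e = "norm (w - z)"
  have "state E a w - state E b z = (amplitude w - amplitude z) *\<^sub>R E a + amplitude z *\<^sub>R E (a - b) + (w - z)"
    by (simp add: state_def E_diff algebra_simps)
  then have "norm (state E a w - state E b z)
      \<le> \<bar>amplitude w - amplitude z\<bar> * norm (E a) + \<bar>amplitude z\<bar> * norm (E (a - b)) + ?e"
    using norm_triangle_ineq[of "(amplitude w - amplitude z) *\<^sub>R E a + amplitude z *\<^sub>R E (a - b)" "w - z"]
      norm_triangle_ineq[of "(amplitude w - amplitude z) *\<^sub>R E a" "amplitude z *\<^sub>R E (a - b)"] by simp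
  also have "\<dots> \<le> (\<theta> * ?e) * \<eta> + sqrt \<mu> * (\<eta> * ?d) + ?e"
    using amplitude_Lipschitz[OF assms(1,2)] amplitude[OF assms(2)] E_bound[of a] E_bound[of "a - b"] assms nonneg \<sigma>_pos
    by (intro add_mono mult_mono) auto
  also have "\<dots> \<le> lip_state * (?d + ?e)"
  proof -
    have "(\<theta> * \<eta> + 1) * ?d \<ge> 0" "sqrt \<mu> * \<eta> * ?e \<ge> 0" using nonneg by auto
    then show ?thesis by (simp add: lip_state_def algebra_simps)
  qed
  finally show ?thesis .
qed

lemma multiplier_Lipschitz:
  assumes "small w" "small z" "norm a = 1" "norm b = 1"
  shows "\<bar>multiplier E a w - multiplier E b z\<bar> \<le> lip_multiplier * (norm (a - b) + norm (w - z))"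
proof -
  let ?D = "norm (a - b) + norm (w - z)"
  let ?u = "state E a w" and ?v = "state E b z"
  note s = amplitude(1)[OF assms(1)] amplitude(1)[OF assms(2)]
  have spos: "amplitude w > 0" "amplitude z > 0" using amplitude_pos assms by auto
  have "\<bar>DG ?u (E a) - DG ?v (E b)\<bar> \<le> \<bar>DG ?u (E a) - DG ?v (E a)\<bar> + \<bar>DG ?v (E (a - b))\<bar>"
    by (simp add: E_diff DG_simps)
  also have "\<dots> \<le> L * (lip_state * ?D) + B * ?D"
  proof (rule add_mono)
    have "\<bar>DG ?u (E a) - DG ?v (E a)\<bar> \<le> L * norm (?u - ?v)"
      using DG_Lipschitz[of ?u "E a" ?v] assms by (simp add: E_iso flip: power2_norm_eq_inner)
    also have "\<dots> \<le> L * (lip_state * ?D)"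
      using state_Lipschitz[OF assms] nonneg by (intro mult_left_mono) auto
    finally show "\<bar>DG ?u (E a) - DG ?v (E a)\<bar> \<le> L * (lip_state * ?D)" .
    have "\<bar>DG ?v (E (a - b))\<bar> \<le> B * norm (a - b)" by (rule DG_E_bound)
    also have "\<dots> \<le> B * ?D" using nonneg by (intro mult_left_mono) auto
    finally show "\<bar>DG ?v (E (a - b))\<bar> \<le> B * ?D" .
  qed
  finally have 1: "\<bar>DG ?u (E a) - DG ?v (E b)\<bar> \<le> (L * lip_state + B) * ?D" by (simp add: algebra_simps)
  have 2: "\<bar>1 / amplitude w - 1 / amplitude z\<bar> \<le> \<theta> * ?D / \<sigma>\<^sup>2"
  proof -
    have "\<bar>1 / amplitude w - 1 / amplitude z\<bar> = \<bar>amplitude w - amplitude z\<bar> / (amplitude w * amplitude z)"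
      using spos by (simp add: abs_if field_simps)
    also have "\<dots> \<le> (\<theta> * ?D) / (\<sigma> * \<sigma>)"
    proof (rule frac_le)
      show "\<bar>amplitude w - amplitude z\<bar> \<le> \<theta> * ?D"
        using nonneg by (intro order_trans[OF amplitude_Lipschitz[OF assms(1,2)]] mult_left_mono) auto
      show "\<sigma> * \<sigma> \<le> amplitude w * amplitude z" using s \<sigma>_pos spos by (intro mult_mono) linarith+
    qed (use nonneg in auto)
    finally show ?thesis by (simp add: power2_eq_square)
  qed
  have "multiplier E a w - multiplier E b z
      = (DG ?u (E a) - DG ?v (E b)) / amplitude w + DG ?v (E b) * (1 / amplitude w - 1 / amplitude z)"
    by (simp add: multiplier_def diff_divide_distrib algebra_simps)
  then have "\<bar>multiplier E a w - multiplier E b z\<bar>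
      \<le> \<bar>DG ?u (E a) - DG ?v (E b)\<bar> / amplitude w + \<bar>DG ?v (E b)\<bar> * \<bar>1 / amplitude w - 1 / amplitude z\<bar>"
    using spos by (metis abs_divide abs_mult abs_of_pos abs_triangle_ineq)
  also have "\<dots> \<le> (L * lip_state + B) * ?D / \<sigma> + B * (\<theta> * ?D / \<sigma>\<^sup>2)"
    using 1 2 DG_E_bound[of ?v b] assms s spos \<sigma>_pos nonneg lip_pos
    by (intro add_mono frac_le mult_mono) auto
  also have "\<dots> = lip_multiplier * ?D" by (simp add: lip_multiplier_def algebra_simps add_divide_distrib)
  finally show ?thesis .
qed

lemma residual_Lipschitz:
  assumes "small w" "small z" "norm a = 1" "norm b = 1"
  shows "\<bar>residual E a w y - residual E b z y\<bar> \<le> lip_residual * (norm (a - b) + norm (w - z)) * seminorm y"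
proof -
  let ?D = "norm (a - b) + norm (w - z)"
  let ?u = "state E a w" and ?v = "state E b z"
  let ?c = "multiplier E a w" and ?d = "multiplier E b z"
  have "residual E a w y - residual E b z y = (DG ?u y - DG ?v y) - (?c - ?d) * ip w y - ?d * ip (w - z) y"
    by (simp add: residual_def ip_simps algebra_simps)
  then have "\<bar>residual E a w y - residual E b z y\<bar>
      \<le> \<bar>DG ?u y - DG ?v y\<bar> + \<bar>?c - ?d\<bar> * \<bar>ip w y\<bar> + \<bar>?d\<bar> * \<bar>ip (w - z) y\<bar>"
    unfolding abs_mult[symmetric] by linarith
  also have "\<dots> \<le> L * (lip_state * ?D) * seminorm y + (lip_multiplier * ?D) * (sqrt \<mu> * seminorm y) + (B / \<sigma>) * (\<theta> * ?D * seminorm y)"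
  proof (intro add_mono)
    have "\<bar>DG ?u y - DG ?v y\<bar> \<le> L * norm (?u - ?v) * seminorm y"
      using DG_Lipschitz[of ?u y ?v] by (simp add: seminorm_def)
    also have "\<dots> \<le> L * (lip_state * ?D) * seminorm y"
      using state_Lipschitz[OF assms] nonneg seminorm_nonneg by (intro mult_right_mono mult_left_mono) auto
    finally show "\<bar>DG ?u y - DG ?v y\<bar> \<le> L * (lip_state * ?D) * seminorm y" .
    have "\<bar>ip w y\<bar> \<le> sqrt \<mu> * seminorm y"
      using small_seminorm'[OF assms(1)] seminorm_nonneg
      by (intro order_trans[OF ip_le] mult_right_mono) auto
    then show "\<bar>?c - ?d\<bar> * \<bar>ip w y\<bar> \<le> (lip_multiplier * ?D) * (sqrt \<mu> * seminorm y)"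
      using multiplier_Lipschitz[OF assms] lip_pos nonneg by (intro mult_mono) auto
    have "\<bar>ip (w - z) y\<bar> \<le> (\<theta> * norm (w - z)) * seminorm y"
      using seminorm_le_norm seminorm_nonneg by (intro order_trans[OF ip_le] mult_right_mono) auto
    also have "\<dots> \<le> \<theta> * ?D * seminorm y"
      using nonneg seminorm_nonneg by (intro mult_right_mono mult_left_mono) auto
    finally show "\<bar>?d\<bar> * \<bar>ip (w - z) y\<bar> \<le> (B / \<sigma>) * (\<theta> * ?D * seminorm y)"
      using multiplier_bound[OF assms(2,4)] nonneg \<sigma>_pos by (intro mult_mono) auto
  qed
  also have "\<dots> = lip_residual * ?D * seminorm y" by (simp add: lip_residual_def algebra_simps add_divide_distrib)
  finally show ?thesis .
qed

lemma K_residual_Lipschitz: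
  assumes "small w" "small z" "norm a = 1" "norm b = 1"
  shows "norm (K (residual E a w) - K (residual E b z)) \<le> (norm (a - b) + norm (w - z)) / 2"
proof -
  have "norm (K (residual E a w) - K (residual E b z)) \<le> \<kappa> * (lip_residual * (norm (a - b) + norm (w - z)))"
    using residual_functional assms residual_Lipschitz[OF assms] by (intro K_bound) (auto simp: seminorm_def)
  also have "\<dots> = (\<kappa> * lip_residual) * (norm (a - b) + norm (w - z))" by simp
  also have "\<dots> \<le> (1 / 2) * (norm (a - b) + norm (w - z))"
    using \<kappa>_small by (intro mult_right_mono) auto
  finally show ?thesis by simp
qed

lemma K_residual_norm:
  assumes "small w" "norm a = 1"
  shows "norm (K (residual E a w)) \<le> \<kappa> * (3 * B)"
  using K_bound[OF residual_functional[OF assms] functional_0, of "3 * B"] residual_bound[OF assms]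
  by (simp add: K_0 seminorm_def)

lemma K_residual_small:
  assumes "small w" "norm a = 1"
  shows "small (K (residual E a w))"
  using K_residual_norm[OF assms] \<kappa>_small unfolding small_def by linarith

text \<open>
  Contraction with factor one half on a ball of small \<open>w\<close>.
\<close>

lemma ex_correction:
  assumes "norm a = 1"
  shows "\<exists>w. small w \<and> K (residual E a w) = w"
proof -
  define S :: "'x set" where "S = {w. small w}"
  have S_eq: "S = cball 0 (min 1 (\<sigma> / \<theta>))" by (auto simp: S_def small_def)
  have "\<exists>!w\<in>S. K (residual E a w) = w"
  proof (rule Banach_fix)
    show "complete S" unfolding S_eq by (simp add: complete_eq_closed)
    show "S \<noteq> {}" unfolding S_eq using nonneg less_imp_le[OF \<sigma>_pos] by (auto simp: not_less)
    show "(\<lambda>w. K (residual E a w)) ` S \<subseteq> S" using K_residual_small assms by (auto simp: S_def)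
    show "dist (K (residual E a w)) (K (residual E a z)) \<le> 1 / 2 * dist w z" if "w \<in> S" "z \<in> S" for w z
      using K_residual_Lipschitz[of w z a a] that assms by (simp add: S_def dist_norm)
  qed auto
  then show ?thesis by (auto simp: S_def)
qed

definition correction :: "'e \<Rightarrow> 'x" where
  "correction a = (SOME w. small w \<and> K (residual E a w) = w)"

lemma correction: assumes "norm a = 1" shows "small (correction a)" "K (residual E a (correction a)) = correction a"
  using someI_ex[OF ex_correction[OF assms]] by (simp_all add: correction_def)

text \<open>
  Half of the distance of the corrections is absorbed on the left-hand side.
\<close>

lemma correction_Lipschitz:
  assumes "norm a = 1" "norm b = 1"
  shows "norm (correction a - correction b) \<le> norm (a - b)"
  using K_residual_Lipschitz[OF correction(1)[OF assms(1)] correction(1)[OF assms(2)] assms]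
    correction(2)[OF assms(1)] correction(2)[OF assms(2)] by simp

text \<open>
  The constrained energy of \<open>s E a + w(a)\<close> without its constant part. If \<open>w = K f\<close>, then \<open>f w\<close> is the value at
  \<open>w\<close> of the quadratic form of the shifted operator; in this way the unbounded operator does not occur.
\<close>

definition reduced :: "'e \<Rightarrow> real" where
  "reduced a = residual E a (correction a) (correction a) / 2 - G (state E a (correction a))"

definition "expansion_const = lip_residual * \<theta> + 4 * L * lip_state\<^sup>2 + \<theta> * B + (B / \<sigma>) * \<theta>\<^sup>2"

lemma abs_combination_le:
  fixes R :: real
  assumes "R = x / 2 - y - p + q" "\<bar>x\<bar> \<le> 2 * c1" "\<bar>y\<bar> \<le> c2" "\<bar>p\<bar> \<le> c3" "\<bar>q\<bar> \<le> c4"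
  shows "\<bar>R\<bar> \<le> c1 + c2 + c3 + c4"
  using assms by linarith

text \<open>
  The envelope principle in quantitative form. In the variation of the energy the terms linear in
  \<open>w(a) - w(b)\<close> cancel because \<open>w(b)\<close> solves its equation, so the first-order term is the one for a frozen
  correction. Since \<open>w\<close> is Lipschitz, all remainders are quadratic in \<open>|a - b|\<close>.
\<close>

lemma reduced_expansion:
  assumes a: "norm a = 1" and b: "norm b = 1"
  shows "\<bar>reduced a - reduced b + amplitude (correction b) * DG (state E b (correction b)) (E (a - b))\<bar>
           \<le> expansion_const * (norm (a - b))\<^sup>2"
proof -
  define \<Delta> where "\<Delta> = norm (a - b)"
  define d where "d = correction a - correction b"
  define fa where "fa = residual E a (correction a)"
  define fb where "fb = residual E b (correction b)"
  define ua where "ua = state E a (correction a)"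
  define ub where "ub = state E b (correction b)"
  define sa where "sa = amplitude (correction a)"
  define sb where "sb = amplitude (correction b)"
  define cb where "cb = multiplier E b (correction b)"
  have \<Delta>: "\<Delta> \<ge> 0" by (simp add: \<Delta>_def)
  note sm = correction(1)[OF a] correction(1)[OF b]
  have fn: "functional ip fa" "functional ip fb" using residual_functional sm a b by (auto simp: fa_def fb_def)
  have lin: "linear fa" "linear fb" using fn by (auto simp: functional_def)
  have K: "K fa = correction a" "K fb = correction b" using correction(2) a b by (auto simp: fa_def fb_def)
  have d: "norm d \<le> \<Delta>" using correction_Lipschitz[OF a b] by (simp add: d_def \<Delta>_def)
  have snd: "seminorm d \<le> \<theta> * \<Delta>"
    using seminorm_le_norm[of d] d nonneg mult_left_mono[of "norm d" \<Delta> \<theta>] by linarith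
  have sab: "\<bar>sa - sb\<bar> \<le> \<theta> * \<Delta>"
    unfolding sa_def sb_def using d nonneg
    by (intro order_trans[OF amplitude_Lipschitz[OF sm]] mult_left_mono) (auto simp: d_def)

  \<comment> \<open>Symmetry of \<open>K\<close> turns the difference of the quadratic parts into twice the linear term \<open>fb d\<close>.\<close>
  have "fa (correction b) = fb (correction a)" using K_sym[OF fn] K by simp
  then have quad: "fa (correction a) - fb (correction b) = 2 * fb d + (fa d - fb d)"
    by (simp add: d_def linear_diff[OF lin(1)] linear_diff[OF lin(2)])
  have R1: "\<bar>fa d - fb d\<bar> \<le> 2 * (lip_residual * \<theta> * \<Delta>\<^sup>2)"
  proof -
    have "\<bar>fa d - fb d\<bar> \<le> lip_residual * (\<Delta> + norm d) * seminorm d"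
      using residual_Lipschitz[OF sm a b, of d] by (simp add: fa_def fb_def \<Delta>_def d_def)
    also have "\<dots> \<le> lip_residual * (2 * \<Delta>) * (\<theta> * \<Delta>)"
      using d snd lip_pos seminorm_nonneg \<Delta> by (intro mult_mono) auto
    finally show ?thesis by (simp add: power2_eq_square algebra_simps)
  qed
  have R2: "\<bar>G ua - G ub - DG ub (ua - ub)\<bar> \<le> 4 * L * lip_state\<^sup>2 * \<Delta>\<^sup>2"
  proof -
    have "norm (ua - ub) \<le> lip_state * (2 * \<Delta>)"
      unfolding ua_def ub_def using d lip_pos
      by (intro order_trans[OF state_Lipschitz[OF sm a b]] mult_left_mono) (auto simp: \<Delta>_def d_def)
    then have "L * (norm (ua - ub))\<^sup>2 \<le> L * (lip_state * (2 * \<Delta>))\<^sup>2"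
      using nonneg by (intro mult_left_mono power_mono) auto
    then show ?thesis using G_diff[of ub "ua - ub"] by (simp add: power_mult_distrib algebra_simps)
  qed
  have "ua - ub = (sa - sb) *\<^sub>R E b + (sa - sb) *\<^sub>R E (a - b) + sb *\<^sub>R E (a - b) + d"
    by (simp add: ua_def ub_def state_def sa_def sb_def d_def E_diff algebra_simps)
  then have Dexp: "DG ub (ua - ub) = (sa - sb) * DG ub (E b) + (sa - sb) * DG ub (E (a - b))
      + sb * DG ub (E (a - b)) + DG ub d"
    by (simp add: DG_simps)
  have R3: "\<bar>(sa - sb) * DG ub (E (a - b))\<bar> \<le> \<theta> * B * \<Delta>\<^sup>2"
  proof -
    have "\<bar>(sa - sb) * DG ub (E (a - b))\<bar> \<le> (\<theta> * \<Delta>) * (B * \<Delta>)"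
      unfolding abs_mult using sab DG_E_bound[of ub "a - b"] nonneg \<Delta>
      by (intro mult_mono) (auto simp: \<Delta>_def)
    then show ?thesis by (simp add: power2_eq_square algebra_simps)
  qed
  have DGb: "DG ub (E b) = cb * sb"
    using amplitude_pos[OF sm(2)] by (simp add: cb_def multiplier_def ub_def sb_def)
  \<comment> \<open>The amplitude to first order: \<open>s\<^sub>b (s\<^sub>a - s\<^sub>b)\<close> is half the difference of the squares, up to second order.\<close>
  have amplitude_diff: "sb * (sa - sb) = - ip (correction b) d - (ip d d + (sa - sb)\<^sup>2) / 2"
  proof -
    have "sa\<^sup>2 - sb\<^sup>2 = - (2 * ip (correction b) d + ip d d)"
      using amplitude(3)[OF sm(1)] amplitude(3)[OF sm(2)]
      by (simp add: sa_def sb_def d_def ip_simps ip_commute[of "correction a" "correction b"])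
    moreover have "sb * (sa - sb) = ((sa\<^sup>2 - sb\<^sup>2) - (sa - sb)\<^sup>2) / 2"
      by (simp add: power2_eq_square field_simps)
    ultimately show ?thesis by (simp add: diff_divide_distrib add_divide_distrib)
  qed
  have "(sa - sb) * DG ub (E b) = cb * (sb * (sa - sb))" by (simp add: DGb)
  then have amplitude_term: "(sa - sb) * DG ub (E b)
      = - cb * ip (correction b) d - cb * ((ip d d + (sa - sb)\<^sup>2) / 2)"
    unfolding amplitude_diff by (simp add: right_diff_distrib)
  have R4: "\<bar>cb * ((ip d d + (sa - sb)\<^sup>2) / 2)\<bar> \<le> (B / \<sigma>) * \<theta>\<^sup>2 * \<Delta>\<^sup>2"
  proof -
    have "ip d d \<le> (\<theta> * \<Delta>)\<^sup>2" using snd seminorm_nonneg power_mono[of "seminorm d" "\<theta> * \<Delta>" 2] by (simp add: seminorm_sq)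
    moreover have "(sa - sb)\<^sup>2 \<le> (\<theta> * \<Delta>)\<^sup>2" using sab abs_le_square_iff[of "sa - sb" "\<theta> * \<Delta>"] nonneg \<Delta> by simp
    ultimately have "\<bar>(ip d d + (sa - sb)\<^sup>2) / 2\<bar> \<le> (\<theta> * \<Delta>)\<^sup>2" using ip_nonneg[of d] by simp
    then have "\<bar>cb * ((ip d d + (sa - sb)\<^sup>2) / 2)\<bar> \<le> (B / \<sigma>) * (\<theta> * \<Delta>)\<^sup>2"
      unfolding abs_mult using multiplier_bound[OF sm(2) b] nonneg \<sigma>_pos
      by (intro mult_mono) (auto simp: cb_def)
    then show ?thesis by (simp add: power_mult_distrib)
  qed
  have fbd: "fb d = DG ub d - cb * ip (correction b) d" by (simp add: fb_def residual_def ub_def cb_def)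
  have "reduced a - reduced b + sb * DG ub (E (a - b))
      = (fa d - fb d) / 2 - (G ua - G ub - DG ub (ua - ub)) - (sa - sb) * DG ub (E (a - b))
        + cb * ((ip d d + (sa - sb)\<^sup>2) / 2)"
  proof -
    have "reduced a - reduced b = (fa (correction a) - fb (correction b)) / 2 - (G ua - G ub)"
      by (simp add: reduced_def fa_def fb_def ua_def ub_def diff_divide_distrib)
    then show ?thesis unfolding quad Dexp amplitude_term fbd
      by (simp add: algebra_simps add_divide_distrib diff_divide_distrib)
  qed
  then have "\<bar>reduced a - reduced b + sb * DG ub (E (a - b))\<bar>
     \<le> lip_residual * \<theta> * \<Delta>\<^sup>2 + 4 * L * lip_state\<^sup>2 * \<Delta>\<^sup>2 + \<theta> * B * \<Delta>\<^sup>2 + (B / \<sigma>) * \<theta>\<^sup>2 * \<Delta>\<^sup>2"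
    using R1 R2 R3 R4 by (rule abs_combination_le)
  also have "\<dots> = expansion_const * \<Delta>\<^sup>2" by (simp add: expansion_const_def algebra_simps)
  finally show ?thesis by (simp add: sb_def ub_def \<Delta>_def)
qed

lemma expansion_const_pos: "expansion_const > 0"
proof -
  have "lip_residual * \<theta> > 0" using lip_pos nonneg by simp
  moreover have "4 * L * lip_state\<^sup>2 \<ge> 0" "\<theta> * B \<ge> 0" "(B / \<sigma>) * \<theta>\<^sup>2 \<ge> 0" using nonneg by simp_all
  ultimately show ?thesis unfolding expansion_const_def by (intro add_pos_nonneg)
qed

lemma reduced_continuous: "continuous_on (sphere 0 1) reduced"
proof (rule lipschitz_on_continuous_on)
  show "(sqrt \<mu> * B + 2 * expansion_const)-lipschitz_on (sphere 0 1) reduced"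
  proof (rule lipschitz_onI)
    fix a b :: 'e
    assume "a \<in> sphere 0 1" "b \<in> sphere 0 1"
    then have a: "norm a = 1" and b: "norm b = 1" by auto
    have "norm (a - b) \<le> 2" using norm_triangle_ineq4[of a b] a b by simp
    then have "expansion_const * (norm (a - b))\<^sup>2 \<le> expansion_const * (2 * norm (a - b))"
      using expansion_const_pos by (simp add: power2_eq_square mult_right_mono)
    moreover have "\<bar>amplitude (correction b) * DG (state E b (correction b)) (E (a - b))\<bar> \<le> sqrt \<mu> * (B * norm (a - b))"
      unfolding abs_mult using amplitude[OF correction(1)[OF b]] \<sigma>_pos nonneg
      by (intro mult_mono DG_E_bound) auto
    ultimately show "dist (reduced a) (reduced b) \<le> (sqrt \<mu> * B + 2 * expansion_const) * dist a b"
      using reduced_expansion[OF a b] by (simp add: dist_norm algebra_simps)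
  qed (use nonneg expansion_const_pos in auto)
qed

text \<open>
  On the unit sphere \<open>|a - b|\<^sup>2 = 2 - 2 (a \<bullet> b)\<close>, so the quadratic error is itself a linear form. Hence \<open>b\<close>
  maximises \<open>a \<mapsto> z \<bullet> a\<close> for a modified vector \<open>z\<close>, and equality in the Cauchy-Schwarz inequality makes \<open>z\<close>,
  and with it \<open>\<psi>\<close>, parallel to \<open>b\<close>.
\<close>

lemma linear_functional_parallel:
  fixes \<psi> :: "'e \<Rightarrow> real"
  assumes lin: "linear \<psi>" and b: "norm b = 1"
    and max: "\<And>a. norm a = 1 \<Longrightarrow> \<psi> a \<le> \<psi> b + C * (norm (a - b))\<^sup>2"
  shows "\<psi> x = \<psi> b * (x \<bullet> b)"
proof -
  define y where "y = adjoint \<psi> 1"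
  have y: "\<psi> x = y \<bullet> x" for x
    using adjoint_works[OF lin, of x 1] by (simp add: y_def inner_commute)
  \<comment> \<open>The error \<open>C |a - b|\<^sup>2\<close> equals \<open>2 C - 2 C (a \<bullet> b)\<close> and is absorbed into the linear form.\<close>
  define z where "z = y + (2 * C) *\<^sub>R b"
  have z: "z \<bullet> a \<le> z \<bullet> b" if "norm a = 1" for a
  proof -
    have "(norm (a - b))\<^sup>2 = 2 - 2 * (a \<bullet> b)"
      using dot_norm_neg[of a b] that b by simp
    then have "y \<bullet> a \<le> y \<bullet> b + C * (2 - 2 * (a \<bullet> b))" using max[OF that] by (simp only: y)
    then show ?thesis
      using b inner_commute[of a b] by (simp add: z_def inner_add_left dot_square_norm algebra_simps)
  qed
  have "z = norm z *\<^sub>R b"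
  proof (cases "z = 0")
    case False
    have zz: "z \<bullet> z = norm z * norm z" by (simp add: dot_square_norm power2_eq_square)
    have "norm z = z \<bullet> (z /\<^sub>R norm z)"
      using False zz by (simp add: field_simps)
    also have "\<dots> \<le> z \<bullet> b" using False by (intro z) simp
    finally have "z \<bullet> b = norm z * norm b" using b norm_cauchy_schwarz[of z b] by simp
    then have "norm z *\<^sub>R b = norm b *\<^sub>R z" by (simp only: norm_cauchy_schwarz_eq)
    then show ?thesis using b by (metis scaleR_one)
  qed simp
  then have "y = (norm z - 2 * C) *\<^sub>R b" by (simp add: z_def algebra_simps)
  then have "\<psi> a = (norm z - 2 * C) * (a \<bullet> b)" for a
    by (metis y inner_scaleR_left inner_commute)
  then show ?thesis using b by (simp add: dot_square_norm)
qed

text \<open>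
  A minimiser of the reduced energy on the compact unit sphere satisfies the remaining,
  finite-dimensional part of the equation.
\<close>

theorem ex_constrained_critical_point:
  "\<exists>a w c. norm a = 1 \<and> norm w \<le> 1 \<and> \<bar>c\<bar> \<le> B / \<sigma> \<and> 0 \<le> amplitude w \<and> amplitude w \<le> sqrt \<mu> \<and>
     functional ip (residual E a w) \<and> K (residual E a w) = w \<and> c = multiplier E a w \<and>
     (\<forall>x. DG (state E a w) (E x) = c * amplitude w * (x \<bullet> a)) \<and>
     ip (state E a w) (state E a w) = \<mu>"
proof -
  obtain b where "b \<in> sphere 0 1" and min: "\<And>a. a \<in> sphere 0 1 \<Longrightarrow> reduced b \<le> reduced a"
  proof (rule continuous_attains_inf[OF _ _ reduced_continuous, THEN bexE])
    show "sphere (0::'e) 1 \<noteq> {}" by simp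
  qed auto
  then have b: "norm b = 1" by simp
  define w where "w = correction b"
  define u where "u = state E b w"
  note w = correction[OF b, folded w_def]
  have s: "amplitude w > 0" using amplitude(1)[OF w(1)] \<sigma>_pos by linarith
  have par: "amplitude w * DG u (E x) = amplitude w * DG u (E b) * (x \<bullet> b)" for x
  proof (rule linear_functional_parallel[OF _ b, of "\<lambda>x. amplitude w * DG u (E x)"])
    show "linear (\<lambda>x. amplitude w * DG u (E x))"
      by (rule linearI) (simp_all add: DG_simps linear_add[OF E_linear] linear_scale[OF E_linear] algebra_simps)
    show "amplitude w * DG u (E a) \<le> amplitude w * DG u (E b) + expansion_const * (norm (a - b))\<^sup>2" if "norm a = 1" for a
      using reduced_expansion[OF that b, folded w_def, folded u_def] min[of a] that
      by (simp add: E_diff DG_simps algebra_simps)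
  qed
  have "DG u (E x) = multiplier E b w * amplitude w * (x \<bullet> b)" for x
    using par[of x] s by (simp add: multiplier_def u_def)
  moreover have "ip w (E b) = 0" using K_orth[OF residual_functional[OF w(1) b]] w(2) by simp
  then have "ip u u = \<mu>"
    using amplitude(3)[OF w(1)] b
    by (simp add: u_def state_def ip_simps E_iso dot_square_norm power2_eq_square ip_commute[of "E b"])
  moreover have "norm w \<le> 1" using w(1) by (simp add: small_def)
  ultimately show ?thesis
    using b w multiplier_bound[OF w(1) b] less_imp_le[OF s] amplitude(2)[OF w(1)] residual_functional[OF w(1) b]
    unfolding u_def by (intro exI[of _ b] exI[of _ w] exI[of _ "multiplier E b w"] conjI allI) auto
qed

end

section \<open>Integration on the torus\<close>

abbreviation "square \<equiv> {0..<2 * pi} \<times> {0..<2 * pi}"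

lemma square_lebesgue: "square \<in> sets lebesgue"
proof -
  have "square \<in> sets borel" by (intro borel_Times) auto
  then show ?thesis by simp
qed

lemma square_lmeasurable: "square \<in> lmeasurable"
  by (intro bounded_set_imp_lmeasurable bounded_Times square_lebesgue) auto

lemma negligible_coordinate_lines:
  fixes c :: real
  shows "negligible {z::real \<times> real. fst z = c}" "negligible {z::real \<times> real. snd z = c}"
  using negligible_standard_hyperplane[of "(1, 0) :: real \<times> real" c]
    negligible_standard_hyperplane[of "(0, 1) :: real \<times> real" c]
  by (auto simp: inner_prod_def Basis_prod_def)

lemma space_torus: "space torus = square"
  by (simp add: torus_def)

interpretation torus: finite_measure torus
  unfolding torus_def by (intro finite_measure_lebesgue_on square_lmeasurable)

lemma AE_torus_I:
  assumes "negligible N" "\<And>z. z \<in> square \<Longrightarrow> z \<notin> N \<Longrightarrow> P z"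
  shows "AE z in torus. P z"
proof -
  have "AE z in lebesgue. z \<in> square \<longrightarrow> P z"
    using assms by (intro AE_I'[of N]) (auto simp: negligible_iff_null_sets)
  then show ?thesis
    unfolding torus_def by (subst AE_restrict_space_iff) (use square_lebesgue in auto)
qed

lemma continuous_bounded_on_square:
  fixes f :: plane_fun
  assumes "continuous_on UNIV f"
  obtains B where "B \<ge> 0" "\<And>z. z \<in> square \<Longrightarrow> \<bar>f z\<bar> \<le> B"
proof -
  have "compact (f ` cbox (0, 0) (2 * pi, 2 * pi))"
    using assms by (intro compact_continuous_image) (auto intro: continuous_on_subset)
  then obtain B where "\<forall>y\<in>f ` cbox (0, 0) (2 * pi, 2 * pi). norm y \<le> B"
    using compact_imp_bounded bounded_iff by metis
  moreover have "square \<subseteq> cbox (0, 0) (2 * pi, 2 * pi)" by (auto simp: cbox_Pair_eq)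
  ultimately have "\<bar>f z\<bar> \<le> max 0 B" if "z \<in> square" for z
    using that by (metis imageI le_max_iff_disj real_norm_def subsetD)
  then show ?thesis using that[of "max 0 B"] by auto
qed

lemma continuous_measurable_torus:
  fixes f :: plane_fun
  assumes "continuous_on UNIV f"
  shows "f \<in> borel_measurable torus"
  unfolding torus_def
  by (intro continuous_imp_measurable_on_sets_lebesgue square_lebesgue continuous_on_subset[OF assms]) auto

lemma bounded_integrable_torus:
  fixes f :: plane_fun
  assumes "f \<in> borel_measurable torus" "\<And>z. z \<in> square \<Longrightarrow> \<bar>f z\<bar> \<le> B"
  shows "integrable torus f"
  using assms by (intro torus.integrable_const_bound[of f B]) (auto simp: space_torus intro!: AE_I2)

lemma continuous_integrable_torus:
  fixes f :: plane_fun
  assumes "continuous_on UNIV f"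
  shows "integrable torus f"
  by (rule continuous_bounded_on_square[OF assms])
    (rule bounded_integrable_torus[OF continuous_measurable_torus[OF assms]])

lemma integral_torus_cbox:
  fixes f :: plane_fun
  assumes "continuous_on UNIV f"
  shows "(\<integral>z. f z \<partial>torus) = integral (cbox (0, 0) (2 * pi, 2 * pi)) f"
proof -
  have "(\<integral>z. f z \<partial>torus) = integral square f"
    using continuous_integrable_torus[OF assms] square_lebesgue
    by (simp add: torus_def lebesgue_integral_eq_integral)
  also have "\<dots> = integral (cbox (0, 0) (2 * pi, 2 * pi)) f"
  proof (rule integral_subset_negligible)
    have "cbox (0, 0) (2 * pi, 2 * pi) - square \<subseteq> {z. fst z = 2 * pi} \<union> {z. snd z = 2 * pi}"
      by (auto simp: cbox_Pair_eq)
    then show "negligible (cbox (0, 0) (2 * pi, 2 * pi) - square)"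
      using negligible_coordinate_lines negligible_Un negligible_subset by blast
  qed (auto simp: cbox_Pair_eq)
  finally show ?thesis .
qed

lemma integral_torus_iterated:
  fixes f :: plane_fun
  assumes "continuous_on UNIV f"
  shows "(\<integral>z. f z \<partial>torus) = integral {0..2 * pi} (\<lambda>x. integral {0..2 * pi} (\<lambda>y. f (x, y)))"
    and "(\<integral>z. f z \<partial>torus) = integral {0..2 * pi} (\<lambda>y. integral {0..2 * pi} (\<lambda>x. f (x, y)))"
proof -
  have c: "continuous_on (cbox (0, 0) (2 * pi, 2 * pi)) (\<lambda>(x, y). f (x, y))"
    using assms by (auto intro: continuous_on_subset)
  show 1: "(\<integral>z. f z \<partial>torus) = integral {0..2 * pi} (\<lambda>x. integral {0..2 * pi} (\<lambda>y. f (x, y)))"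
    using integral_torus_cbox[OF assms] integral_prod_continuous[OF c] by (simp add: case_prod_beta)
  show "(\<integral>z. f z \<partial>torus) = integral {0..2 * pi} (\<lambda>y. integral {0..2 * pi} (\<lambda>x. f (x, y)))"
    using 1 integral_swap_continuous[OF c] by (simp add: case_prod_beta)
qed

text \<open>
  Fubini and the fundamental theorem of calculus in the differentiated variable; the boundary terms
  cancel by periodicity. Both integration by parts and the orthogonality relations rest on this.
\<close>

lemma integral_partial_zero:
  fixes f f' :: plane_fun
  assumes cont: "continuous_on UNIV f'" and per: "periodic f"
  shows "(\<And>x y. ((\<lambda>t. f (t, y)) has_real_derivative f' (x, y)) (at x)) \<Longrightarrow> (\<integral>z. f' z \<partial>torus) = 0"
    and "(\<And>x y. ((\<lambda>t. f (x, t)) has_real_derivative f' (x, y)) (at y)) \<Longrightarrow> (\<integral>z. f' z \<partial>torus) = 0"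
proof -
  assume d: "\<And>x y. ((\<lambda>t. f (t, y)) has_real_derivative f' (x, y)) (at x)"
  have "integral {0..2 * pi} (\<lambda>x. f' (x, y)) = 0" for y
  proof -
    have "((\<lambda>x. f' (x, y)) has_integral f (2 * pi, y) - f (0, y)) {0..2 * pi}"
      using d by (intro fundamental_theorem_of_calculus)
        (auto simp flip: has_real_derivative_iff_has_vector_derivative intro: has_field_derivative_at_within)
    moreover have "f (2 * pi, y) = f (0, y)" using per by (metis add_0 periodic_def)
    ultimately show ?thesis by (simp add: integral_unique)
  qed
  then show "(\<integral>z. f' z \<partial>torus) = 0" by (simp add: integral_torus_iterated(2)[OF cont])
next
  assume d: "\<And>x y. ((\<lambda>t. f (x, t)) has_real_derivative f' (x, y)) (at y)"
  have "integral {0..2 * pi} (\<lambda>y. f' (x, y)) = 0" for x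
  proof -
    have "((\<lambda>y. f' (x, y)) has_integral f (x, 2 * pi) - f (x, 0)) {0..2 * pi}"
      using d by (intro fundamental_theorem_of_calculus)
        (auto simp flip: has_real_derivative_iff_has_vector_derivative intro: has_field_derivative_at_within)
    moreover have "f (x, 2 * pi) = f (x, 0)" using per by (metis add_0 periodic_def)
    ultimately show ?thesis by (simp add: integral_unique)
  qed
  then show "(\<integral>z. f' z \<partial>torus) = 0" by (simp add: integral_torus_iterated(1)[OF cont])
qed

lemma measure_torus: "measure torus square = (2 * pi)\<^sup>2"
proof -
  have "measure torus square = (\<integral>z. 1 \<partial>torus)" by (simp add: space_torus)
  also have "\<dots> = (2 * pi)\<^sup>2" by (subst integral_torus_iterated(1)) (auto simp: power2_eq_square)
  finally show ?thesis .
qed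

section \<open>Square-integrable functions\<close>

definition square_integrable :: "plane_fun \<Rightarrow> bool" where
  "square_integrable f \<longleftrightarrow> f \<in> borel_measurable torus \<and> integrable torus (\<lambda>z. (f z)\<^sup>2)"

definition L2_inner :: "plane_fun \<Rightarrow> plane_fun \<Rightarrow> real" where
  "L2_inner f g = (\<integral>z. f z * g z \<partial>torus)"

lemma L2_torus_iff: "f \<in> L2_torus \<longleftrightarrow> periodic f \<and> square_integrable f"
  by (auto simp: L2_torus_def square_integrable_def)

text \<open>
  \<open>|f g| \<le> f\<^sup>2 + g\<^sup>2\<close> is an integrable majorant.
\<close>

lemma square_integrable_prod:
  assumes f: "square_integrable f" and g: "square_integrable g"
  shows "integrable torus (\<lambda>z. f z * g z)"
proof (rule Bochner_Integration.integrable_bound)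
  show "integrable torus (\<lambda>z. (f z)\<^sup>2 + (g z)\<^sup>2)" using f g by (simp add: square_integrable_def)
  show "AE z in torus. norm (f z * g z) \<le> norm ((f z)\<^sup>2 + (g z)\<^sup>2)"
  proof (rule AE_I2)
    fix z
    have "2 * (\<bar>f z\<bar> * \<bar>g z\<bar>) \<le> (f z)\<^sup>2 + (g z)\<^sup>2"
      using zero_le_power2[of "\<bar>f z\<bar> - \<bar>g z\<bar>"] by (simp add: power2_diff algebra_simps)
    moreover have "0 \<le> \<bar>f z\<bar> * \<bar>g z\<bar>" by simp
    ultimately have "\<bar>f z\<bar> * \<bar>g z\<bar> \<le> (f z)\<^sup>2 + (g z)\<^sup>2" by linarith
    then show "norm (f z * g z) \<le> norm ((f z)\<^sup>2 + (g z)\<^sup>2)" by (simp add: abs_mult)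
  qed
  have [measurable]: "f \<in> borel_measurable torus" "g \<in> borel_measurable torus"
    using f g by (auto simp: square_integrable_def)
  show "(\<lambda>z. f z * g z) \<in> borel_measurable torus" by measurable
qed

lemma square_integrable_add: "square_integrable f \<Longrightarrow> square_integrable g \<Longrightarrow> square_integrable (\<lambda>z. f z + g z)"
  using square_integrable_prod[of f g] by (auto simp: square_integrable_def power2_sum mult.assoc)

lemma square_integrable_cmult: "square_integrable f \<Longrightarrow> square_integrable (\<lambda>z. c * f z)"
  by (auto simp: square_integrable_def power_mult_distrib)

lemma square_integrable_diff: "square_integrable f \<Longrightarrow> square_integrable g \<Longrightarrow> square_integrable (\<lambda>z. f z - g z)"
  using square_integrable_add[of f "\<lambda>z. (-1) * g z"] square_integrable_cmult[of g "-1"] by simp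

lemma square_integrable_bounded:
  assumes [measurable]: "f \<in> borel_measurable torus" and B: "\<And>z. z \<in> square \<Longrightarrow> \<bar>f z\<bar> \<le> B"
  shows "square_integrable f"
proof -
  have "\<bar>(f z)\<^sup>2\<bar> \<le> B\<^sup>2" if "z \<in> square" for z
    using power_mono[OF B[OF that], of 2] by simp
  then have "integrable torus (\<lambda>z. (f z)\<^sup>2)" by (intro bounded_integrable_torus[of _ "B\<^sup>2"]) auto
  then show ?thesis by (simp add: square_integrable_def)
qed

lemma square_integrable_continuous: "continuous_on UNIV f \<Longrightarrow> square_integrable f"
  by (rule continuous_bounded_on_square) (auto intro: square_integrable_bounded continuous_measurable_torus)

lemma square_integrable_sum: "(\<And>k. k \<in> F \<Longrightarrow> square_integrable (f k)) \<Longrightarrow> square_integrable (\<lambda>z. \<Sum>k\<in>F. f k z)"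
proof (induction F rule: infinite_finite_induct)
  case (insert k F)
  then show ?case using square_integrable_add[of "f k" "\<lambda>z. \<Sum>k\<in>F. f k z"] by simp
qed (auto intro: square_integrable_continuous)

lemma L2_inner_commute: "L2_inner f g = L2_inner g f" by (simp add: L2_inner_def mult.commute)

lemma L2_inner_add: "square_integrable f \<Longrightarrow> square_integrable g \<Longrightarrow> square_integrable h \<Longrightarrow> L2_inner (\<lambda>z. f z + g z) h = L2_inner f h + L2_inner g h"
  by (simp add: L2_inner_def distrib_right square_integrable_prod)

lemma L2_inner_diff: "square_integrable f \<Longrightarrow> square_integrable g \<Longrightarrow> square_integrable h \<Longrightarrow> L2_inner (\<lambda>z. f z - g z) h = L2_inner f h - L2_inner g h"
  by (simp add: L2_inner_def left_diff_distrib square_integrable_prod)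

lemma L2_inner_cmult: "L2_inner (\<lambda>z. c * f z) h = c * L2_inner f h"
  by (simp add: L2_inner_def mult.assoc)

lemma L2_inner_sum:
  assumes "\<And>k. k \<in> F \<Longrightarrow> square_integrable (f k)" "square_integrable h"
  shows "L2_inner (\<lambda>z. \<Sum>k\<in>F. f k z) h = (\<Sum>k\<in>F. L2_inner (f k) h)"
  unfolding L2_inner_def sum_distrib_right using assms
  by (intro Bochner_Integration.integral_sum square_integrable_prod) auto

lemma L2_inner_nonneg: "L2_inner f f \<ge> 0" by (simp add: L2_inner_def)

lemma L2_inner_Cauchy_Schwarz:
  assumes "square_integrable f" "square_integrable g"
  shows "\<bar>L2_inner f g\<bar> \<le> sqrt (L2_inner f f) * sqrt (L2_inner g g)"
proof -
  have "(L2_inner f g)\<^sup>2 \<le> L2_inner f f * L2_inner g g"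
  proof (rule square_le_of_nonneg_quadratic)
    fix t
    have "0 \<le> L2_inner (\<lambda>z. f z + t * g z) (\<lambda>z. f z + t * g z)" by (rule L2_inner_nonneg)
    also have "\<dots> = L2_inner f f + 2 * t * L2_inner f g + t\<^sup>2 * L2_inner g g"
    proof -
      define h where "h = (\<lambda>z. f z + t * g z)"
      have h: "square_integrable h" unfolding h_def using assms square_integrable_add square_integrable_cmult by blast
      have exp: "L2_inner h k = L2_inner f k + t * L2_inner g k" if "square_integrable k" for k
        unfolding h_def using assms that by (simp add: L2_inner_add L2_inner_cmult square_integrable_cmult)
      have "L2_inner f h = L2_inner f f + t * L2_inner f g" "L2_inner g h = L2_inner f g + t * L2_inner g g"
        using exp[of f] exp[of g] assms by (simp_all add: L2_inner_commute[of f h] L2_inner_commute[of g h] L2_inner_commute[of g f])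
      with exp[OF h] show ?thesis by (simp add: h_def power2_eq_square algebra_simps)
    qed
    finally show "0 \<le> L2_inner f f + 2 * t * L2_inner f g + t\<^sup>2 * L2_inner g g" .
  qed
  then have "\<bar>L2_inner f g\<bar> \<le> sqrt (L2_inner f f * L2_inner g g)" by (metis real_sqrt_abs real_sqrt_le_mono)
  then show ?thesis by (simp add: real_sqrt_mult)
qed

section \<open>The Hartley basis\<close>

definition phase :: "int \<times> int \<Rightarrow> real \<times> real \<Rightarrow> real" where
  "phase k z = of_int (fst k) * fst z + of_int (snd k) * snd z"

text \<open>
  The real form of the exponential basis due to Hartley. Unlike sines and cosines it needs a single
  family indexed by \<open>\<int>\<^sup>2\<close>, and a partial derivative maps the function of index \<open>k\<close> to a multiple of that of
  index \<open>- k\<close>.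
\<close>

definition hartley :: "int \<times> int \<Rightarrow> plane_fun" where
  "hartley k z = (cos (phase k z) + sin (phase k z)) / (2 * pi)"

definition coef :: "plane_fun \<Rightarrow> int \<times> int \<Rightarrow> real" where
  "coef f k = L2_inner f (hartley k)"

definition norm_sq :: "int \<times> int \<Rightarrow> real" where
  "norm_sq k = (of_int (fst k))\<^sup>2 + (of_int (snd k))\<^sup>2"

lemma phase_simps:
  "phase (- k) z = - phase k z" "phase (k + l) z = phase k z + phase l z"
  "phase (k - l) z = phase k z - phase l z" "phase 0 z = 0"
  "phase k (x + 2 * pi, y) = phase k (x, y) + 2 * pi * of_int (fst k)"
  "phase k (x, y + 2 * pi) = phase k (x, y) + 2 * pi * of_int (snd k)"
  by (simp_all add: phase_def algebra_simps)

lemma continuous_phase [continuous_intros]: "continuous_on S (phase k)"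
  unfolding phase_def[abs_def] by (intro continuous_intros)

lemma continuous_hartley [continuous_intros]: "continuous_on S (hartley k)"
  unfolding hartley_def[abs_def] by (intro continuous_intros) auto

lemma periodic_phase:
  "periodic (\<lambda>z. sin (phase k z))" "periodic (\<lambda>z. cos (phase k z))"
  unfolding periodic_def phase_simps sin_add cos_add cos_int_2pin sin_int_2pin by auto

lemma periodic_hartley: "periodic (hartley k)"
  using periodic_phase[of k] by (simp add: periodic_def hartley_def)

lemma hartley_bound: "\<bar>hartley k z\<bar> \<le> 1"
proof -
  have "\<bar>cos (phase k z) + sin (phase k z)\<bar> \<le> 1 + 1"
    by (intro order_trans[OF abs_triangle_ineq] add_mono) auto
  also have "\<dots> \<le> 2 * pi" using pi_gt3 by simp
  finally show ?thesis by (simp add: hartley_def)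
qed

lemma phase_derivative:
  "((\<lambda>t. phase k (t, y)) has_real_derivative of_int (fst k)) (at x)"
  "((\<lambda>t. phase k (x, t)) has_real_derivative of_int (snd k)) (at y)"
  by (auto simp: phase_def intro!: derivative_eq_intros)

lemma hartley_derivative:
  "((\<lambda>t. hartley k (t, y)) has_real_derivative of_int (fst k) * hartley (- k) (x, y)) (at x)"
  "((\<lambda>t. hartley k (x, t)) has_real_derivative of_int (snd k) * hartley (- k) (x, y)) (at y)"
  unfolding hartley_def
  by (auto simp: phase_simps field_simps intro!: derivative_eq_intros phase_derivative)

lemma partial_hartley:
  "partial1 (\<lambda>z. c * hartley k z) = (\<lambda>z. (c * of_int (fst k)) * hartley (- k) z)"
  "partial2 (\<lambda>z. c * hartley k z) = (\<lambda>z. (c * of_int (snd k)) * hartley (- k) z)"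
  by (auto simp: partial1_def partial2_def fun_eq_iff mult.assoc
      intro!: DERIV_imp_deriv DERIV_cmult hartley_derivative)

lemma hartley_differentiable: "(\<lambda>z. c * hartley k z) differentiable (at z)"
  unfolding hartley_def[abs_def] phase_def[abs_def] differentiable_def
  by (rule exI) (auto intro!: derivative_eq_intros)

lemma C_k_hartley: "C_k n (\<lambda>z. c * hartley k z)"
proof (induction n arbitrary: c k)
  case 0
  show ?case by (auto intro!: continuous_intros)
next
  case (Suc n)
  then show ?case unfolding C_k.simps partial_hartley by (blast intro: hartley_differentiable)
qed

lemma smooth_hartley: "hartley k \<in> smooth_torus"
  using C_k_hartley[of _ 1 k] periodic_hartley by (simp add: smooth_torus_def)

lemma square_integrable_hartley: "square_integrable (hartley k)"
  by (intro square_integrable_continuous continuous_intros)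

lemma phase_trig_derivative:
  assumes "((\<lambda>t. phase k (g t)) has_real_derivative c) (at x)" "c \<noteq> 0"
  shows "((\<lambda>t. sin (phase k (g t)) / c) has_real_derivative cos (phase k (g x))) (at x)"
    "((\<lambda>t. - cos (phase k (g t)) / c) has_real_derivative sin (phase k (g x))) (at x)"
  using DERIV_cdivide[OF DERIV_fun_sin[OF assms(1)], of c]
    DERIV_cdivide[OF DERIV_minus[OF DERIV_fun_cos[OF assms(1)]], of c] assms(2) by auto

lemma integral_trig:
  "k \<noteq> 0 \<Longrightarrow> (\<integral>z. cos (phase k z) \<partial>torus) = 0"
  "(\<integral>z. sin (phase k z) \<partial>torus) = 0"
proof -
  have c: "continuous_on UNIV (\<lambda>z. cos (phase k z))" "continuous_on UNIV (\<lambda>z. sin (phase k z))"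
    by (intro continuous_intros)+
  have ps: "periodic (\<lambda>z. sin (phase k z) / c)" "periodic (\<lambda>z. - cos (phase k z) / c)" for c
    using periodic_phase[of k] by (auto simp: periodic_def)
  consider "fst k \<noteq> 0" | "snd k \<noteq> 0" | "k = 0" by (auto simp: prod_eq_iff)
  then have "(k \<noteq> 0 \<longrightarrow> (\<integral>z. cos (phase k z) \<partial>torus) = 0) \<and> (\<integral>z. sin (phase k z) \<partial>torus) = 0"
  proof cases
    case 1
    have "(\<integral>z. cos (phase k z) \<partial>torus) = 0"
      by (rule integral_partial_zero(1)[OF c(1) ps(1)[of "of_int (fst k)"]])
        (rule phase_trig_derivative[OF phase_derivative(1)], use 1 in simp)
    moreover have "(\<integral>z. sin (phase k z) \<partial>torus) = 0"
      by (rule integral_partial_zero(1)[OF c(2) ps(2)[of "of_int (fst k)"]])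
        (rule phase_trig_derivative[OF phase_derivative(1)], use 1 in simp)
    ultimately show ?thesis by simp
  next
    case 2
    have "(\<integral>z. cos (phase k z) \<partial>torus) = 0"
      by (rule integral_partial_zero(2)[OF c(1) ps(1)[of "of_int (snd k)"]])
        (rule phase_trig_derivative[OF phase_derivative(2)], use 2 in simp)
    moreover have "(\<integral>z. sin (phase k z) \<partial>torus) = 0"
      by (rule integral_partial_zero(2)[OF c(2) ps(2)[of "of_int (snd k)"]])
        (rule phase_trig_derivative[OF phase_derivative(2)], use 2 in simp)
    ultimately show ?thesis by simp
  next
    case 3
    then show ?thesis by (simp add: phase_simps)
  qed
  then show "k \<noteq> 0 \<Longrightarrow> (\<integral>z. cos (phase k z) \<partial>torus) = 0" "(\<integral>z. sin (phase k z) \<partial>torus) = 0" by auto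
qed

lemma hartley_mult:
  "hartley k z * hartley l z = (cos (phase (k - l) z) + sin (phase (k + l) z)) / (2 * pi)\<^sup>2"
proof -
  have "(cos a + sin a) * (cos b + sin b) = cos (a - b) + sin (a + b)" for a b :: real
    by (simp add: cos_diff sin_add algebra_simps)
  then show ?thesis by (simp add: hartley_def phase_simps power2_eq_square)
qed

lemma L2_inner_hartley: "L2_inner (hartley k) (hartley l) = (if k = l then 1 else 0)"
proof -
  have i: "integrable torus (\<lambda>z. cos (phase (k - l) z))" "integrable torus (\<lambda>z. sin (phase (k + l) z))"
    by (intro continuous_integrable_torus continuous_intros)+
  have "L2_inner (hartley k) (hartley l)
      = ((\<integral>z. cos (phase (k - l) z) \<partial>torus) + (\<integral>z. sin (phase (k + l) z) \<partial>torus)) / (2 * pi)\<^sup>2"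
    unfolding L2_inner_def hartley_mult using i by simp
  also have "\<dots> = (if k = l then 1 else 0)"
    using integral_trig[of "k - l"] integral_trig(2)[of "k + l"] measure_torus
    by (auto simp: phase_simps space_torus)
  finally show ?thesis .
qed

lemma coef_hartley_sum:
  assumes "finite F"
  shows "coef (\<lambda>z. \<Sum>k\<in>F. c k * hartley k z) l = (if l \<in> F then c l else 0)"
proof -
  have "coef (\<lambda>z. \<Sum>k\<in>F. c k * hartley k z) l = (\<Sum>k\<in>F. c k * (if k = l then 1 else 0))"
    unfolding coef_def by (simp add: L2_inner_sum square_integrable_cmult square_integrable_hartley L2_inner_cmult L2_inner_hartley)
  also have "\<dots> = (\<Sum>k\<in>F. if l = k then c k else 0)" by (intro sum.cong) auto
  finally show ?thesis using assms by simp
qed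

text \<open>
  Completing the square. It shows that the Fourier coefficients give the best approximation with
  frequencies in \<open>F\<close>.
\<close>

lemma L2_inner_hartley_approx:
  fixes c :: "int \<times> int \<Rightarrow> real"
  assumes f: "square_integrable f" and F: "finite F"
  defines "t \<equiv> \<lambda>z. \<Sum>k\<in>F. c k * hartley k z"
  shows "L2_inner (\<lambda>z. f z - t z) (\<lambda>z. f z - t z)
     = L2_inner f f - (\<Sum>k\<in>F. (coef f k)\<^sup>2) + (\<Sum>k\<in>F. (c k - coef f k)\<^sup>2)"
proof -
  have t: "square_integrable t" unfolding t_def by (intro square_integrable_sum square_integrable_cmult square_integrable_hartley)
  have t_g: "L2_inner t g = (\<Sum>k\<in>F. c k * coef g k)" if "square_integrable g" for g
    unfolding t_def using that
    by (simp add: L2_inner_sum square_integrable_cmult square_integrable_hartley L2_inner_cmult coef_def L2_inner_commute[of g])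
  have "coef t l = c l" if "l \<in> F" for l
    unfolding t_def using coef_hartley_sum[OF F, of c l] that by simp
  then have tt: "L2_inner t t = (\<Sum>k\<in>F. c k * c k)" using t_g[OF t] by simp
  have "L2_inner (\<lambda>z. f z - t z) (\<lambda>z. f z - t z) = L2_inner f (\<lambda>z. f z - t z) - L2_inner t (\<lambda>z. f z - t z)"
    using f t by (intro L2_inner_diff square_integrable_diff)
  also have "\<dots> = L2_inner (\<lambda>z. f z - t z) f - L2_inner (\<lambda>z. f z - t z) t"
    using L2_inner_commute[of f "\<lambda>z. f z - t z"] L2_inner_commute[of t "\<lambda>z. f z - t z"] by presburger
  also have "\<dots> = (L2_inner f f - L2_inner t f) - (L2_inner f t - L2_inner t t)"
    using f t by (simp only: L2_inner_diff)
  also have "\<dots> = L2_inner f f - 2 * L2_inner t f + L2_inner t t" by (simp add: L2_inner_commute[of f t])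
  also have "\<dots> = L2_inner f f - (\<Sum>k\<in>F. (coef f k)\<^sup>2) + (\<Sum>k\<in>F. (c k - coef f k)\<^sup>2)"
    unfolding tt t_g[OF f]
    by (simp add: power2_eq_square algebra_simps sum.distrib sum_subtractf sum_distrib_left)
  finally show ?thesis .
qed

section \<open>Completeness\<close>

text \<open>
  The span of the Hartley basis, generated in the form in which closure under products is an
  induction.
\<close>

inductive trig_poly :: "plane_fun \<Rightarrow> bool" where
  base: "trig_poly (\<lambda>z. c * hartley k z)"
| add: "trig_poly f \<Longrightarrow> trig_poly g \<Longrightarrow> trig_poly (\<lambda>z. f z + g z)"

lemma trig_poly_cos_sin: "trig_poly (\<lambda>z. c * cos (phase k z))" "trig_poly (\<lambda>z. c * sin (phase k z))"
proof -
  have cos: "(\<lambda>z. c * cos (phase k z)) = (\<lambda>z. (c * pi) * hartley k z + (c * pi) * hartley (- k) z)"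
    by (rule ext) (simp add: hartley_def phase_simps field_simps)
  show "trig_poly (\<lambda>z. c * cos (phase k z))"
    unfolding cos by (intro trig_poly.intros)
  have sin: "(\<lambda>z. c * sin (phase k z)) = (\<lambda>z. (c * pi) * hartley k z + (- c * pi) * hartley (- k) z)"
    by (rule ext) (simp add: hartley_def phase_simps field_simps)
  show "trig_poly (\<lambda>z. c * sin (phase k z))"
    unfolding sin by (intro trig_poly.intros)
qed

lemma trig_poly_const: "trig_poly (\<lambda>z. c)"
  using trig_poly_cos_sin(1)[of c 0] by (simp add: phase_simps)

lemma trig_poly_mult: "trig_poly f \<Longrightarrow> trig_poly g \<Longrightarrow> trig_poly (\<lambda>z. f z * g z)"
proof (induction rule: trig_poly.induct)
  case (base c k)
  from \<open>trig_poly g\<close> show ?case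
  proof (induction rule: trig_poly.induct)
    case (base d l)
    have "(c * hartley k z) * (d * hartley l z)
        = (c * d / (2 * pi)\<^sup>2) * cos (phase (k - l) z) + (c * d / (2 * pi)\<^sup>2) * sin (phase (k + l) z)" for z
    proof -
      have "(c * hartley k z) * (d * hartley l z) = c * d * (hartley k z * hartley l z)" by simp
      then show ?thesis unfolding hartley_mult by (simp add: add_divide_distrib distrib_left)
    qed
    then show ?case by (simp only:) (intro trig_poly.add trig_poly_cos_sin)
  next
    case (add g h)
    then show ?case unfolding distrib_left by (intro trig_poly.add)
  qed
next
  case (add f h)
  then show ?case unfolding distrib_right by (intro trig_poly.add)
qed

lemma trig_poly_continuous: "trig_poly t \<Longrightarrow> continuous_on UNIV t"
  by (induction rule: trig_poly.induct) (auto intro!: continuous_intros)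

lemma trig_poly_expansion: "trig_poly t \<Longrightarrow> \<exists>F c. finite F \<and> t = (\<lambda>z. \<Sum>k\<in>F. c k * hartley k z)"
proof (induction rule: trig_poly.induct)
  case (base c k)
  have "(\<lambda>z. c * hartley k z) = (\<lambda>z. \<Sum>l\<in>{k}. c * hartley l z)" by simp
  then show ?case by (intro exI[of _ "{k}"] exI[of _ "\<lambda>_. c"] conjI finite.intros)
next
  case (add f g)
  obtain F c where F1: "finite F" "f = (\<lambda>z. \<Sum>k\<in>F. c k * hartley k z)" using add.IH(1) by (elim exE conjE)
  obtain H d where H1: "finite H" "g = (\<lambda>z. \<Sum>k\<in>H. d k * hartley k z)" using add.IH(2) by (elim exE conjE)
  note F = F1(1) H1(1) and eq = F1(2) H1(2)
  let ?e = "\<lambda>k. (if k \<in> F then c k else 0) + (if k \<in> H then d k else 0)"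
  have "f z + g z = (\<Sum>k\<in>F \<union> H. ?e k * hartley k z)" for z
  proof -
    have "f z = (\<Sum>k\<in>F \<union> H. (if k \<in> F then c k else 0) * hartley k z)"
      unfolding eq using F by (intro sum.mono_neutral_cong_left) auto
    moreover have "g z = (\<Sum>k\<in>F \<union> H. (if k \<in> H then d k else 0) * hartley k z)"
      unfolding eq using F by (intro sum.mono_neutral_cong_left) auto
    ultimately show ?thesis by (simp add: sum.distrib distrib_right)
  qed
  then have "(\<lambda>z. f z + g z) = (\<lambda>z. \<Sum>k\<in>F \<union> H. ?e k * hartley k z)" by (rule ext)
  moreover have "finite (F \<union> H)" using F by simp
  ultimately show ?case by (intro exI[of _ "F \<union> H"] exI[of _ ?e] conjI)
qed

text \<open>
  The torus is embedded in \<open>\<complex>\<^sup>2\<close> by \<open>(x, y) \<mapsto> (e\<^sup>i\<^sup>x, e\<^sup>i\<^sup>y)\<close>; this turns the Stone-Weierstrass theorem for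
  polynomials into one for trigonometric polynomials.
\<close>

lemma trig_poly_of_polynomial:
  fixes g :: "complex \<times> complex \<Rightarrow> real"
  assumes "real_polynomial_function g"
  shows "trig_poly (\<lambda>z. g (cis (fst z), cis (snd z)))"
  using assms
proof (induction rule: real_polynomial_function.induct)
  case (linear g)
  then interpret bounded_linear g .
  have "g (cis x, cis y) = (g (1, 0) * cos x + g (\<i>, 0) * sin x) + (g (0, 1) * cos y + g (0, \<i>) * sin y)" for x y
  proof -
    have "(cis x, cis y) = (cos x *\<^sub>R (1, 0) + sin x *\<^sub>R (\<i>, 0)) + (cos y *\<^sub>R (0, 1) + sin y *\<^sub>R (0, \<i>))"
      by (simp add: prod_eq_iff complex_eq_iff)
    then have "g (cis x, cis y) = (cos x *\<^sub>R g (1, 0) + sin x *\<^sub>R g (\<i>, 0))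
        + (cos y *\<^sub>R g (0, 1) + sin y *\<^sub>R g (0, \<i>))"
      by (simp only: add scaleR)
    then show ?thesis by (simp add: mult.commute)
  qed
  then have "(\<lambda>z. g (cis (fst z), cis (snd z)))
      = (\<lambda>z. (g (1, 0) * cos (phase (1, 0) z) + g (\<i>, 0) * sin (phase (1, 0) z))
      + (g (0, 1) * cos (phase (0, 1) z) + g (0, \<i>) * sin (phase (0, 1) z)))"
    by (intro ext) (simp add: phase_def)
  then show ?case by (simp only:) (intro trig_poly.add trig_poly_cos_sin)
next
  case (const c)
  show ?case by (rule trig_poly_const)
next
  case (add f g)
  then show ?case by (intro trig_poly.add)
next
  case (mult f g)
  then show ?case by (intro trig_poly_mult)
qed

lemma Arg2pi_cis: "0 \<le> x \<Longrightarrow> x < 2 * pi \<Longrightarrow> Arg2pi (cis x) = x"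
  using Arg2pi_exp[of "\<i> * of_real x"] by (simp add: cis_conv_exp)

text \<open>
  The angle function jumps across \<open>1\<close>. The cutoff vanishes there and \<open>\<phi>\<close> is bounded, so their product is
  nevertheless continuous on the embedded torus.
\<close>

lemma continuous_cutoff_lift:
  fixes \<phi> :: plane_fun
  assumes cont: "continuous_on UNIV \<phi>" and bound: "\<And>z. \<bar>\<phi> z\<bar> \<le> B"
  shows "continuous_on (sphere 0 1 \<times> sphere 0 1)
    (\<lambda>(z, w). min 1 (c * norm (z - 1)) * min 1 (c * norm (w - 1)) * \<phi> (Arg2pi z, Arg2pi w))"
    (is "continuous_on ?S ?f")
proof -
  define p where "p = (\<lambda>zw::complex \<times> complex. min 1 (c * norm (fst zw - 1)) * min 1 (c * norm (snd zw - 1)))"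
  define q where "q = (\<lambda>zw. \<phi> (Arg2pi (fst zw), Arg2pi (snd zw)))"
  have f: "?f = (\<lambda>zw. p zw * q zw)" by (auto simp: p_def q_def fun_eq_iff)
  have p: "continuous_on UNIV p" unfolding p_def by (intro continuous_intros)
  have "continuous (at zw within ?S) (\<lambda>zw. p zw * q zw)" if zw: "zw \<in> ?S" for zw
  proof (cases "fst zw = 1 \<or> snd zw = 1")
    case True
    then have "p zw = 0" by (auto simp: p_def)
    moreover have "(p \<longlongrightarrow> p zw) (at zw within ?S)"
      using continuous_on_subset[OF p subset_UNIV, of ?S] zw unfolding continuous_on_def by blast
    ultimately have "((\<lambda>x. \<bar>p x\<bar> * B) \<longlongrightarrow> 0) (at zw within ?S)"
      by (auto intro!: tendsto_eq_intros)
    then have "((\<lambda>x. p x * q x) \<longlongrightarrow> 0) (at zw within ?S)"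
      by (rule Lim_null_comparison[rotated])
        (auto simp: abs_mult q_def intro!: always_eventually mult_left_mono bound)
    then show ?thesis using \<open>p zw = 0\<close> by (simp add: continuous_within)
  next
    case False
    have "z \<notin> \<real>\<^sub>\<ge>\<^sub>0" if "norm z = 1" "z \<noteq> 1" for z :: complex
      using that by (auto simp: nonneg_Reals_def)
    with False zw have "fst zw \<notin> \<real>\<^sub>\<ge>\<^sub>0" "snd zw \<notin> \<real>\<^sub>\<ge>\<^sub>0" by (auto simp: mem_Times_iff)
    then have "isCont (\<lambda>x. Arg2pi (fst x)) zw" "isCont (\<lambda>x. Arg2pi (snd x)) zw"
      using isCont_o2[OF isCont_fst[OF continuous_ident] continuous_at_Arg2pi, of zw]
        isCont_o2[OF isCont_snd[OF continuous_ident] continuous_at_Arg2pi, of zw] by simp_all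
    then have "isCont (\<lambda>x. (Arg2pi (fst x), Arg2pi (snd x))) zw" by (intro continuous_intros)
    then have "isCont q zw" unfolding q_def
      by (rule isCont_o2) (use cont in \<open>simp add: continuous_on_eq_continuous_at\<close>)
    moreover have "isCont p zw" using p by (metis continuous_on_eq_continuous_at open_UNIV UNIV_I)
    ultimately have "isCont (\<lambda>x. p x * q x) zw" by (intro continuous_intros)
    then show ?thesis using continuous_at_imp_continuous_at_within by blast
  qed
  then show ?thesis unfolding f by (simp add: continuous_on_eq_continuous_within)
qed

lemma trig_poly_near_cutoff:
  fixes \<phi> :: plane_fun
  assumes "continuous_on UNIV \<phi>" "\<And>z. \<bar>\<phi> z\<bar> \<le> B" "e > 0"
  obtains t where "trig_poly t"
    "\<And>z. z \<in> square \<Longrightarrow>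
       \<bar>min 1 (c * norm (cis (fst z) - 1)) * min 1 (c * norm (cis (snd z) - 1)) * \<phi> z - t z\<bar> < e"
proof -
  have "compact (sphere (0::complex) 1 \<times> sphere (0::complex) 1)" by (intro compact_Times) auto
  then obtain g where g: "real_polynomial_function g"
    and near: "\<And>x. x \<in> sphere 0 1 \<times> sphere 0 1 \<Longrightarrow>
      \<bar>(\<lambda>(z, w). min 1 (c * norm (z - 1)) * min 1 (c * norm (w - 1)) * \<phi> (Arg2pi z, Arg2pi w)) x - g x\<bar> < e"
    by (rule Stone_Weierstrass_real_polynomial_function[OF _ continuous_cutoff_lift[OF assms(1,2), of c] assms(3)]) blast
  show ?thesis
  proof (rule that[OF trig_poly_of_polynomial[OF g]])
    fix z :: "real \<times> real"
    assume "z \<in> square"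
    then show "\<bar>min 1 (c * norm (cis (fst z) - 1)) * min 1 (c * norm (cis (snd z) - 1)) * \<phi> z
        - g (cis (fst z), cis (snd z))\<bar> < e"
      using near[of "(cis (fst z), cis (snd z))"] by (auto simp: Arg2pi_cis mem_Times_iff)
  qed
qed

lemma cis_ne_1: "0 < x \<Longrightarrow> x < 2 * pi \<Longrightarrow> cis x \<noteq> 1"
  using Arg2pi_cis[of x] Arg2pi_cis[of 0] by auto

text \<open>
  A measurable function is an almost everywhere limit of continuous ones. These are truncated at \<open>B\<close>,
  cut off near the boundary of the square and replaced by nearby trigonometric polynomials. The
  uniform bound is what makes dominated convergence applicable.
\<close>

lemma trig_poly_AE_limit:
  assumes f: "f \<in> borel_measurable torus" and B: "\<And>z. z \<in> square \<Longrightarrow> \<bar>f z\<bar> \<le> B"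
  obtains t where "\<And>j::nat. trig_poly (t j)" "\<And>j z. z \<in> square \<Longrightarrow> \<bar>t j z\<bar> \<le> B + 1"
    "AE z in torus. (\<lambda>j. t j z) \<longlonglongrightarrow> f z"
proof -
  have "B \<ge> 0" using B[of "(0, 0)"] by simp
  have "f measurable_on square"
    by (rule measurable_on_iff_borel_measurable[THEN iffD2, OF square_lebesgue f[unfolded torus_def]])
  then obtain N g where Ng: "negligible N \<and> (\<forall>n. continuous_on UNIV (g n))
      \<and> (\<forall>z. z \<notin> N \<longrightarrow> (\<lambda>n. g n z) \<longlonglongrightarrow> (if z \<in> square then f z else 0))"
    unfolding measurable_on_def by (elim exE)
  have N: "negligible N" using Ng by (rule conjunct1)
  have g: "continuous_on UNIV (g n)" for n using Ng[THEN conjunct2, THEN conjunct1] by (rule spec)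
  have lim: "(\<lambda>n. g n z) \<longlonglongrightarrow> (if z \<in> square then f z else 0)" if "z \<notin> N" for z
    using Ng[THEN conjunct2, THEN conjunct2, THEN spec, THEN mp, OF that] .
  define \<phi> where "\<phi> n z = max (- B) (min B (g n z))" for n z
  define \<rho> where "\<rho> n z = min 1 (real n * norm (cis (fst z) - 1)) * min 1 (real n * norm (cis (snd z) - 1))"
    for n and z :: "real \<times> real"
  have "continuous_on UNIV (\<phi> n)" for n unfolding \<phi>_def[abs_def] by (intro continuous_intros g)
  moreover have \<phi>B: "\<bar>\<phi> n z\<bar> \<le> B" for n z using \<open>B \<ge> 0\<close> by (auto simp: \<phi>_def)
  ultimately have "\<exists>t. trig_poly t \<and> (\<forall>z\<in>square. \<bar>\<rho> n z * \<phi> n z - t z\<bar> < 1 / Suc n)" for n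
    unfolding \<rho>_def
  proof (rule trig_poly_near_cutoff[of "\<phi> n" B "1 / Suc n" "real n"])
    fix t
    assume "trig_poly t" "\<And>z. z \<in> square \<Longrightarrow> \<bar>min 1 (real n * norm (cis (fst z) - 1)) *
      min 1 (real n * norm (cis (snd z) - 1)) * \<phi> n z - t z\<bar> < 1 / Suc n"
    then show "\<exists>t. trig_poly t \<and> (\<forall>z\<in>square. \<bar>min 1 (real n * norm (cis (fst z) - 1)) *
      min 1 (real n * norm (cis (snd z) - 1)) * \<phi> n z - t z\<bar> < 1 / Suc n)"
      by (intro exI[of _ t] conjI ballI)
  qed simp
  then have "\<exists>t. \<forall>n. trig_poly (t n) \<and> (\<forall>z\<in>square. \<bar>\<rho> n z * \<phi> n z - t n z\<bar> < 1 / Suc n)"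
    by (intro choice allI)
  then obtain t where tt: "\<forall>n. trig_poly (t n) \<and> (\<forall>z\<in>square. \<bar>\<rho> n z * \<phi> n z - t n z\<bar> < 1 / Suc n)"
    by (elim exE)
  have t: "trig_poly (t n)" for n using tt[THEN spec, THEN conjunct1] .
  have near: "\<bar>\<rho> n z * \<phi> n z - t n z\<bar> < 1 / Suc n" if "z \<in> square" for n z
    using tt[THEN spec, THEN conjunct2, THEN bspec, OF that] .
  have \<rho>1: "0 \<le> \<rho> n z \<and> \<rho> n z \<le> 1" for n z
    unfolding \<rho>_def by (auto intro!: mult_le_one)
  show ?thesis
  proof (rule that[of t])
    show "trig_poly (t j)" for j by (rule t)
    show "\<bar>t j z\<bar> \<le> B + 1" if "z \<in> square" for j z
    proof -
      have "\<bar>\<rho> j z * \<phi> j z\<bar> \<le> 1 * B"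
        unfolding abs_mult using \<rho>1[of j z] \<phi>B[of j z] \<open>B \<ge> 0\<close> by (intro mult_mono) auto
      moreover have "1 / Suc j \<le> (1::real)" by simp
      ultimately show ?thesis using near[OF that, of j] by linarith
    qed
    show "AE z in torus. (\<lambda>j. t j z) \<longlonglongrightarrow> f z"
    proof (rule AE_torus_I)
      show "negligible (N \<union> ({z. fst z = 0} \<union> {z. snd z = 0}))"
        using N negligible_coordinate_lines by (intro negligible_Un)
      fix z :: "real \<times> real"
      assume z: "z \<in> square" and "z \<notin> N \<union> ({z. fst z = 0} \<union> {z. snd z = 0})"
      then have "z \<notin> N" and ne: "cis (fst z) \<noteq> 1" "cis (snd z) \<noteq> 1"
        using cis_ne_1[of "fst z"] cis_ne_1[of "snd z"] by (auto simp: mem_Times_iff)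
      have ev: "eventually (\<lambda>n. min 1 (real n * norm (w - 1)) = 1) sequentially" if "w \<noteq> 1" for w :: complex
      proof -
        have "eventually (\<lambda>n. 1 / norm (w - 1) \<le> real n) sequentially"
          using filterlim_real_sequentially unfolding filterlim_at_top by (rule spec)
        then show ?thesis by eventually_elim (use that in \<open>simp add: field_simps\<close>)
      qed
      have "(\<lambda>n. g n z) \<longlonglongrightarrow> f z" using lim[OF \<open>z \<notin> N\<close>] z by simp
      then have "(\<lambda>n. \<phi> n z) \<longlonglongrightarrow> max (- B) (min B (f z))"
        unfolding \<phi>_def by (intro tendsto_intros)
      moreover have "max (- B) (min B (f z)) = f z" using B[OF z] by auto
      ultimately have \<phi>_lim: "(\<lambda>n. \<phi> n z) \<longlonglongrightarrow> f z" by simp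
      have "eventually (\<lambda>n. \<phi> n z = \<rho> n z * \<phi> n z) sequentially"
        using ev[OF ne(1)] ev[OF ne(2)] by eventually_elim (simp add: \<rho>_def)
      then have 1: "(\<lambda>n. \<rho> n z * \<phi> n z) \<longlonglongrightarrow> f z"
        by (rule Lim_transform_eventually[OF \<phi>_lim])
      have "\<forall>n. norm (\<rho> n z * \<phi> n z - t n z) \<le> inverse (real (Suc n))"
        using near[OF z] unfolding real_norm_def inverse_eq_divide by (intro allI less_imp_le)
      then have "(\<lambda>n. \<rho> n z * \<phi> n z - t n z) \<longlonglongrightarrow> 0"
        by (rule Lim_null_comparison[OF always_eventually LIMSEQ_inverse_real_of_nat])
      from tendsto_diff[OF 1 this] show "(\<lambda>j. t j z) \<longlonglongrightarrow> f z" by simp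
    qed
  qed
qed

lemma trig_poly_dense_bounded:
  assumes f: "f \<in> borel_measurable torus" and B: "\<And>z. z \<in> square \<Longrightarrow> \<bar>f z\<bar> \<le> B" and "e > 0"
  obtains t where "trig_poly t" "L2_inner (\<lambda>z. f z - t z) (\<lambda>z. f z - t z) < e"
proof -
  obtain t where t: "\<And>j::nat. trig_poly (t j)" "\<And>j z. z \<in> square \<Longrightarrow> \<bar>t j z\<bar> \<le> B + 1"
    and lim: "AE z in torus. (\<lambda>j. t j z) \<longlonglongrightarrow> f z"
    by (rule trig_poly_AE_limit[OF f B]) blast+
  have [measurable]: "t j \<in> borel_measurable torus" for j
    by (intro continuous_measurable_torus trig_poly_continuous t)
  note f [measurable]
  have "(\<lambda>j. \<integral>z. (f z - t j z) * (f z - t j z) \<partial>torus) \<longlonglongrightarrow> (\<integral>z. 0 \<partial>torus)"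
  proof (rule integral_dominated_convergence)
    show "integrable torus (\<lambda>z. (2 * B + 1)\<^sup>2)" by simp
    show "AE z in torus. (\<lambda>j. (f z - t j z) * (f z - t j z)) \<longlonglongrightarrow> 0"
      using lim by eventually_elim (auto intro!: tendsto_eq_intros)
    show "AE z in torus. norm ((f z - t j z) * (f z - t j z)) \<le> (2 * B + 1)\<^sup>2" for j
    proof (rule AE_I2)
      fix z assume "z \<in> space torus"
      then have "\<bar>f z - t j z\<bar> \<le> 2 * B + 1" using B[of z] t(2)[of z j] by (auto simp: space_torus)
      then show "norm ((f z - t j z) * (f z - t j z)) \<le> (2 * B + 1)\<^sup>2"
        using power_mono[of "\<bar>f z - t j z\<bar>" "2 * B + 1" 2] by (simp add: power2_eq_square)
    qed
  qed auto
  then have "eventually (\<lambda>j. (\<integral>z. (f z - t j z) * (f z - t j z) \<partial>torus) < e) sequentially"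
    using \<open>e > 0\<close> by (intro order_tendstoD(2)) auto
  then obtain j where "(\<integral>z. (f z - t j z) * (f z - t j z) \<partial>torus) < e"
    by (auto simp: eventually_sequentially)
  then show ?thesis using that[OF t(1)[of j]] by (simp add: L2_inner_def)
qed

lemma L2_inner_square_add:
  assumes "square_integrable f" "square_integrable g"
  shows "L2_inner (\<lambda>z. f z + g z) (\<lambda>z. f z + g z) \<le> 2 * L2_inner f f + 2 * L2_inner g g"
proof -
  have "L2_inner (\<lambda>z. f z + g z) (\<lambda>z. f z + g z) \<le> (\<integral>z. 2 * (f z)\<^sup>2 + 2 * (g z)\<^sup>2 \<partial>torus)"
    unfolding L2_inner_def
  proof (rule integral_mono)
    show "integrable torus (\<lambda>z. 2 * (f z)\<^sup>2 + 2 * (g z)\<^sup>2)" using assms by (simp add: square_integrable_def)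
    show "integrable torus (\<lambda>z. (f z + g z) * (f z + g z))" using assms by (intro square_integrable_prod square_integrable_add)
    show "(f z + g z) * (f z + g z) \<le> 2 * (f z)\<^sup>2 + 2 * (g z)\<^sup>2" for z
      using zero_le_power2[of "f z - g z"] by (simp add: power2_eq_square algebra_simps)
  qed
  also have "\<dots> = 2 * L2_inner f f + 2 * L2_inner g g"
    using assms by (simp add: L2_inner_def square_integrable_def power2_eq_square)
  finally show ?thesis .
qed

lemma trig_poly_dense:
  assumes f: "square_integrable f" and "e > 0"
  obtains t where "trig_poly t" "L2_inner (\<lambda>z. f z - t z) (\<lambda>z. f z - t z) < e"
proof -
  define g where "g n z = max (- real n) (min (real n) (f z))" for n z
  have [measurable]: "f \<in> borel_measurable torus" using f by (simp add: square_integrable_def)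
  have g[measurable]: "g n \<in> borel_measurable torus" for n unfolding g_def[abs_def] by measurable
  have gB: "\<bar>g n z\<bar> \<le> real n" for n z by (auto simp: g_def)
  have "(\<lambda>n. \<integral>z. (f z - g n z) * (f z - g n z) \<partial>torus) \<longlonglongrightarrow> (\<integral>z. 0 \<partial>torus)"
  proof (rule integral_dominated_convergence)
    show "integrable torus (\<lambda>z. (f z)\<^sup>2)" using f by (simp add: square_integrable_def)
    show "AE z in torus. (\<lambda>n. (f z - g n z) * (f z - g n z)) \<longlonglongrightarrow> 0"
    proof (rule AE_I2)
      fix z
      have "eventually (\<lambda>n. \<bar>f z\<bar> \<le> real n) sequentially"
        using filterlim_real_sequentially unfolding filterlim_at_top by (rule spec)
      then have "eventually (\<lambda>n. (f z - g n z) * (f z - g n z) = 0) sequentially"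
        by eventually_elim (auto simp: g_def)
      then show "(\<lambda>n. (f z - g n z) * (f z - g n z)) \<longlonglongrightarrow> 0" by (rule tendsto_eventually)
    qed
    show "AE z in torus. norm ((f z - g n z) * (f z - g n z)) \<le> (f z)\<^sup>2" for n
    proof (rule AE_I2)
      fix z
      have "\<bar>f z - g n z\<bar> \<le> \<bar>f z\<bar>" by (auto simp: g_def)
      then show "norm ((f z - g n z) * (f z - g n z)) \<le> (f z)\<^sup>2"
        using power_mono[of "\<bar>f z - g n z\<bar>" "\<bar>f z\<bar>" 2] by (simp add: power2_eq_square)
    qed
  qed auto
  then have "eventually (\<lambda>n. (\<integral>z. (f z - g n z) * (f z - g n z) \<partial>torus) < e / 4) sequentially"
    using \<open>e > 0\<close> by (intro order_tendstoD(2)) auto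
  then obtain n where n: "L2_inner (\<lambda>z. f z - g n z) (\<lambda>z. f z - g n z) < e / 4"
    by (auto simp: eventually_sequentially L2_inner_def)
  obtain t where t: "trig_poly t" "L2_inner (\<lambda>z. g n z - t z) (\<lambda>z. g n z - t z) < e / 4"
    using trig_poly_dense_bounded[OF g[of n] gB, of "e / 4"] \<open>e > 0\<close> by auto
  have "square_integrable (g n)" using g gB by (rule square_integrable_bounded)
  moreover have "square_integrable t" by (intro square_integrable_continuous trig_poly_continuous t)
  ultimately have "L2_inner (\<lambda>z. f z - t z) (\<lambda>z. f z - t z)
      \<le> 2 * L2_inner (\<lambda>z. f z - g n z) (\<lambda>z. f z - g n z) + 2 * L2_inner (\<lambda>z. g n z - t z) (\<lambda>z. g n z - t z)"
    using L2_inner_square_add[of "\<lambda>z. f z - g n z" "\<lambda>z. g n z - t z"] f square_integrable_diff by simp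
  then show ?thesis using n t that by force
qed

text \<open>
  By density some trigonometric polynomial is close to \<open>f\<close>; partial sums over any larger set of
  frequencies are at least as close, being best approximations.
\<close>

theorem Parseval:
  assumes f: "square_integrable f" and g: "square_integrable g"
  shows "((\<lambda>k. coef f k * coef g k) has_sum L2_inner f g) UNIV"
  unfolding has_sum_def
proof (rule tendstoI)
  fix e :: real assume "e > 0"
  \<comment> \<open>The summand \<open>1\<close> avoids a division by zero when \<open>g\<close> vanishes.\<close>
  define \<delta> where "\<delta> = (e / (sqrt (L2_inner g g) + 1))\<^sup>2"
  have gp: "sqrt (L2_inner g g) + 1 > 0" using L2_inner_nonneg[of g] by (simp add: add_nonneg_pos)
  have "\<delta> > 0" using \<open>e > 0\<close> gp by (simp add: \<delta>_def)
  obtain t where "trig_poly t" and t: "L2_inner (\<lambda>z. f z - t z) (\<lambda>z. f z - t z) < \<delta>"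
    by (rule trig_poly_dense[OF f \<open>\<delta> > 0\<close>]) blast
  then obtain F0 c where F0: "finite F0" and t_eq: "t = (\<lambda>z. \<Sum>k\<in>F0. c k * hartley k z)"
    using trig_poly_expansion[OF \<open>trig_poly t\<close>] by (elim exE conjE)
  show "eventually (\<lambda>F. dist (\<Sum>k\<in>F. coef f k * coef g k) (L2_inner f g) < e) (finite_subsets_at_top UNIV)"
    unfolding eventually_finite_subsets_at_top
  proof (intro exI[of _ F0] conjI allI impI)
    fix F assume F: "finite F \<and> F0 \<subseteq> F \<and> F \<subseteq> (UNIV :: (int \<times> int) set)"
    define S where "S = (\<lambda>z. \<Sum>k\<in>F. coef f k * hartley k z)"
    have S: "square_integrable S" unfolding S_def by (intro square_integrable_sum square_integrable_cmult square_integrable_hartley)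
    have "t = (\<lambda>z. \<Sum>k\<in>F. (if k \<in> F0 then c k else 0) * hartley k z)"
      unfolding t_eq using F by (intro ext sum.mono_neutral_cong_left) auto
    then have "L2_inner (\<lambda>z. f z - S z) (\<lambda>z. f z - S z) \<le> L2_inner (\<lambda>z. f z - t z) (\<lambda>z. f z - t z)"
      using L2_inner_hartley_approx[OF f, of F "coef f"]
        L2_inner_hartley_approx[OF f, of F "\<lambda>k. if k \<in> F0 then c k else 0"] F
      by (simp add: S_def sum_nonneg)
    then have "sqrt (L2_inner (\<lambda>z. f z - S z) (\<lambda>z. f z - S z)) < sqrt \<delta>" using t by simp
    also have "sqrt \<delta> = e / (sqrt (L2_inner g g) + 1)" using \<open>e > 0\<close> gp by (simp add: \<delta>_def)
    finally have small: "sqrt (L2_inner (\<lambda>z. f z - S z) (\<lambda>z. f z - S z)) * (sqrt (L2_inner g g) + 1) < e"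
      using gp by (simp add: pos_less_divide_eq)
    have "(\<Sum>k\<in>F. coef f k * coef g k) = L2_inner S g"
      unfolding S_def using g
      by (simp add: L2_inner_sum square_integrable_cmult square_integrable_hartley L2_inner_cmult coef_def L2_inner_commute[of g])
    then have "dist (\<Sum>k\<in>F. coef f k * coef g k) (L2_inner f g) = \<bar>L2_inner (\<lambda>z. f z - S z) g\<bar>"
      using f S g by (simp add: L2_inner_diff dist_real_def abs_minus_commute)
    also have "\<dots> \<le> sqrt (L2_inner (\<lambda>z. f z - S z) (\<lambda>z. f z - S z)) * sqrt (L2_inner g g)"
      using f S g by (intro L2_inner_Cauchy_Schwarz square_integrable_diff)
    also have "\<dots> \<le> sqrt (L2_inner (\<lambda>z. f z - S z) (\<lambda>z. f z - S z)) * (sqrt (L2_inner g g) + 1)"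
      by (intro mult_left_mono) (auto simp: L2_inner_nonneg)
    finally show "dist (\<Sum>k\<in>F. coef f k * coef g k) (L2_inner f g) < e" using small by linarith
  qed (use F0 in auto)
qed

section \<open>Weak derivatives and Fourier coefficients\<close>

lemma smooth_continuous: "\<phi> \<in> smooth_torus \<Longrightarrow> continuous_on UNIV \<phi>"
  unfolding smooth_torus_def using C_k.simps(1) by blast

lemma smooth_periodic: "\<phi> \<in> smooth_torus \<Longrightarrow> periodic \<phi>"
  by (simp add: smooth_torus_def)

lemma smooth_square_integrable: "\<phi> \<in> smooth_torus \<Longrightarrow> square_integrable \<phi>"
  by (intro square_integrable_continuous smooth_continuous)

lemma smooth_derivative:
  assumes "\<phi> \<in> smooth_torus"
  shows "((\<lambda>t. \<phi> (t, y)) has_real_derivative partial1 \<phi> (x, y)) (at x)"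
    and "((\<lambda>t. \<phi> (x, t)) has_real_derivative partial2 \<phi> (x, y)) (at y)"
proof -
  have d: "\<phi> differentiable (at z)" for z
    using assms C_k.simps(2)[of 0 \<phi>] unfolding smooth_torus_def by blast
  have "(\<lambda>t. \<phi> (t, y)) differentiable (at x)"
    by (rule differentiable_compose[of \<phi>, OF d]) (auto intro!: derivative_intros)
  then show "((\<lambda>t. \<phi> (t, y)) has_real_derivative partial1 \<phi> (x, y)) (at x)"
    by (simp add: partial1_def DERIV_deriv_iff_real_differentiable)
  have "(\<lambda>t. \<phi> (x, t)) differentiable (at y)"
    by (rule differentiable_compose[of \<phi>, OF d]) (auto intro!: derivative_intros)
  then show "((\<lambda>t. \<phi> (x, t)) has_real_derivative partial2 \<phi> (x, y)) (at y)"
    by (simp add: partial2_def DERIV_deriv_iff_real_differentiable)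
qed

lemma smooth_partial:
  assumes "\<phi> \<in> smooth_torus"
  shows "partial1 \<phi> \<in> smooth_torus" "partial2 \<phi> \<in> smooth_torus"
proof -
  have C: "C_k n (partial1 \<phi>)" "C_k n (partial2 \<phi>)" for n
    using assms C_k.simps(2)[of n \<phi>] unfolding smooth_torus_def by blast+
  have per: "\<phi> (x + 2 * pi, y) = \<phi> (x, y)" "\<phi> (x, y + 2 * pi) = \<phi> (x, y)" for x y
    using smooth_periodic[OF assms] by (auto simp: periodic_def)
  note d = smooth_derivative[OF assms]
  have "partial1 \<phi> (x + 2 * pi, y) = partial1 \<phi> (x, y)" for x y
    using d(1)[of y "x + 2 * pi"] d(1)[of y x] DERIV_unique
    unfolding DERIV_shift per by blast
  moreover have "partial1 \<phi> (x, y + 2 * pi) = partial1 \<phi> (x, y)" for x y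
    by (simp add: partial1_def per)
  ultimately show "partial1 \<phi> \<in> smooth_torus" using C by (simp add: smooth_torus_def periodic_def)
  have "partial2 \<phi> (x, y + 2 * pi) = partial2 \<phi> (x, y)" for x y
    using d(2)[of x "y + 2 * pi"] d(2)[of x y] DERIV_unique
    unfolding DERIV_shift per by blast
  moreover have "partial2 \<phi> (x + 2 * pi, y) = partial2 \<phi> (x, y)" for x y
    by (simp add: partial2_def per)
  ultimately show "partial2 \<phi> \<in> smooth_torus" using C by (simp add: smooth_torus_def periodic_def)
qed

text \<open>
  Integration by parts against the Hartley basis.
\<close>

lemma coef_partial:
  assumes \<phi>: "\<phi> \<in> smooth_torus"
  shows "coef (partial1 \<phi>) k = - of_int (fst k) * coef \<phi> (- k)"
    and "coef (partial2 \<phi>) k = - of_int (snd k) * coef \<phi> (- k)"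
proof -
  have per: "periodic (\<lambda>z. \<phi> z * hartley k z)"
    using smooth_periodic[OF \<phi>] periodic_hartley[of k] by (simp add: periodic_def)
  have int: "integrable torus (\<lambda>z. \<phi> z * hartley l z)" "integrable torus (\<lambda>z. partial1 \<phi> z * hartley l z)"
    "integrable torus (\<lambda>z. partial2 \<phi> z * hartley l z)" for l
    by (intro square_integrable_prod smooth_square_integrable square_integrable_hartley \<phi> smooth_partial)+
  have "(\<integral>z. partial1 \<phi> z * hartley k z + of_int (fst k) * (\<phi> z * hartley (- k) z) \<partial>torus) = 0"
  proof (rule integral_partial_zero(1)[OF _ per])
    show "continuous_on UNIV (\<lambda>z. partial1 \<phi> z * hartley k z + of_int (fst k) * (\<phi> z * hartley (- k) z))"
      by (intro continuous_intros smooth_continuous smooth_partial \<phi>)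
    show "((\<lambda>t. \<phi> (t, y) * hartley k (t, y)) has_real_derivative
        partial1 \<phi> (x, y) * hartley k (x, y) + of_int (fst k) * (\<phi> (x, y) * hartley (- k) (x, y))) (at x)" for x y
      using DERIV_mult[OF smooth_derivative(1)[OF \<phi>] hartley_derivative(1)[of k y x]]
      by (simp add: algebra_simps)
  qed
  then show "coef (partial1 \<phi>) k = - of_int (fst k) * coef \<phi> (- k)"
    using int by (simp add: coef_def L2_inner_def)
  have "(\<integral>z. partial2 \<phi> z * hartley k z + of_int (snd k) * (\<phi> z * hartley (- k) z) \<partial>torus) = 0"
  proof (rule integral_partial_zero(2)[OF _ per])
    show "continuous_on UNIV (\<lambda>z. partial2 \<phi> z * hartley k z + of_int (snd k) * (\<phi> z * hartley (- k) z))"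
      by (intro continuous_intros smooth_continuous smooth_partial \<phi>)
    show "((\<lambda>t. \<phi> (x, t) * hartley k (x, t)) has_real_derivative
        partial2 \<phi> (x, y) * hartley k (x, y) + of_int (snd k) * (\<phi> (x, y) * hartley (- k) (x, y))) (at y)" for x y
      using DERIV_mult[OF smooth_derivative(2)[OF \<phi>] hartley_derivative(2)[of k x y]]
      by (simp add: algebra_simps)
  qed
  then show "coef (partial2 \<phi>) k = - of_int (snd k) * coef \<phi> (- k)"
    using int by (simp add: coef_def L2_inner_def)
qed

section \<open>Absolutely convergent Hartley series\<close>

instance bcontfun :: (metric_space, banach) banach ..

type_synonym cfun = "(real \<times> real) \<Rightarrow>\<^sub>C real"

definition hartley_C :: "int \<times> int \<Rightarrow> cfun" where "hartley_C k = Bcontfun (hartley k)"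

lemma apply_hartley_C: "apply_bcontfun (hartley_C k) = hartley k"
  unfolding hartley_C_def using hartley_bound[of k] continuous_hartley
  by (intro Bcontfun_inverse bcontfun_normI[where b = 1]) auto

lemma norm_hartley_C: "norm (hartley_C k) \<le> 1"
  using hartley_bound by (intro norm_bound) (simp add: apply_hartley_C)

lemma square_integrable_cfun: "square_integrable (apply_bcontfun x)"
  by (intro square_integrable_continuous) auto

lemma L2_inner_cfun_bound: "L2_inner (apply_bcontfun x) (apply_bcontfun x) \<le> (2 * pi * norm x)\<^sup>2"
proof -
  have "L2_inner (apply_bcontfun x) (apply_bcontfun x) \<le> (\<integral>z. (norm x)\<^sup>2 \<partial>torus)"
    unfolding L2_inner_def
  proof (rule integral_mono)
    show "apply_bcontfun x z * apply_bcontfun x z \<le> (norm x)\<^sup>2" for z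
      using power_mono[OF norm_bounded[of x z], of 2] by (simp add: power2_eq_square)
  qed (auto intro: square_integrable_prod square_integrable_cfun)
  also have "\<dots> = (2 * pi * norm x)\<^sup>2"
    using measure_torus by (simp add: space_torus power_mult_distrib)
  finally show ?thesis .
qed

lemma sqrt_L2_inner_cfun_bound: "sqrt (L2_inner (apply_bcontfun x) (apply_bcontfun x)) \<le> 2 * pi * norm x"
  by (rule real_le_lsqrt) (simp_all add: L2_inner_cfun_bound)

lemma bounded_linear_L2_inner:
  assumes "square_integrable g"
  shows "bounded_linear (\<lambda>x::cfun. L2_inner (apply_bcontfun x) g)"
proof (rule bounded_linear_intro[where K = "2 * pi * sqrt (L2_inner g g)"])
  fix x y :: cfun and r :: real
  show "L2_inner (apply_bcontfun (x + y)) g = L2_inner (apply_bcontfun x) g + L2_inner (apply_bcontfun y) g"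
    using L2_inner_add[OF square_integrable_cfun square_integrable_cfun assms] by (simp add: plus_bcontfun.rep_eq)
  show "L2_inner (apply_bcontfun (r *\<^sub>R x)) g = r *\<^sub>R L2_inner (apply_bcontfun x) g"
    using L2_inner_cmult by (simp add: scaleR_bcontfun.rep_eq)
  have "\<bar>L2_inner (apply_bcontfun x) g\<bar> \<le> sqrt (L2_inner (apply_bcontfun x) (apply_bcontfun x)) * sqrt (L2_inner g g)"
    by (intro L2_inner_Cauchy_Schwarz square_integrable_cfun assms)
  also have "\<dots> \<le> (2 * pi * norm x) * sqrt (L2_inner g g)"
    by (intro mult_right_mono sqrt_L2_inner_cfun_bound) (simp add: L2_inner_nonneg)
  finally show "norm (L2_inner (apply_bcontfun x) g) \<le> norm x * (2 * pi * sqrt (L2_inner g g))"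
    by (simp add: mult_ac)
qed

definition series :: "(int \<times> int \<Rightarrow> real) \<Rightarrow> cfun" where
  "series d = (\<Sum>\<^sub>\<infinity>k. d k *\<^sub>R hartley_C k)"

abbreviation absolutely_summable :: "(int \<times> int \<Rightarrow> 'a::real_normed_vector) \<Rightarrow> bool" where
  "absolutely_summable d \<equiv> (\<lambda>k. norm (d k)) summable_on UNIV"

lemma series_abs:
  assumes "absolutely_summable d"
  shows "absolutely_summable (\<lambda>k. d k *\<^sub>R hartley_C k)"
proof (rule Infinite_Sum.abs_summable_on_comparison_test[OF assms])
  show "norm (d k *\<^sub>R hartley_C k) \<le> norm (d k)" for k
    using mult_left_mono[OF norm_hartley_C[of k], of "\<bar>d k\<bar>"] by simp
qed

lemma series_has_sum:
  assumes "absolutely_summable d"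
  shows "((\<lambda>k. d k *\<^sub>R hartley_C k) has_sum series d) UNIV"
  unfolding series_def 
  by (rule has_sum_infsum, rule Infinite_Sum.abs_summable_summable, rule series_abs, rule assms)

lemma series_linear:
  assumes "absolutely_summable d" "bounded_linear (h :: cfun \<Rightarrow> real)"
  shows "((\<lambda>k. d k * h (hartley_C k)) has_sum h (series d)) UNIV"
proof -
  interpret bounded_linear h by fact
  have "h (d k *\<^sub>R hartley_C k) = d k * h (hartley_C k)" for k by (simp only: scaleR real_scaleR_def)
  then show ?thesis using has_sum_bounded_linear[OF assms(2) series_has_sum[OF assms(1)]] by (simp only:)
qed

text \<open>
  The bound on finite sums does double duty: it gives convergence in the sup norm and bounds the sum.
\<close>

lemma norm_series:
  assumes "\<And>F. finite F \<Longrightarrow> (\<Sum>k\<in>F. \<bar>d k\<bar>) \<le> C"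
  shows "absolutely_summable d" "norm (series d) \<le> C"
proof -
  show s: "absolutely_summable d"
  proof (rule nonneg_bdd_above_summable_on)
    show "bdd_above (sum (\<lambda>k. norm (d k)) ` {F. F \<subseteq> UNIV \<and> finite F})"
      by (rule bdd_aboveI2[of _ _ C]) (simp add: assms)
  qed simp
  have "norm (series d) \<le> (\<Sum>\<^sub>\<infinity>k. norm (d k *\<^sub>R hartley_C k))"
    unfolding series_def by (rule Infinite_Sum.norm_infsum_bound[OF series_abs[OF s]])
  also have "\<dots> \<le> C"
  proof (rule infsum_le_finite_sums[OF series_abs[OF s]])
    fix F :: "(int \<times> int) set" assume "finite F"
    have "(\<Sum>k\<in>F. norm (d k *\<^sub>R hartley_C k)) \<le> (\<Sum>k\<in>F. \<bar>d k\<bar>)"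
      using mult_left_mono[OF norm_hartley_C abs_ge_zero] by (intro sum_mono) (simp add: abs_mult)
    also have "\<dots> \<le> C" by (rule assms[OF \<open>finite F\<close>])
    finally show "(\<Sum>k\<in>F. norm (d k *\<^sub>R hartley_C k)) \<le> C" .
  qed
  finally show "norm (series d) \<le> C" .
qed

lemma coef_series:
  assumes "absolutely_summable d"
  shows "coef (apply_bcontfun (series d)) k = d k"
proof -
  have "((\<lambda>l. d l * L2_inner (hartley l) (hartley k)) has_sum coef (apply_bcontfun (series d)) k) UNIV"
    using series_linear[OF assms bounded_linear_L2_inner[OF square_integrable_hartley[of k]]]
    by (simp add: apply_hartley_C coef_def)
  moreover have "((\<lambda>l. d l * L2_inner (hartley l) (hartley k)) has_sum d k) UNIV"
    by (rule has_sum_finite_neutralI[of "{k}"]) (auto simp: L2_inner_hartley)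
  ultimately show ?thesis by (rule has_sum_unique)
qed

lemma bounded_linear_eval: "bounded_linear (\<lambda>x::cfun. apply_bcontfun x z)"
proof (rule bounded_linear_intro[where K = 1])
  show "norm (apply_bcontfun x z) \<le> norm x * 1" for x :: cfun using norm_bounded[of x z] by simp
qed (auto simp: plus_bcontfun.rep_eq scaleR_bcontfun.rep_eq)

lemma periodic_series:
  assumes "absolutely_summable d"
  shows "periodic (apply_bcontfun (series d))"
proof -
  have s: "((\<lambda>k. d k * hartley k z) has_sum apply_bcontfun (series d) z) UNIV" for z
    using series_linear[OF assms bounded_linear_eval[of z]] by (simp add: apply_hartley_C)
  have "hartley k (x + 2 * pi, y) = hartley k (x, y)" "hartley k (x, y + 2 * pi) = hartley k (x, y)" for k x y
    using periodic_hartley[of k] by (auto simp: periodic_def)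
  then have "((\<lambda>k. d k * hartley k (x, y)) has_sum apply_bcontfun (series d) (x + 2 * pi, y)) UNIV"
    "((\<lambda>k. d k * hartley k (x, y)) has_sum apply_bcontfun (series d) (x, y + 2 * pi)) UNIV" for x y
    using s[of "(x + 2 * pi, y)"] s[of "(x, y + 2 * pi)"] by simp_all
  from this[THEN has_sum_unique, OF s]
  show ?thesis by (simp add: periodic_def)
qed

section \<open>Regularity\<close>

lemma coef_square_summable:
  assumes "square_integrable f"
  shows "absolutely_summable (\<lambda>k. coef f k * coef f k)"
  using has_sum_imp_summable[OF Parseval[OF assms assms]] by simp

text \<open>
  If a derivative acts on Fourier coefficients as a multiplier \<open>q\<close> followed by an index change \<open>\<tau>\<close>, then by
  Parseval's identity the weak derivative of \<open>u\<close> must have the coefficients of the transposed operation.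
  When these are summable, their series is such a function. For odd order \<open>\<tau>\<close> is negation, for even
  order the identity.
\<close>

lemma ex_weak_partial:
  assumes u: "square_integrable u"
    and smooth: "\<And>\<phi>. \<phi> \<in> smooth_torus \<Longrightarrow> (partial1 ^^ a) ((partial2 ^^ b) \<phi>) \<in> smooth_torus"
    and coef: "\<And>\<phi> k. \<phi> \<in> smooth_torus \<Longrightarrow> coef ((partial1 ^^ a) ((partial2 ^^ b) \<phi>)) k = q k * coef \<phi> (\<tau> k)"
    and \<tau>: "\<And>k. \<tau> (\<tau> k) = k"
    and summable: "absolutely_summable (\<lambda>k. coef u k * q k)"
  shows "\<exists>w\<in>L2_torus. has_weak_partial a b u w"
proof -
  define s :: real where "s = (- 1) ^ (a + b)"
  define d where "d k = s * (coef u (\<tau> k) * q (\<tau> k))" for k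
  have ss: "s * s = 1" by (simp add: s_def flip: power_add mult_2)
  have bij: "bij \<tau>" using \<tau> by (rule involuntory_imp_bij)
  have "absolutely_summable (\<lambda>k. coef u (\<tau> k) * q (\<tau> k))"
    using summable summable_on_reindex_bij_betw[OF bij, of "\<lambda>k. norm (coef u k * q k)"] by simp
  then have d: "absolutely_summable d"
    unfolding d_def by (simp add: abs_mult summable_on_cmult_right)
  let ?w = "apply_bcontfun (series d)"
  have "has_weak_partial a b u ?w"
    unfolding has_weak_partial_def
  proof
    fix \<phi> assume \<phi>: "\<phi> \<in> smooth_torus"
    let ?D = "(partial1 ^^ a) ((partial2 ^^ b) \<phi>)"
    have "((\<lambda>k. coef u k * coef ?D k) has_sum L2_inner u ?D) UNIV"
      by (intro Parseval u smooth_square_integrable smooth \<phi>)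
    then have "((\<lambda>k. coef u (\<tau> k) * coef ?D (\<tau> k)) has_sum L2_inner u ?D) UNIV"
      using has_sum_reindex_bij_betw[OF bij, of "\<lambda>k. coef u k * coef ?D k"] by simp
    moreover have "coef u (\<tau> k) * coef ?D (\<tau> k) = s * (coef ?w k * coef \<phi> k)" for k
      using ss by (simp add: coef[OF \<phi>] \<tau> coef_series[OF d] d_def mult.assoc[symmetric])
    ultimately have "((\<lambda>k. s * (coef ?w k * coef \<phi> k)) has_sum L2_inner u ?D) UNIV" by simp
    moreover have "((\<lambda>k. s * (coef ?w k * coef \<phi> k)) has_sum s * L2_inner ?w \<phi>) UNIV"
      by (intro has_sum_cmult_right Parseval square_integrable_cfun smooth_square_integrable \<phi>)
    ultimately have "L2_inner u ?D = s * L2_inner ?w \<phi>" by (rule has_sum_unique)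
    then show "(\<integral>z. u z * ?D z \<partial>torus) = (- 1) ^ (a + b) * (\<integral>z. ?w z * \<phi> z \<partial>torus)"
      by (simp add: L2_inner_def s_def)
  qed
  moreover have "?w \<in> L2_torus"
    by (simp add: L2_torus_iff periodic_series[OF d] square_integrable_cfun)
  ultimately show ?thesis by blast
qed

lemma summable_int_squares: "(\<lambda>m::int. 1 / (1 + (of_int m)\<^sup>2 :: real)) summable_on UNIV"
proof -
  have "summable (\<lambda>n. 1 / (1 + (real n)\<^sup>2))"
  proof (rule summable_comparison_test[OF _ inverse_power_summable[of 2]])
    show "\<exists>N. \<forall>n\<ge>N. norm (1 / (1 + (real n)\<^sup>2)) \<le> inverse (real n ^ 2)"
      by (intro exI[of _ 1]) (auto simp: inverse_eq_divide intro!: frac_le)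
  qed simp
  then have nat: "(\<lambda>n. 1 / (1 + (real n)\<^sup>2)) summable_on UNIV"
    by (subst summable_on_UNIV_nonneg_real_iff) auto
  have inj: "inj int" "inj (\<lambda>n. - int n)" by (auto simp: inj_on_def)
  have "(\<lambda>m::int. 1 / (1 + (of_int m)\<^sup>2 :: real)) summable_on (range int)"
    using nat by (subst summable_on_reindex[OF inj(1)]) (simp add: o_def)
  moreover have "(\<lambda>m::int. 1 / (1 + (of_int m)\<^sup>2 :: real)) summable_on (range (\<lambda>n. - int n))"
    using nat by (subst summable_on_reindex[OF inj(2)]) (simp add: o_def)
  ultimately have "(\<lambda>m::int. 1 / (1 + (of_int m)\<^sup>2 :: real)) summable_on (range int \<union> range (\<lambda>n. - int n))"
    by (rule summable_on_union)
  moreover have "range int \<union> range (\<lambda>n. - int n) = UNIV"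
  proof (rule UNIV_eq_I[symmetric])
    show "m \<in> range int \<union> range (\<lambda>n. - int n)" for m by (cases m rule: int_cases2) auto
  qed
  ultimately show ?thesis by simp
qed

lemma norm_sq_nonneg: "norm_sq k \<ge> 0" by (simp add: norm_sq_def)

text \<open>
  Compared with the product of two one-dimensional sums, since \<open>(1 + a\<^sup>2) (1 + b\<^sup>2) \<le> (1 + a\<^sup>2 + b\<^sup>2)\<^sup>2\<close>.
\<close>

lemma summable_norm_sq: "(\<lambda>k. 1 / (1 + norm_sq k)\<^sup>2) summable_on UNIV"
proof -
  define g :: "int \<Rightarrow> real" where "g m = 1 / (1 + (of_int m)\<^sup>2)" for m
  have g: "g summable_on UNIV" unfolding g_def by (rule summable_int_squares)
  have gpos: "g m \<ge> 0" for m by (simp add: g_def)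
  have "(\<lambda>k. g (fst k) * g (snd k)) summable_on Sigma UNIV (\<lambda>_. UNIV)"
  proof (rule summable_on_SigmaI)
    show "((\<lambda>y. g (fst (x, y)) * g (snd (x, y))) has_sum g x * infsum g UNIV) UNIV" for x
      using has_sum_cmult_right[OF has_sum_infsum[OF g], of "g x"] by simp
    show "(\<lambda>x. g x * infsum g UNIV) summable_on UNIV" by (intro summable_on_cmult_left g)
  qed (simp add: gpos)
  then have "(\<lambda>k. g (fst k) * g (snd k)) summable_on UNIV" by simp
  then show ?thesis
  proof (rule summable_on_comparison_test)
    fix k :: "int \<times> int"
    have "(1 + (of_int (fst k))\<^sup>2) * (1 + (of_int (snd k))\<^sup>2) \<le> (1 + norm_sq k) * (1 + norm_sq k)"
      by (intro mult_mono) (auto simp: norm_sq_def)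
    then show "1 / (1 + norm_sq k)\<^sup>2 \<le> g (fst k) * g (snd k)"
      unfolding g_def times_divide_times_eq by (intro frac_le) (auto simp: power2_eq_square add_pos_nonneg)
  qed simp
qed

text \<open>
  The functions \<open>u\<close> and \<open>f\<close> are square integrable, so \<open>(1 + |k|\<^sup>4) u\<^sub>k\<close> is a square summable family. Division by
  \<open>1 + |k|\<^sup>2\<close>, whose inverse is square summable in two dimensions, shows that \<open>(1 + |k|\<^sup>2) u\<^sub>k\<close> is summable. This
  covers all multipliers of order at most two.
\<close>

lemma H2_of_coef:
  assumes u: "square_integrable u" "periodic u" and f: "square_integrable f"
    and eq: "\<And>k. (norm_sq k)\<^sup>2 * coef u k = coef f k"
  shows "u \<in> H2_torus"
proof -
  have sum0: "absolutely_summable (\<lambda>k. coef u k * (1 + norm_sq k))"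
  proof -
    have uf: "square_integrable (\<lambda>z. u z + f z)" by (intro square_integrable_add u f)
    have "coef (\<lambda>z. u z + f z) k = coef u k + coef f k" for k
      unfolding coef_def by (intro L2_inner_add u f square_integrable_hartley)
    then have v: "coef (\<lambda>z. u z + f z) k = coef u k * (1 + (norm_sq k)\<^sup>2)" for k
      by (simp add: algebra_simps flip: eq)
    have "absolutely_summable (\<lambda>k. coef (\<lambda>z. u z + f z) k * (2 / (1 + norm_sq k)))"
    proof (rule Infinite_Sum.abs_summable_product[OF coef_square_summable[OF uf]])
      show "absolutely_summable (\<lambda>k. 2 / (1 + norm_sq k) * (2 / (1 + norm_sq k)))"
        using summable_on_cmult_right[OF summable_norm_sq, of 4] by (simp add: power2_eq_square)
    qed
    then show ?thesis
    proof (rule Infinite_Sum.abs_summable_on_comparison_test)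
      fix k
      have n: "norm_sq k \<ge> 0" by (rule norm_sq_nonneg)
      have "(1 + norm_sq k) * (1 + norm_sq k) \<le> 2 * (1 + (norm_sq k)\<^sup>2)"
        using zero_le_power2[of "norm_sq k - 1"] by (simp add: power2_eq_square algebra_simps)
      then have "1 + norm_sq k \<le> (1 + (norm_sq k)\<^sup>2) * (2 / (1 + norm_sq k))"
        using n by (simp add: pos_le_divide_eq)
      then have "\<bar>coef u k\<bar> * (1 + norm_sq k) \<le> \<bar>coef u k\<bar> * ((1 + (norm_sq k)\<^sup>2) * (2 / (1 + norm_sq k)))"
        by (rule mult_left_mono) simp
      moreover have "\<bar>(1 + (norm_sq k)\<^sup>2) * (2 / (1 + norm_sq k))\<bar> = (1 + (norm_sq k)\<^sup>2) * (2 / (1 + norm_sq k))"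
        "\<bar>1 + norm_sq k\<bar> = 1 + norm_sq k" using n by simp_all
      ultimately show "norm (coef u k * (1 + norm_sq k)) \<le> norm (coef (\<lambda>z. u z + f z) k * (2 / (1 + norm_sq k)))"
        unfolding v real_norm_def mult.assoc abs_mult[of "coef u k"] by (simp only:)
    qed
  qed
  have sum: "absolutely_summable (\<lambda>k. coef u k * q k)" if "\<And>k. \<bar>q k\<bar> \<le> 1 + norm_sq k" for q
    using sum0
  proof (rule Infinite_Sum.abs_summable_on_comparison_test)
    show "norm (coef u k * q k) \<le> norm (coef u k * (1 + norm_sq k))" for k
      using that[of k] norm_sq_nonneg[of k] by (simp add: abs_mult mult_left_mono)
  qed
  have int_sq: "\<bar>of_int i\<bar> \<le> (of_int i :: real)\<^sup>2" for i :: int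
  proof -
    have "\<bar>i\<bar> * 1 \<le> \<bar>i\<bar> * \<bar>i\<bar>"
    proof (cases "i = 0")
      case False
      then have "1 \<le> \<bar>i\<bar>" by linarith
      then show ?thesis by (intro mult_left_mono) auto
    qed simp
    then have "real_of_int (\<bar>i\<bar> * 1) \<le> real_of_int (\<bar>i\<bar> * \<bar>i\<bar>)" by (simp only: of_int_le_iff)
    then show ?thesis by (simp add: power2_eq_square)
  qed
  have q: "\<bar>of_int (fst k)\<bar> \<le> 1 + norm_sq k" "\<bar>of_int (snd k)\<bar> \<le> 1 + norm_sq k"
    "(of_int (fst k))\<^sup>2 \<le> 1 + norm_sq k" "(of_int (snd k))\<^sup>2 \<le> 1 + norm_sq k"
    "\<bar>of_int (fst k) * of_int (snd k)\<bar> \<le> 1 + norm_sq k" for k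
  proof -
    let ?a = "of_int (fst k) :: real" and ?b = "of_int (snd k) :: real"
    have "2 * (\<bar>?a\<bar> * \<bar>?b\<bar>) \<le> ?a\<^sup>2 + ?b\<^sup>2"
      using zero_le_power2[of "\<bar>?a\<bar> - \<bar>?b\<bar>"] by (simp add: power2_diff algebra_simps)
    moreover have "0 \<le> \<bar>?a\<bar> * \<bar>?b\<bar>" by simp
    ultimately have "\<bar>?a\<bar> * \<bar>?b\<bar> \<le> 1 + norm_sq k" unfolding norm_sq_def by linarith
    then show "\<bar>?a * ?b\<bar> \<le> 1 + norm_sq k" by (simp only: abs_mult)
    show "\<bar>?a\<bar> \<le> 1 + norm_sq k" "\<bar>?b\<bar> \<le> 1 + norm_sq k" "?a\<^sup>2 \<le> 1 + norm_sq k" "?b\<^sup>2 \<le> 1 + norm_sq k"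
      using int_sq[of "fst k"] int_sq[of "snd k"] zero_le_power2[of ?a] zero_le_power2[of ?b]
      unfolding norm_sq_def by linarith+
  qed
  have "\<exists>w\<in>L2_torus. has_weak_partial a b u w" if "a + b \<le> 2" for a b
  proof -
    consider "a = 0" "b = 0" | "a = 1" "b = 0" | "a = 0" "b = 1" | "a = 2" "b = 0" | "a = 0" "b = 2"
      | "a = 1" "b = 1" using \<open>a + b \<le> 2\<close> by linarith
    then show ?thesis
    proof cases
      case 1
      show ?thesis
        by (rule ex_weak_partial[OF u(1), where q = "\<lambda>_. 1" and \<tau> = id])
          (use sum[of "\<lambda>_. 1"] norm_sq_nonneg in \<open>auto simp: 1\<close>)
    next
      case 2
      show ?thesis
        by (rule ex_weak_partial[OF u(1), where q = "\<lambda>k. - of_int (fst k)" and \<tau> = uminus])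
          (use sum[of "\<lambda>k. - of_int (fst k)"] q(1) in \<open>auto simp: 2 smooth_partial coef_partial\<close>)
    next
      case 3
      show ?thesis
        by (rule ex_weak_partial[OF u(1), where q = "\<lambda>k. - of_int (snd k)" and \<tau> = uminus])
          (use sum[of "\<lambda>k. - of_int (snd k)"] q(2) in \<open>auto simp: 3 smooth_partial coef_partial\<close>)
    next
      case 4
      show ?thesis
        by (rule ex_weak_partial[OF u(1), where q = "\<lambda>k. - (of_int (fst k))\<^sup>2" and \<tau> = id])
          (use sum[of "\<lambda>k. - (of_int (fst k))\<^sup>2"] q(3) in
            \<open>auto simp: 4 smooth_partial coef_partial numeral_2_eq_2\<close>)
    next
      case 5
      show ?thesis
        by (rule ex_weak_partial[OF u(1), where q = "\<lambda>k. - (of_int (snd k))\<^sup>2" and \<tau> = id])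
          (use sum[of "\<lambda>k. - (of_int (snd k))\<^sup>2"] q(4) in
            \<open>auto simp: 5 smooth_partial coef_partial numeral_2_eq_2\<close>)
    next
      case 6
      show ?thesis
        by (rule ex_weak_partial[OF u(1), where q = "\<lambda>k. - (of_int (fst k) * of_int (snd k))" and \<tau> = id])
          (use sum[of "\<lambda>k. - (of_int (fst k) * of_int (snd k))"] q(5) in
            \<open>auto simp: 6 smooth_partial coef_partial\<close>)
    qed
  qed
  then show ?thesis using u by (simp add: H2_torus_def L2_torus_iff)
qed

lemma weak_partial_props:
  assumes "v \<in> H2_torus" "a + b \<le> 2"
  shows "square_integrable (weak_partial a b v)" "has_weak_partial a b v (weak_partial a b v)"
proof -
  have "\<exists>w. w \<in> L2_torus \<and> has_weak_partial a b v w" using assms by (auto simp: H2_torus_def)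
  from someI_ex[OF this] show "square_integrable (weak_partial a b v)" "has_weak_partial a b v (weak_partial a b v)"
    by (simp_all add: weak_partial_def L2_torus_iff)
qed

text \<open>
  The basis functions are themselves test functions. This determines the coefficients whichever
  representatives the choice of weak derivatives picks.
\<close>

lemma laplacian_coef:
  assumes v: "v \<in> H2_torus"
  shows "square_integrable (laplacian v)" "coef (laplacian v) k = - norm_sq k * coef v k"
proof -
  have s: "square_integrable (weak_partial 2 0 v)" "square_integrable (weak_partial 0 2 v)"
    using weak_partial_props[OF v] by auto
  then show "square_integrable (laplacian v)" unfolding laplacian_def by (rule square_integrable_add)
  have D: "(partial1 ^^ 2) ((partial2 ^^ 0) (hartley k)) = (\<lambda>z. - (of_int (fst k))\<^sup>2 * hartley k z)"
    "(partial1 ^^ 0) ((partial2 ^^ 2) (hartley k)) = (\<lambda>z. - (of_int (snd k))\<^sup>2 * hartley k z)"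
    using partial_hartley[of 1 k] partial_hartley[of _ "- k"] by (simp_all add: numeral_2_eq_2)
  have "coef (weak_partial 2 0 v) k = - (of_int (fst k))\<^sup>2 * coef v k"
    using bspec[OF weak_partial_props(2)[OF v, of 2 0, unfolded has_weak_partial_def] smooth_hartley[of k]]
    unfolding D L2_inner_def[symmetric] L2_inner_commute[of v] L2_inner_cmult by (simp add: coef_def L2_inner_commute[of v])
  moreover have "coef (weak_partial 0 2 v) k = - (of_int (snd k))\<^sup>2 * coef v k"
    using bspec[OF weak_partial_props(2)[OF v, of 0 2, unfolded has_weak_partial_def] smooth_hartley[of k]]
    unfolding D L2_inner_def[symmetric] L2_inner_commute[of v] L2_inner_cmult by (simp add: coef_def L2_inner_commute[of v])
  moreover have "coef (laplacian v) k = coef (weak_partial 2 0 v) k + coef (weak_partial 0 2 v) k"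
    unfolding coef_def laplacian_def by (intro L2_inner_add s square_integrable_hartley)
  ultimately show "coef (laplacian v) k = - norm_sq k * coef v k" by (simp add: norm_sq_def algebra_simps)
qed

text \<open>
  Both sides equal the sum of \<open>|k|\<^sup>4 u\<^sub>k v\<^sub>k\<close>.
\<close>

theorem weak_equation_of_coef:
  assumes u: "u \<in> H2_torus" and f: "square_integrable f"
    and eq: "\<And>k. (norm_sq k)\<^sup>2 * coef u k = coef f k" and v: "v \<in> H2_torus"
  shows "(\<integral>z. laplacian u z * laplacian v z \<partial>torus) = (\<integral>z. f z * v z \<partial>torus)"
proof -
  have "square_integrable v" using v by (simp add: H2_torus_def L2_torus_iff)
  have "((\<lambda>k. coef (laplacian u) k * coef (laplacian v) k) has_sum L2_inner (laplacian u) (laplacian v)) UNIV"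
    by (intro Parseval laplacian_coef u v)
  moreover have "coef (laplacian u) k * coef (laplacian v) k = coef f k * coef v k" for k
    by (simp add: laplacian_coef u v power2_eq_square mult_ac flip: eq)
  ultimately have "((\<lambda>k. coef f k * coef v k) has_sum L2_inner (laplacian u) (laplacian v)) UNIV" by simp
  moreover have "((\<lambda>k. coef f k * coef v k) has_sum L2_inner f v) UNIV"
    by (intro Parseval f \<open>square_integrable v\<close>)
  ultimately have "L2_inner (laplacian u) (laplacian v) = L2_inner f v" by (rule has_sum_unique)
  then show ?thesis by (simp add: L2_inner_def)
qed

section \<open>The resolvent\<close>

text \<open>
  The symbol of the inverse of \<open>\<Delta>\<^sup>2 - m\<^sup>2\<close>, set to zero on the kernel \<open>|k|\<^sup>2 = m\<close>.
\<close>

definition weight :: "real \<Rightarrow> int \<times> int \<Rightarrow> real" where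
  "weight m k = (if norm_sq k = m then 0 else 1 / ((norm_sq k)\<^sup>2 - m\<^sup>2))"

definition resolvent :: "real \<Rightarrow> (cfun \<Rightarrow> real) \<Rightarrow> cfun" where
  "resolvent m \<phi> = series (\<lambda>k. \<phi> (hartley_C k) * weight m k)"

abbreviation C_inner :: "cfun \<Rightarrow> cfun \<Rightarrow> real" where
  "C_inner x y \<equiv> L2_inner (apply_bcontfun x) (apply_bcontfun y)"

text \<open>
  By Cauchy-Schwarz, \<open>\<kappa>\<close> then bounds the resolvent as a map from \<open>L\<^sup>2\<close>-bounded functionals to the sup norm.
\<close>

definition weight_bound :: "real \<Rightarrow> real \<Rightarrow> bool" where
  "weight_bound m \<kappa> \<longleftrightarrow> \<kappa> \<ge> 0 \<and> (\<forall>F. finite F \<longrightarrow> (\<Sum>k\<in>F. (weight m k)\<^sup>2) \<le> \<kappa>\<^sup>2)"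

lemma apply_sum:
  "apply_bcontfun (\<Sum>k\<in>F. c k *\<^sub>R hartley_C k) = (\<lambda>z. \<Sum>k\<in>F. c k * hartley k z)"
proof
  fix z
  interpret bounded_linear "\<lambda>x::cfun. apply_bcontfun x z" by (rule bounded_linear_eval)
  show "apply_bcontfun (\<Sum>k\<in>F. c k *\<^sub>R hartley_C k) z = (\<Sum>k\<in>F. c k * hartley k z)"
    by (simp add: sum apply_hartley_C scaleR_bcontfun.rep_eq)
qed

lemma L2_inner_hartley_sum_left:
  assumes "square_integrable g"
  shows "L2_inner (\<lambda>z. \<Sum>k\<in>F. c k * hartley k z) g = (\<Sum>k\<in>F. c k * coef g k)"
proof -
  have "L2_inner (\<lambda>z. \<Sum>k\<in>F. c k * hartley k z) g = (\<Sum>k\<in>F. L2_inner (\<lambda>z. c k * hartley k z) g)"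
    by (intro L2_inner_sum square_integrable_cmult square_integrable_hartley assms)
  also have "\<dots> = (\<Sum>k\<in>F. c k * coef g k)"
    unfolding L2_inner_cmult coef_def L2_inner_commute[of g] ..
  finally show ?thesis .
qed

lemma L2_inner_hartley_sum:
  assumes "finite F"
  shows "L2_inner (\<lambda>z. \<Sum>k\<in>F. c k * hartley k z) (\<lambda>z. \<Sum>k\<in>F. d k * hartley k z) = (\<Sum>k\<in>F. c k * d k)"
proof -
  have "square_integrable (\<lambda>z. \<Sum>k\<in>F. d k * hartley k z)"
    by (intro square_integrable_sum square_integrable_cmult square_integrable_hartley)
  then have "L2_inner (\<lambda>z. \<Sum>k\<in>F. c k * hartley k z) (\<lambda>z. \<Sum>k\<in>F. d k * hartley k z)
      = (\<Sum>k\<in>F. c k * (if k \<in> F then d k else 0))"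
    unfolding coef_hartley_sum[OF assms, symmetric] by (rule L2_inner_hartley_sum_left)
  also have "\<dots> = (\<Sum>k\<in>F. c k * d k)" by (intro sum.cong) auto
  finally show ?thesis .
qed

text \<open>
  The functional is tested with \<open>y = \<Sum> \<xi>(e\<^sub>k) e\<^sub>k\<close>, for which \<open>\<xi> y\<close> and the square of the \<open>L\<^sup>2\<close> norm of \<open>y\<close>
  coincide.
\<close>

lemma functional_Bessel:
  assumes lin: "linear \<xi>" and bound: "\<And>y. \<bar>\<xi> y\<bar> \<le> C * sqrt (C_inner y y)" and F: "finite F"
  shows "(\<Sum>k\<in>F. (\<xi> (hartley_C k))\<^sup>2) \<le> C\<^sup>2"
proof -
  define Q where "Q = (\<Sum>k\<in>F. (\<xi> (hartley_C k))\<^sup>2)"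
  define y where "y = (\<Sum>k\<in>F. \<xi> (hartley_C k) *\<^sub>R hartley_C k)"
  have "Q \<ge> 0" by (simp add: Q_def sum_nonneg)
  have "\<xi> y = Q" by (simp add: y_def Q_def linear_sum[OF lin] linear_scale[OF lin] power2_eq_square)
  moreover have "C_inner y y = Q" by (simp add: y_def Q_def apply_sum L2_inner_hartley_sum[OF F] power2_eq_square)
  ultimately have *: "Q \<le> C * sqrt Q" using bound[of y] \<open>Q \<ge> 0\<close> by simp
  show ?thesis
  proof (cases "Q = 0")
    case False
    with \<open>Q \<ge> 0\<close> have "sqrt Q > 0" by simp
    moreover have "sqrt Q * sqrt Q \<le> C * sqrt Q" using * \<open>Q \<ge> 0\<close> by simp
    ultimately have "sqrt Q \<le> C" by (simp only: mult_le_cancel_right_pos)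
    then have "(sqrt Q)\<^sup>2 \<le> C\<^sup>2" using \<open>sqrt Q > 0\<close> by (intro power_mono) auto
    then show ?thesis using \<open>Q \<ge> 0\<close> by (simp add: Q_def)
  qed (simp flip: Q_def)
qed

lemma functional_bound_nonneg:
  assumes "\<And>y. \<bar>\<xi> y\<bar> \<le> C * sqrt (C_inner y y)"
  shows "C \<ge> 0"
  using assms[of "hartley_C 0"] by (simp add: apply_hartley_C L2_inner_hartley)

lemma functional_weight_sum:
  assumes lin: "linear \<xi>" and bound: "\<And>y. \<bar>\<xi> y\<bar> \<le> C * sqrt (C_inner y y)"
    and w: "weight_bound m \<kappa>" and F: "finite F"
  shows "(\<Sum>k\<in>F. \<bar>\<xi> (hartley_C k) * weight m k\<bar>) \<le> \<kappa> * C"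
proof -
  have "(\<Sum>k\<in>F. \<bar>\<xi> (hartley_C k)\<bar> * \<bar>weight m k\<bar>)\<^sup>2 \<le> (\<Sum>k\<in>F. \<bar>\<xi> (hartley_C k)\<bar>\<^sup>2) * (\<Sum>k\<in>F. \<bar>weight m k\<bar>\<^sup>2)"
    by (rule Cauchy_Schwarz_ineq_sum)
  also have "\<dots> \<le> C\<^sup>2 * \<kappa>\<^sup>2"
    using functional_Bessel[OF lin bound F] w F unfolding weight_bound_def power2_abs
    by (intro mult_mono) (simp_all add: sum_nonneg)
  also have "\<dots> = (\<kappa> * C)\<^sup>2" by (simp add: power_mult_distrib)
  finally have "(\<Sum>k\<in>F. \<bar>\<xi> (hartley_C k) * weight m k\<bar>)\<^sup>2 \<le> (\<kappa> * C)\<^sup>2" by (simp only: abs_mult)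
  moreover have "\<kappa> * C \<ge> 0"
    using functional_bound_nonneg[OF bound] w unfolding weight_bound_def by (intro mult_nonneg_nonneg) simp_all
  ultimately show ?thesis by (rule power2_le_imp_le)
qed

lemma functional_bounded_linear:
  assumes "functional C_inner \<phi>"
  shows "bounded_linear \<phi>"
proof -
  obtain C where lin: "linear \<phi>" and C_all: "\<forall>y. \<bar>\<phi> y\<bar> \<le> C * sqrt (C_inner y y)"
    using assms unfolding functional_def by (elim conjE exE)
  note C = C_all[THEN spec]
  show ?thesis
  proof (rule bounded_linear_intro[where K = "C * (2 * pi)"])
    show "\<phi> (x + y) = \<phi> x + \<phi> y" "\<phi> (c *\<^sub>R x) = c *\<^sub>R \<phi> x" for x y c
      using lin by (simp_all add: linear_add linear_scale)
    show "norm (\<phi> x) \<le> norm x * (C * (2 * pi))" for x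
    proof -
      have "C * sqrt (C_inner x x) \<le> C * (2 * pi * norm x)"
        by (intro mult_left_mono sqrt_L2_inner_cfun_bound functional_bound_nonneg[OF C])
      with C[of x] show ?thesis by (simp add: mult_ac)
    qed
  qed
qed

lemma resolvent_summable:
  assumes "functional C_inner \<phi>" "weight_bound m \<kappa>"
  shows "absolutely_summable (\<lambda>k. \<phi> (hartley_C k) * weight m k)"
proof -
  obtain C where lin: "linear \<phi>" and C_all: "\<forall>y. \<bar>\<phi> y\<bar> \<le> C * sqrt (C_inner y y)"
    using assms(1) unfolding functional_def by (elim conjE exE)
  note C = C_all[THEN spec]
  show ?thesis by (rule norm_series(1)[OF functional_weight_sum[OF lin C assms(2)]])
qed

lemma resolvent_bound:
  assumes \<phi>: "functional C_inner \<phi>" and \<psi>: "functional C_inner \<psi>" and w: "weight_bound m \<kappa>"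
    and bound: "\<And>y. \<bar>\<phi> y - \<psi> y\<bar> \<le> C * sqrt (C_inner y y)"
  shows "norm (resolvent m \<phi> - resolvent m \<psi>) \<le> \<kappa> * C"
proof -
  define \<xi> where "\<xi> y = \<phi> y - \<psi> y" for y
  have lin: "linear \<xi>" unfolding \<xi>_def
    using \<phi> \<psi> by (intro linear_compose_sub) (auto simp: functional_def)
  have sum: "(\<Sum>k\<in>F. \<bar>\<xi> (hartley_C k) * weight m k\<bar>) \<le> \<kappa> * C" if "finite F" for F
    by (rule functional_weight_sum[OF lin _ w that]) (simp add: \<xi>_def bound)
  have "((\<lambda>k. (\<xi> (hartley_C k) * weight m k) *\<^sub>R hartley_C k + (\<psi> (hartley_C k) * weight m k) *\<^sub>R hartley_C k)
      has_sum (series (\<lambda>k. \<xi> (hartley_C k) * weight m k) + resolvent m \<psi>)) UNIV"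
    unfolding resolvent_def
    by (intro has_sum_add series_has_sum resolvent_summable[OF \<psi> w] norm_series(1)[OF sum])
  moreover have "(\<xi> (hartley_C k) * weight m k) *\<^sub>R hartley_C k + (\<psi> (hartley_C k) * weight m k) *\<^sub>R hartley_C k
      = (\<phi> (hartley_C k) * weight m k) *\<^sub>R hartley_C k" for k
    by (simp add: \<xi>_def flip: scaleR_add_left distrib_right)
  ultimately have "((\<lambda>k. (\<phi> (hartley_C k) * weight m k) *\<^sub>R hartley_C k)
      has_sum (series (\<lambda>k. \<xi> (hartley_C k) * weight m k) + resolvent m \<psi>)) UNIV"
    by (simp only:)
  moreover have "((\<lambda>k. (\<phi> (hartley_C k) * weight m k) *\<^sub>R hartley_C k) has_sum resolvent m \<phi>) UNIV"
    unfolding resolvent_def by (rule series_has_sum[OF resolvent_summable[OF \<phi> w]])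
  ultimately have "series (\<lambda>k. \<xi> (hartley_C k) * weight m k) + resolvent m \<psi> = resolvent m \<phi>"
    by (rule has_sum_unique)
  then have "resolvent m \<phi> - resolvent m \<psi> = series (\<lambda>k. \<xi> (hartley_C k) * weight m k)"
    by (simp add: algebra_simps)
  then show ?thesis using norm_series(2)[OF sum] by simp
qed

lemma resolvent_0: "resolvent m (\<lambda>y. 0) = 0"
  by (simp add: resolvent_def series_def)

text \<open>
  Both sides are the sum of \<open>\<phi>(e\<^sub>k) \<psi>(e\<^sub>k)\<close> with the weights.
\<close>

lemma resolvent_sym:
  assumes \<phi>: "functional C_inner \<phi>" and \<psi>: "functional C_inner \<psi>" and w: "weight_bound m \<kappa>"
  shows "\<phi> (resolvent m \<psi>) = \<psi> (resolvent m \<phi>)"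
proof -
  have "((\<lambda>k. \<psi> (hartley_C k) * weight m k * \<phi> (hartley_C k)) has_sum \<phi> (resolvent m \<psi>)) UNIV"
    unfolding resolvent_def
    by (rule series_linear[OF resolvent_summable[OF \<psi> w] functional_bounded_linear[OF \<phi>]])
  moreover have "((\<lambda>k. \<phi> (hartley_C k) * weight m k * \<psi> (hartley_C k)) has_sum \<psi> (resolvent m \<phi>)) UNIV"
    unfolding resolvent_def
    by (rule series_linear[OF resolvent_summable[OF \<phi> w] functional_bounded_linear[OF \<psi>]])
  moreover have "\<phi> (hartley_C k) * weight m k * \<psi> (hartley_C k) = \<psi> (hartley_C k) * weight m k * \<phi> (hartley_C k)" for k
    by simp
  ultimately have "((\<lambda>k. \<psi> (hartley_C k) * weight m k * \<phi> (hartley_C k)) has_sum \<phi> (resolvent m \<psi>)) UNIV"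
    "((\<lambda>k. \<psi> (hartley_C k) * weight m k * \<phi> (hartley_C k)) has_sum \<psi> (resolvent m \<phi>)) UNIV" by (simp_all only:)
  then show ?thesis by (rule has_sum_unique)
qed

lemma coef_resolvent:
  assumes "functional C_inner \<phi>" "weight_bound m \<kappa>"
  shows "coef (apply_bcontfun (resolvent m \<phi>)) k = \<phi> (hartley_C k) * weight m k"
  unfolding resolvent_def by (rule coef_series[OF resolvent_summable[OF assms]])

lemma periodic_resolvent:
  assumes "functional C_inner \<phi>" "weight_bound m \<kappa>"
  shows "periodic (apply_bcontfun (resolvent m \<phi>))"
  unfolding resolvent_def by (rule periodic_series[OF resolvent_summable[OF assms]])

text \<open>
  Distinct integers \<open>|k|\<^sup>2\<close> and \<open>n\<close> differ by at least one, so \<open>||k|\<^sup>4 - n\<^sup>2| \<ge> |k|\<^sup>2 + n\<close>.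
\<close>

lemma weight_square_le:
  fixes n :: nat
  assumes "n \<ge> 1"
  shows "(weight (real n) k)\<^sup>2 \<le> 1 / (1 + norm_sq k)\<^sup>2" "(weight (real n) k)\<^sup>2 \<le> 1 / (real n)\<^sup>2"
proof -
  have n: "real n \<ge> 1" using assms by simp
  have *: "(weight (real n) k)\<^sup>2 \<le> 1 / (norm_sq k + real n)\<^sup>2"
  proof (cases "norm_sq k = real n")
    case False
    define i where "i = (fst k)\<^sup>2 + (snd k)\<^sup>2"
    have i: "norm_sq k = of_int i" by (simp add: norm_sq_def i_def)
    with False have "i \<noteq> int n" by auto
    \<comment> \<open>The gap comes from integrality.\<close>
    then have "1 \<le> \<bar>i - int n\<bar>" by linarith
    then have "of_int 1 \<le> (of_int \<bar>i - int n\<bar> :: real)" by (simp only: of_int_le_iff)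
    then have "1 \<le> \<bar>norm_sq k - real n\<bar>" by (simp add: i)
    then have "1 \<le> (norm_sq k - real n)\<^sup>2" using power_mono[of 1 "\<bar>norm_sq k - real n\<bar>" 2] by simp
    then have "1 * (norm_sq k + real n)\<^sup>2 \<le> (norm_sq k - real n)\<^sup>2 * (norm_sq k + real n)\<^sup>2"
      by (rule mult_right_mono) simp
    also have "\<dots> = ((norm_sq k)\<^sup>2 - (real n)\<^sup>2)\<^sup>2" by (simp add: power2_eq_square algebra_simps)
    finally have "(norm_sq k + real n)\<^sup>2 \<le> ((norm_sq k)\<^sup>2 - (real n)\<^sup>2)\<^sup>2" by simp
    moreover have "(weight (real n) k)\<^sup>2 = 1 / ((norm_sq k)\<^sup>2 - (real n)\<^sup>2)\<^sup>2"
      using False by (simp add: weight_def power_divide)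
    moreover have "norm_sq k + real n > 0" using norm_sq_nonneg[of k] n by linarith
    ultimately show ?thesis by (simp add: frac_le)
  qed (simp add: weight_def)
  have "1 / (norm_sq k + real n)\<^sup>2 \<le> 1 / (1 + norm_sq k)\<^sup>2" "1 / (norm_sq k + real n)\<^sup>2 \<le> 1 / (real n)\<^sup>2"
    using norm_sq_nonneg[of k] n by (auto intro!: frac_le power_mono)
  with * show "(weight (real n) k)\<^sup>2 \<le> 1 / (1 + norm_sq k)\<^sup>2" "(weight (real n) k)\<^sup>2 \<le> 1 / (real n)\<^sup>2"
    by linarith+
qed

text \<open>
  Dominated convergence for sums: the first estimate of the weights makes the tail outside a finite
  set small uniformly in \<open>n\<close>, the second one makes the finite part tend to zero.
\<close>

lemma weight_bound_eventually:
  assumes "\<kappa> > 0"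
  shows "eventually (\<lambda>n. weight_bound (real n) \<kappa>) sequentially"
proof -
  define g where "g k = 1 / (1 + norm_sq k)\<^sup>2" for k
  define e where "e = \<kappa>\<^sup>2 / 2"
  have "e > 0" using assms by (simp add: e_def)
  have g: "(g has_sum infsum g UNIV) UNIV" unfolding g_def by (intro has_sum_infsum summable_norm_sq)
  have gpos: "g k \<ge> 0" for k by (simp add: g_def)
  have "eventually (\<lambda>F. sum g F > infsum g UNIV - e) (finite_subsets_at_top UNIV)"
    using g \<open>e > 0\<close> unfolding has_sum_def by (intro order_tendstoD(1)) auto
  then obtain F0 where F0: "finite F0" "sum g F0 > infsum g UNIV - e"
    by (auto simp: eventually_finite_subsets_at_top)
  have tail: "sum g (F - F0) \<le> e" if "finite F" for F
  proof -
    have "sum g F0 + sum g (F - F0) = sum g (F0 \<union> F)"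
      using F0 that by (subst sum.union_disjoint[symmetric]) auto
    also have "\<dots> \<le> infsum g UNIV"
      using F0 that gpos g by (intro finite_sum_le_infsum) (auto simp: summable_on_def)
    finally show ?thesis using F0 by linarith
  qed
  have ev: "eventually (\<lambda>n. real (card F0) / e \<le> real n) sequentially"
    using filterlim_real_sequentially unfolding filterlim_at_top by (rule spec)
  show ?thesis
    using ev eventually_ge_at_top[of 1]
  proof eventually_elim
    case (elim n)
    have "(\<Sum>k\<in>F. (weight (real n) k)\<^sup>2) \<le> \<kappa>\<^sup>2" if F: "finite F" for F
    proof -
      have "(\<Sum>k\<in>F. (weight (real n) k)\<^sup>2)
          = (\<Sum>k\<in>F - F0. (weight (real n) k)\<^sup>2) + (\<Sum>k\<in>F \<inter> F0. (weight (real n) k)\<^sup>2)"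
        using sum.Int_Diff[OF F, of "\<lambda>k. (weight (real n) k)\<^sup>2" F0] by simp
      also have "\<dots> \<le> sum g (F - F0) + (\<Sum>k\<in>F \<inter> F0. 1 / (real n)\<^sup>2)"
        unfolding g_def using elim(2) by (intro add_mono sum_mono weight_square_le)
      also have "\<dots> \<le> e + e"
      proof (rule add_mono[OF tail[OF F]])
        have "real n \<ge> 1" using elim(2) by simp
        have "(\<Sum>k\<in>F \<inter> F0. 1 / (real n)\<^sup>2) = real (card (F \<inter> F0)) / (real n)\<^sup>2" by simp
        also have "\<dots> \<le> real (card F0) / real n"
          using F0 \<open>real n \<ge> 1\<close> by (intro frac_le) (auto intro: card_mono simp: power2_eq_square)
        also have "\<dots> \<le> e" using elim(1) \<open>e > 0\<close> \<open>real n \<ge> 1\<close> by (simp add: field_simps)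
        finally show "(\<Sum>k\<in>F \<inter> F0. 1 / (real n)\<^sup>2) \<le> e" .
      qed
      finally show ?thesis by (simp add: e_def)
    qed
    then show ?case using assms by (auto simp: weight_bound_def)
  qed
qed

section \<open>Four-dimensional eigenspaces\<close>

definition freq :: "nat \<Rightarrow> 4 \<Rightarrow> int \<times> int" where
  "freq j i = (if i = 1 then (2 ^ j, 0) else if i = 2 then (- (2 ^ j), 0)
     else if i = 3 then (0, 2 ^ j) else (0, - (2 ^ j)))"

definition eigen :: "nat \<Rightarrow> real ^ 4 \<Rightarrow> cfun" where
  "eigen j a = (\<Sum>i\<in>UNIV. a $ i *\<^sub>R hartley_C (freq j i))"

text \<open>
  Squares are \<open>0\<close> or \<open>1\<close> modulo four, so for positive \<open>j\<close> both numbers are even and one can descend.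
\<close>

lemma sum_two_squares_power4:
  fixes a b :: int
  assumes "a\<^sup>2 + b\<^sup>2 = 4 ^ j"
  shows "(a, b) \<in> {(2 ^ j, 0), (- (2 ^ j), 0), (0, 2 ^ j), (0, - (2 ^ j))}"
  using assms
proof (induction j arbitrary: a b)
  case 0
  then have "a\<^sup>2 + b\<^sup>2 = 1" by simp
  then have "a = 0 \<and> b\<^sup>2 = 1 \<or> b = 0 \<and> a\<^sup>2 = 1"
  proof (cases "a = 0")
    case False
    then have "0 < a\<^sup>2" by simp
    then have "b\<^sup>2 \<le> 0" using \<open>a\<^sup>2 + b\<^sup>2 = 1\<close> by linarith
    then have "b = 0" by simp
    then show ?thesis using \<open>a\<^sup>2 + b\<^sup>2 = 1\<close> by simp
  qed simp
  then show ?case by (auto simp: power2_eq_1_iff)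
next
  case (Suc j)
  have sq: "x\<^sup>2 mod 4 = x mod 2" for x :: int
  proof (cases "even x")
    case True
    then obtain c where "x = 2 * c" by (elim evenE)
    then show ?thesis by (simp add: power2_eq_square)
  next
    case False
    then obtain c where "x = 2 * c + 1" by (elim oddE)
    then have "x\<^sup>2 = 4 * (c * c + c) + 1" by (simp add: power2_eq_square algebra_simps)
    moreover have "(4 * d + 1) mod 4 = (1::int)" for d by presburger
    ultimately show ?thesis using False by (simp only: odd_iff_mod_2_eq_one)
  qed
  have "(a\<^sup>2 + b\<^sup>2) mod 4 = 0" using Suc.prems by simp
  then have "(a mod 2 + b mod 2) mod 4 = 0" by (metis mod_add_eq sq)
  then have "even a" "even b" by presburger+
  then obtain c d where cd: "a = 2 * c" "b = 2 * d" by (elim evenE)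
  then have "c\<^sup>2 + d\<^sup>2 = 4 ^ j" using Suc.prems by (simp add: power2_eq_square)
  from Suc.IH[OF this] show ?case by (auto simp: cd)
qed

lemma norm_sq_freq: "norm_sq (freq j i) = 4 ^ j"
proof -
  have "(2 ^ j)\<^sup>2 = (4 ^ j :: real)" by (simp add: power2_eq_square flip: power_mult_distrib)
  then show ?thesis by (simp add: norm_sq_def freq_def)
qed

lemma inj_freq: "inj (freq j)"
proof -
  have "(2::int) ^ j \<noteq> 0" "- (2 ^ j) \<noteq> (2 ^ j :: int)" by (simp_all add: minus_equation_iff)
  moreover have "x = y" if "freq j x = freq j y" for x y :: 4
    using that exhaust_4[of x] exhaust_4[of y] calculation
    by (auto simp: freq_def split: if_splits)
  ultimately show ?thesis by (simp add: inj_def)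
qed

lemma norm_sq_eq_freq:
  assumes "norm_sq k = 4 ^ j"
  obtains i where "k = freq j i"
proof -
  have "of_int ((fst k)\<^sup>2 + (snd k)\<^sup>2) = (of_int (4 ^ j) :: real)" using assms by (simp add: norm_sq_def)
  then have "(fst k)\<^sup>2 + (snd k)\<^sup>2 = 4 ^ j" by (simp only: of_int_eq_iff)
  from sum_two_squares_power4[OF this]
  have "k = freq j 1 \<or> k = freq j 2 \<or> k = freq j 3 \<or> k = freq j 4"
    by (auto simp: freq_def prod_eq_iff)
  then show ?thesis using that by blast
qed

lemma eigen_linear: "linear (eigen j)"
  by (rule linearI) (simp_all add: eigen_def scaleR_add_left sum.distrib scaleR_sum_right)

lemma eigen_apply: "apply_bcontfun (eigen j a) = (\<lambda>z. \<Sum>k\<in>range (freq j). a $ (inv (freq j) k) * hartley k z)"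
proof -
  have "eigen j a = (\<Sum>k\<in>range (freq j). a $ (inv (freq j) k) *\<^sub>R hartley_C k)"
    unfolding eigen_def by (subst sum.reindex[OF inj_freq]) (simp add: inv_f_f[OF inj_freq])
  then show ?thesis by (simp only: apply_sum)
qed

lemma eigen_inner: "C_inner (eigen j a) (eigen j b) = a \<bullet> b"
proof -
  have "C_inner (eigen j a) (eigen j b) = (\<Sum>k\<in>range (freq j). a $ (inv (freq j) k) * b $ (inv (freq j) k))"
    unfolding eigen_apply by (rule L2_inner_hartley_sum) simp
  also have "\<dots> = (\<Sum>i\<in>UNIV. a $ i * b $ i)"
    by (subst sum.reindex[OF inj_freq]) (simp add: inv_f_f[OF inj_freq])
  finally show ?thesis by (simp add: inner_vec_def)
qed

lemma eigen_bound: "norm (eigen j a) \<le> 4 * norm a"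
proof -
  have "norm (eigen j a) \<le> (\<Sum>i\<in>UNIV. norm (a $ i *\<^sub>R hartley_C (freq j i)))"
    unfolding eigen_def by (rule norm_sum)
  also have "\<dots> \<le> (\<Sum>i\<in>(UNIV :: 4 set). norm a)"
  proof (rule sum_mono)
    fix i
    have "\<bar>a $ i\<bar> * norm (hartley_C (freq j i)) \<le> norm a * 1"
      using component_le_norm_cart[of a i] norm_hartley_C by (intro mult_mono) auto
    then show "norm (a $ i *\<^sub>R hartley_C (freq j i)) \<le> norm a" by simp
  qed
  finally show ?thesis by simp
qed

lemma eigen_axis: "eigen j (axis i 1) = hartley_C (freq j i)"
  unfolding eigen_def by (subst sum.remove[of _ i]) (auto simp: axis_def intro!: sum.neutral)

lemma coef_eigen: "coef (apply_bcontfun (eigen j a)) k = (if k \<in> range (freq j) then a $ (inv (freq j) k) else 0)"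
  unfolding eigen_apply by (rule coef_hartley_sum) simp

lemma periodic_eigen: "periodic (apply_bcontfun (eigen j a))"
proof -
  have "hartley k (x + 2 * pi, y) = hartley k (x, y)" "hartley k (x, y + 2 * pi) = hartley k (x, y)" for k x y
    using periodic_hartley[of k] by (auto simp: periodic_def)
  then show ?thesis unfolding eigen_apply periodic_def by simp
qed

lemma resolvent_orth:
  assumes "functional C_inner \<phi>" "weight_bound (4 ^ j) \<kappa>"
  shows "C_inner (resolvent (4 ^ j) \<phi>) (eigen j a) = 0"
proof -
  have "C_inner (eigen j a) (resolvent (4 ^ j) \<phi>)
      = (\<Sum>k\<in>range (freq j). a $ (inv (freq j) k) * coef (apply_bcontfun (resolvent (4 ^ j) \<phi>)) k)"
    unfolding eigen_apply by (rule L2_inner_hartley_sum_left[OF square_integrable_cfun])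
  also have "\<dots> = 0"
    by (rule sum.neutral) (auto simp: coef_resolvent[OF assms] weight_def norm_sq_freq)
  finally show ?thesis by (simp add: L2_inner_commute)
qed

section \<open>The truncated nonlinearity\<close>

definition odd_power :: "real \<Rightarrow> real \<Rightarrow> real" where
  "odd_power p s = \<bar>s\<bar> powr (p - 2) * s"

definition clip :: "real \<Rightarrow> real \<Rightarrow> real" where
  "clip M s = max (- M) (min M s)"

lemma odd_power_minus: "odd_power p (- s) = - odd_power p s"
  by (simp add: odd_power_def)

lemma odd_power_nonneg:
  assumes "s \<ge> 0"
  shows "odd_power p s = s powr (p - 1)"
proof (cases "s = 0")
  case False
  with assms have "s > 0" by simp
  then have "s powr (p - 2) * s powr 1 = s powr (p - 1)" by (subst powr_add[symmetric]) simp
  with \<open>s > 0\<close> show ?thesis by (simp add: odd_power_def)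
qed (simp add: odd_power_def)

text \<open>
  The mean value theorem on \<open>[b, a]\<close> uses the derivative in the interior only, so \<open>b = 0\<close> is admitted.
\<close>

lemma powr_Lipschitz:
  fixes a b :: real
  assumes "0 \<le> b" "b \<le> a" "a \<le> M" "q \<ge> 1"
  shows "\<bar>a powr q - b powr q\<bar> \<le> q * M powr (q - 1) * (a - b)"
proof (cases "a = b")
  case False
  with assms have "b < a" by simp
  have cont: "continuous_on {b..a} (\<lambda>z. z powr q)"
    using assms by (intro continuous_on_powr' continuous_intros) auto
  have d: "((\<lambda>z. z powr q) has_real_derivative q * x powr (q - 1)) (at x)" if "b < x" for x
    using that assms by (intro has_real_derivative_powr) auto
  have dif: "(\<lambda>z. z powr q) differentiable (at x)" if "b < x" "x < a" for x
    using d[OF that(1)] by (rule differentiableI[OF has_field_derivative_imp_has_derivative])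
  have "\<exists>l z. b < z \<and> z < a \<and> ((\<lambda>z. z powr q) has_real_derivative l) (at z)
      \<and> a powr q - b powr q = (a - b) * l"
    by (rule MVT[OF \<open>b < a\<close> cont]) (rule dif)
  then obtain l z where z: "b < z" "z < a" and l: "((\<lambda>z. z powr q) has_real_derivative l) (at z)"
    and eq: "a powr q - b powr q = (a - b) * l"
    by (elim exE conjE)
  have "l = q * z powr (q - 1)" using DERIV_unique[OF l d] z by simp
  moreover have "z powr (q - 1) \<le> M powr (q - 1)"
    using z assms by (intro powr_mono2) auto
  ultimately have "\<bar>l\<bar> \<le> q * M powr (q - 1)" using assms by (simp add: abs_mult mult_left_mono)
  then show ?thesis
    unfolding eq abs_mult using \<open>b < a\<close> mult_right_mono[of "\<bar>l\<bar>" _ "a - b"] by (simp add: mult_ac)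
qed simp

text \<open>
  For arguments of opposite sign one passes through \<open>0\<close>; otherwise oddness reduces to nonnegative ones.
\<close>

lemma odd_power_Lipschitz:
  assumes p: "p > 2" and ab: "\<bar>a\<bar> \<le> M" "\<bar>b\<bar> \<le> M"
  shows "\<bar>odd_power p a - odd_power p b\<bar> \<le> (p - 1) * M powr (p - 2) * \<bar>a - b\<bar>"
proof -
  define L where "L = (p - 1) * M powr (p - 2)"
  have pos: "\<bar>odd_power p x - odd_power p y\<bar> \<le> L * (x - y)" if "0 \<le> y" "y \<le> x" "x \<le> M" for x y
    using powr_Lipschitz[OF that, of "p - 1"] that p by (simp add: odd_power_nonneg L_def)
  have zero: "\<bar>odd_power p x\<bar> \<le> L * x" if "0 \<le> x" "x \<le> M" for x
    using pos[of 0 x] that by (simp add: odd_power_def)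
  have main: "\<bar>odd_power p x - odd_power p y\<bar> \<le> L * (x - y)" if "y \<le> x" "\<bar>x\<bar> \<le> M" "\<bar>y\<bar> \<le> M" for x y
  proof -
    consider "0 \<le> y" | "x \<le> 0" | "y < 0" "0 < x" by linarith
    then show ?thesis
    proof cases
      case 1
      with that show ?thesis by (intro pos) auto
    next
      case 2
      with that have "\<bar>odd_power p (- y) - odd_power p (- x)\<bar> \<le> L * (- y - - x)" by (intro pos) auto
      then show ?thesis by (simp add: odd_power_minus abs_minus_commute)
    next
      case 3
      then have "\<bar>odd_power p x\<bar> \<le> L * x" "\<bar>odd_power p (- y)\<bar> \<le> L * (- y)"
        using that by (intro zero; simp)+
      then show ?thesis by (simp add: odd_power_minus algebra_simps)
    qed
  qed
  show ?thesis
    using main[of b a] main[of a b] ab unfolding L_def[symmetric]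
    by (cases "b \<le> a") (auto simp: abs_minus_commute)
qed

lemma clip_bound: "M \<ge> 0 \<Longrightarrow> \<bar>clip M s\<bar> \<le> M"
  by (auto simp: clip_def)

lemma clip_Lipschitz: "\<bar>clip M a - clip M b\<bar> \<le> \<bar>a - b\<bar>"
  by (auto simp: clip_def)

lemma clip_id: "\<bar>s\<bar> \<le> M \<Longrightarrow> clip M s = s"
  by (auto simp: clip_def)

text \<open>
  The mean value theorem along the segment from \<open>s\<close> to \<open>s + d\<close> treats both signs of \<open>d\<close> at once.
\<close>

lemma Lipschitz_potential:
  fixes h :: "real \<Rightarrow> real"
  assumes Lip: "\<And>a b. \<bar>h a - h b\<bar> \<le> L * \<bar>a - b\<bar>" and "L \<ge> 0"
  obtains H where "\<And>s. (H has_real_derivative h s) (at s)"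
    "\<And>s d. \<bar>H (s + d) - H s - h s * d\<bar> \<le> L * d\<^sup>2"
proof -
  have "L-lipschitz_on UNIV h" using assms by (intro lipschitz_onI) (auto simp: dist_real_def)
  then have "continuous_on UNIV h" by (rule lipschitz_on_continuous_on)
  then have cont: "isCont h x" for x by (simp add: continuous_on_eq_continuous_at)
  have "\<exists>H. \<forall>x::real. - \<infinity> < ereal x \<longrightarrow> ereal x < \<infinity> \<longrightarrow> (H has_vector_derivative h x) (at x)"
    by (rule einterval_antiderivative) (simp_all add: cont)
  then obtain H where H: "\<And>x. (H has_real_derivative h x) (at x)"
    by (auto simp: has_real_derivative_iff_has_vector_derivative)
  have "\<bar>H (s + d) - H s - h s * d\<bar> \<le> L * d\<^sup>2" for s d
  proof -
    have "((\<lambda>t. H (s + t * d) - t * (h s * d)) has_real_derivative h (s + t * d) * d - h s * d) (at t)" for t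
      by (rule derivative_eq_intros DERIV_chain2[OF H] refl | simp)+
    then have "\<exists>z>0. z < 1 \<and> (H (s + 1 * d) - 1 * (h s * d)) - (H (s + 0 * d) - 0 * (h s * d))
        = (1 - 0) * (h (s + z * d) * d - h s * d)"
      by (intro MVT2) auto
    then obtain z where z: "0 < z" "z < 1" and eq: "H (s + d) - H s - h s * d = (h (s + z * d) - h s) * d"
      by (auto simp: algebra_simps)
    have "\<bar>h (s + z * d) - h s\<bar> \<le> L * (z * \<bar>d\<bar>)" using Lip[of "s + z * d" s] z by (simp add: abs_mult)
    also have "\<dots> \<le> L * (1 * \<bar>d\<bar>)" using z assms by (intro mult_left_mono mult_right_mono) auto
    finally have "\<bar>h (s + z * d) - h s\<bar> * \<bar>d\<bar> \<le> L * (1 * \<bar>d\<bar>) * \<bar>d\<bar>" by (rule mult_right_mono) simp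
    then show ?thesis unfolding eq abs_mult by (simp add: power2_eq_square mult.assoc)
  qed
  then show ?thesis using that H by blast
qed

section \<open>The variational structure\<close>

lemma L2_inner_bounded_le:
  assumes g: "g \<in> borel_measurable torus" and C: "\<And>z. z \<in> square \<Longrightarrow> \<bar>g z\<bar> \<le> C"
  shows "\<bar>L2_inner g (apply_bcontfun y)\<bar> \<le> 2 * pi * C * sqrt (C_inner y y)"
proof -
  have sg: "square_integrable g" by (rule square_integrable_bounded[OF g C])
  have "C \<ge> 0" using C[of "(0, 0)"] by simp
  have "L2_inner g g \<le> (\<integral>z. C\<^sup>2 \<partial>torus)" unfolding L2_inner_def
  proof (rule integral_mono)
    show "integrable torus (\<lambda>z. g z * g z)" by (intro square_integrable_prod sg)
    show "g z * g z \<le> C\<^sup>2" if "z \<in> space torus" for z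
      using power_mono[OF C[of z], of 2] that by (simp add: space_torus power2_eq_square)
  qed simp
  also have "\<dots> = (2 * pi * C)\<^sup>2" using measure_torus by (simp add: space_torus power_mult_distrib)
  finally have "sqrt (L2_inner g g) \<le> 2 * pi * C" using \<open>C \<ge> 0\<close> by (intro real_le_lsqrt) auto
  then have "sqrt (L2_inner g g) * sqrt (C_inner y y) \<le> 2 * pi * C * sqrt (C_inner y y)"
    by (rule mult_right_mono) (simp add: L2_inner_nonneg)
  then show ?thesis using L2_inner_Cauchy_Schwarz[OF sg square_integrable_cfun[of y]] by linarith
qed

text \<open>
  The functional \<open>\<integral> r H(u)\<close> has the gradient \<open>r h(u)\<close>. The constants come from \<open>|r| \<le> R\<close>, the bounds for \<open>h\<close> and
  the measure \<open>(2 \<pi>)\<^sup>2\<close> of the torus, whose root is the \<open>L\<^sup>2\<close> norm of \<open>1\<close>.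
\<close>

lemma potential_functional:
  assumes r: "r \<in> borel_measurable torus" "\<And>z. \<bar>r z\<bar> \<le> R"
    and hB: "\<And>s. \<bar>h s\<bar> \<le> B" and hL: "\<And>a b. \<bar>h a - h b\<bar> \<le> L * \<bar>a - b\<bar>"
    and H: "\<And>s. (H has_real_derivative h s) (at s)" "\<And>s d. \<bar>H (s + d) - H s - h s * d\<bar> \<le> L * d\<^sup>2"
    and ge: "R \<ge> 1" "B \<ge> 1" "L \<ge> 1" "\<mu> > 0"
  shows "constrained_functional C_inner (\<lambda>x. \<integral>z. r z * H (apply_bcontfun x z) \<partial>torus)
     (\<lambda>x y. L2_inner (\<lambda>z. r z * h (apply_bcontfun x z)) (apply_bcontfun y))
     (2 * pi) 4 (2 * pi * (R * B)) ((2 * pi)\<^sup>2 * (R * L)) \<mu>"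
proof (rule constrained_functional.intro)
  have pi: "2 * pi \<ge> 1" using pi_gt3 by simp
  have "L-lipschitz_on UNIV h" using hL ge by (intro lipschitz_onI) (auto simp: dist_real_def)
  then have hc: "continuous_on UNIV h" by (rule lipschitz_on_continuous_on)
  have Hc: "continuous_on UNIV H" using H(1) by (intro continuous_at_imp_continuous_on) (auto intro: DERIV_isCont)
  have xc: "continuous_on UNIV (\<lambda>z. k (apply_bcontfun x z))" if "continuous_on UNIV k" for k :: "real \<Rightarrow> real" and x :: cfun
    by (rule continuous_on_compose2[OF that]) auto
  have hm: "(\<lambda>z. r z * h (apply_bcontfun x z)) \<in> borel_measurable torus" for x :: cfun
    by (intro borel_measurable_times r continuous_measurable_torus xc hc)
  have rh_le: "\<bar>r z * h s\<bar> \<le> R * B" for z s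
    unfolding abs_mult using r(2)[of z] hB[of s] ge by (intro mult_mono) auto
  have hsq: "square_integrable (\<lambda>z. r z * h (apply_bcontfun x z))" for x :: cfun
    by (rule square_integrable_bounded[OF hm rh_le])
  have Hi: "integrable torus (\<lambda>z. r z * H (apply_bcontfun x z))" for x :: cfun
  proof -
    obtain C where "\<And>z. z \<in> square \<Longrightarrow> \<bar>H (apply_bcontfun x z)\<bar> \<le> C"
      by (rule continuous_bounded_on_square[OF xc[OF Hc]]) blast
    then have "\<bar>r z * H (apply_bcontfun x z)\<bar> \<le> R * C" if "z \<in> square" for z
      unfolding abs_mult using that r(2)[of z] ge by (intro mult_mono) auto
    moreover have "(\<lambda>z. r z * H (apply_bcontfun x z)) \<in> borel_measurable torus"
      by (intro borel_measurable_times r continuous_measurable_torus xc Hc)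
    ultimately show ?thesis by (intro bounded_integrable_torus)
  qed
  show "linear (\<lambda>x. C_inner x y)" for y
    using bounded_linear_L2_inner[OF square_integrable_cfun[of y]] by (rule bounded_linear.linear)
  show "C_inner x y = C_inner y x" for x y :: cfun by (rule L2_inner_commute)
  show "C_inner x x \<ge> 0" for x :: cfun by (rule L2_inner_nonneg)
  show "C_inner x x \<le> (2 * pi * norm x)\<^sup>2" for x :: cfun by (rule L2_inner_cfun_bound)
  show "linear (\<lambda>y. L2_inner (\<lambda>z. r z * h (apply_bcontfun x z)) (apply_bcontfun y))" for x :: cfun
    using bounded_linear.linear[OF bounded_linear_L2_inner[OF hsq[of x]]] by (simp add: L2_inner_commute[of "\<lambda>z. r z * h (apply_bcontfun x z)"])
  show "\<bar>L2_inner (\<lambda>z. r z * h (apply_bcontfun x z)) (apply_bcontfun y)\<bar> \<le> 2 * pi * (R * B) * sqrt (C_inner y y)" for x y :: cfun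
    by (rule L2_inner_bounded_le[OF hm rh_le])
  show "\<bar>L2_inner (\<lambda>z. r z * h (apply_bcontfun x z)) (apply_bcontfun y) - L2_inner (\<lambda>z. r z * h (apply_bcontfun x' z)) (apply_bcontfun y)\<bar>
      \<le> (2 * pi)\<^sup>2 * (R * L) * norm (x - x') * sqrt (C_inner y y)" for x x' y :: cfun
  proof -
    let ?d = "\<lambda>z. r z * h (apply_bcontfun x z) - r z * h (apply_bcontfun x' z)"
    have "\<bar>?d z\<bar> \<le> R * (L * norm (x - x'))" for z
    proof -
      have "\<bar>h (apply_bcontfun x z) - h (apply_bcontfun x' z)\<bar> \<le> L * \<bar>apply_bcontfun (x - x') z\<bar>"
        using hL by (simp add: minus_bcontfun.rep_eq)
      also have "\<dots> \<le> L * norm (x - x')"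
        using norm_bounded[of "x - x'" z] ge by (intro mult_left_mono) auto
      finally have "\<bar>r z\<bar> * \<bar>h (apply_bcontfun x z) - h (apply_bcontfun x' z)\<bar> \<le> R * (L * norm (x - x'))"
        using r(2)[of z] ge by (intro mult_mono) auto
      then show ?thesis by (simp add: abs_mult flip: right_diff_distrib)
    qed
    then have "\<bar>L2_inner ?d (apply_bcontfun y)\<bar> \<le> 2 * pi * (R * (L * norm (x - x'))) * sqrt (C_inner y y)"
      by (intro L2_inner_bounded_le borel_measurable_diff hm) auto
    also have "\<dots> = 2 * pi * (R * L * norm (x - x') * sqrt (C_inner y y))" by simp
    also have "\<dots> \<le> (2 * pi)\<^sup>2 * (R * L * norm (x - x') * sqrt (C_inner y y))"
      using pi ge L2_inner_nonneg mult_right_mono[of 1 "2 * pi" "2 * pi"]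
      by (intro mult_right_mono mult_nonneg_nonneg) (auto simp: power2_eq_square)
    finally show ?thesis using L2_inner_diff[OF hsq hsq square_integrable_cfun, of x x' y] by (simp add: mult.assoc)
  qed
  show "\<bar>(\<integral>z. r z * H (apply_bcontfun (x + y) z) \<partial>torus) - (\<integral>z. r z * H (apply_bcontfun x z) \<partial>torus)
      - L2_inner (\<lambda>z. r z * h (apply_bcontfun x z)) (apply_bcontfun y)\<bar> \<le> (2 * pi)\<^sup>2 * (R * L) * (norm y)\<^sup>2" for x y :: cfun
  proof -
    let ?d = "\<lambda>z. r z * H (apply_bcontfun (x + y) z) - r z * H (apply_bcontfun x z)
      - r z * h (apply_bcontfun x z) * apply_bcontfun y z"
    have i3: "integrable torus (\<lambda>z. r z * h (apply_bcontfun x z) * apply_bcontfun y z)"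
      by (intro square_integrable_prod hsq square_integrable_cfun)
    have "norm (\<integral>z. ?d z \<partial>torus) \<le> (\<integral>z. R * (L * (norm y)\<^sup>2) \<partial>torus)"
    proof (rule Bochner_Integration.integral_norm_bound_integral)
      show "integrable torus ?d" by (intro Bochner_Integration.integrable_diff Hi i3)
      show "integrable torus (\<lambda>z. R * (L * (norm y)\<^sup>2))" by simp
      show "norm (?d z) \<le> R * (L * (norm y)\<^sup>2)" for z
      proof -
        let ?s = "apply_bcontfun x z" and ?e = "apply_bcontfun y z"
        have "\<bar>H (?s + ?e) - H ?s - h ?s * ?e\<bar> \<le> L * ?e\<^sup>2" by (rule H(2))
        also have "\<dots> \<le> L * (norm y)\<^sup>2"
          using ge power_mono[OF norm_bounded[of y z], of 2] by (intro mult_left_mono) auto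
        finally have "\<bar>r z\<bar> * \<bar>H (?s + ?e) - H ?s - h ?s * ?e\<bar> \<le> R * (L * (norm y)\<^sup>2)"
          using r(2)[of z] ge by (intro mult_mono) auto
        moreover have "?d z = r z * (H (?s + ?e) - H ?s - h ?s * ?e)"
          by (simp add: plus_bcontfun.rep_eq algebra_simps)
        ultimately show ?thesis by (simp only: real_norm_def abs_mult)
      qed
    qed
    moreover have "(\<integral>z. ?d z \<partial>torus) = (\<integral>z. r z * H (apply_bcontfun (x + y) z) \<partial>torus)
        - (\<integral>z. r z * H (apply_bcontfun x z) \<partial>torus) - L2_inner (\<lambda>z. r z * h (apply_bcontfun x z)) (apply_bcontfun y)"
      unfolding L2_inner_def
      by (simp only: Bochner_Integration.integral_diff[OF Bochner_Integration.integrable_diff[OF Hi Hi] i3]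
          Bochner_Integration.integral_diff[OF Hi Hi])
    moreover have "(\<integral>z. R * (L * (norm y)\<^sup>2) \<partial>torus) = (2 * pi)\<^sup>2 * (R * L) * (norm y)\<^sup>2"
      using measure_torus by (simp add: space_torus)
    ultimately show ?thesis by (simp only: real_norm_def)
  qed
  have RB: "1 \<le> R * B" "1 \<le> R * L" using ge mult_mono[of 1 R 1 B] mult_mono[of 1 R 1 L] by auto
  then show "2 * pi * (R * B) \<ge> 1" using pi mult_mono[of 1 "2 * pi" 1 "R * B"] by simp
  have "1 \<le> (2 * pi)\<^sup>2" using pi power_mono[of 1 "2 * pi" 2] by simp
  then show "(2 * pi)\<^sup>2 * (R * L) \<ge> 1" using RB mult_mono[of 1 "(2 * pi)\<^sup>2" 1 "R * L"] by simp
qed (use ge pi_gt3 in auto)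

definition source :: "real \<Rightarrow> plane_fun \<Rightarrow> real \<Rightarrow> plane_fun \<Rightarrow> plane_fun" where
  "source p r l u z = l * u z + r z * odd_power p (u z)"

lemma odd_power_continuous:
  assumes "p > 2"
  shows "continuous_on UNIV (odd_power p)"
  unfolding odd_power_def[abs_def] using assms by (intro continuous_intros continuous_on_powr') auto

lemma square_integrable_odd_power:
  assumes "p > 2" "r \<in> borel_measurable torus" "\<And>z. \<bar>r z\<bar> \<le> R" "continuous_on UNIV u"
  shows "square_integrable (\<lambda>z. r z * odd_power p (u z))"
proof -
  have c: "continuous_on UNIV (\<lambda>z. odd_power p (u z))"
    by (rule continuous_on_compose2[OF odd_power_continuous[OF assms(1)] assms(4)]) auto
  obtain C where C: "\<And>z. z \<in> square \<Longrightarrow> \<bar>odd_power p (u z)\<bar> \<le> C"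
    by (rule continuous_bounded_on_square[OF c]) blast
  show ?thesis
  proof (rule square_integrable_bounded)
    show "(\<lambda>z. r z * odd_power p (u z)) \<in> borel_measurable torus"
      by (intro borel_measurable_times assms continuous_measurable_torus c)
    show "\<bar>r z * odd_power p (u z)\<bar> \<le> R * C" if "z \<in> square" for z
      unfolding abs_mult using C[OF that] assms(3)[of z] by (intro mult_mono) auto
  qed
qed

lemma coef_source:
  assumes "p > 2" "r \<in> borel_measurable torus" "\<And>z. \<bar>r z\<bar> \<le> R" "continuous_on UNIV u"
  shows "square_integrable (source p r l u)"
    and "coef (source p r l u) k = l * coef u k + coef (\<lambda>z. r z * odd_power p (u z)) k"
proof -
  have s: "square_integrable (\<lambda>z. l * u z)" "square_integrable (\<lambda>z. r z * odd_power p (u z))"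
    by (intro square_integrable_cmult square_integrable_continuous assms) (rule square_integrable_odd_power[OF assms])
  then show "square_integrable (source p r l u)" unfolding source_def[abs_def] by (rule square_integrable_add)
  show "coef (source p r l u) k = l * coef u k + coef (\<lambda>z. r z * odd_power p (u z)) k"
    unfolding source_def[abs_def] coef_def using s square_integrable_hartley by (simp add: L2_inner_add L2_inner_cmult)
qed

text \<open>
  The reduction is applied with the nonlinearity truncated at \<open>M\<close>. The constant \<open>C\<close> and the
  admissible size \<open>\<kappa>\<close> of the resolvent do not depend on \<open>j\<close>, so that all large \<open>j\<close> are admissible.
\<close>

proposition ex_normalized_solutions:
  assumes p: "p > 2" and r: "r \<in> borel_measurable torus" "\<And>z. \<bar>r z\<bar> \<le> R" and \<mu>: "\<mu> > 0"
  shows "\<exists>C. \<forall>\<^sub>F j in sequentially. \<exists>l (u::cfun). 16 ^ j - C \<le> l \<and> periodic (apply_bcontfun u) \<and>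
     C_inner u u = \<mu> \<and> (\<forall>k. (norm_sq k)\<^sup>2 * coef (apply_bcontfun u) k = coef (source p r l (apply_bcontfun u)) k)"
proof -
  \<comment> \<open>The a priori bound: \<open>4 sqrt \<mu>\<close> for the part in the eigenspace and \<open>1\<close> for the correction.\<close>
  define M where "M = 4 * sqrt \<mu> + 1"
  define h where "h s = odd_power p (clip M s)" for s
  define L where "L = max 1 ((p - 1) * M powr (p - 2))"
  define B where "B = max 1 (L * M)"
  define R' where "R' = max 1 R"
  have M: "M \<ge> 0" using \<mu> by (simp add: M_def)
  have ge: "R' \<ge> 1" "B \<ge> 1" "L \<ge> 1" by (simp_all add: R'_def B_def L_def)
  have r': "\<bar>r z\<bar> \<le> R'" for z using r(2)[of z] by (simp add: R'_def)
  have hL: "\<bar>h a - h b\<bar> \<le> L * \<bar>a - b\<bar>" for a b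
  proof -
    have "\<bar>h a - h b\<bar> \<le> (p - 1) * M powr (p - 2) * \<bar>clip M a - clip M b\<bar>"
      unfolding h_def by (intro odd_power_Lipschitz p clip_bound M)
    also have "\<dots> \<le> L * \<bar>a - b\<bar>"
      using clip_Lipschitz[of M a b] p by (intro mult_mono) (auto simp: L_def)
    finally show ?thesis .
  qed
  have hB: "\<bar>h s\<bar> \<le> B" for s
  proof -
    have "\<bar>h s\<bar> \<le> (p - 1) * M powr (p - 2) * \<bar>clip M s\<bar>"
      unfolding h_def using odd_power_Lipschitz[OF p clip_bound[OF M], of 0 s] M by (simp add: odd_power_def)
    also have "\<dots> \<le> L * M" using clip_bound[OF M, of s] p by (intro mult_mono) (auto simp: L_def)
    finally show ?thesis by (simp add: B_def)
  qed
  obtain H where H: "\<And>s. (H has_real_derivative h s) (at s)"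
    "\<And>s d. \<bar>H (s + d) - H s - h s * d\<bar> \<le> L * d\<^sup>2"
    by (rule Lipschitz_potential[of h L, OF hL]) (use ge in simp, blast)
  define G :: "cfun \<Rightarrow> real" where "G x = (\<integral>z. r z * H (apply_bcontfun x z) \<partial>torus)" for x
  define DG :: "cfun \<Rightarrow> cfun \<Rightarrow> real"
    where "DG x y = L2_inner (\<lambda>z. r z * h (apply_bcontfun x z)) (apply_bcontfun y)" for x y
  interpret CF: constrained_functional C_inner G DG "2 * pi" 4 "2 * pi * (R' * B)" "(2 * pi)\<^sup>2 * (R' * L)" \<mu>
    unfolding G_def[abs_def] DG_def[abs_def] by (rule potential_functional[OF r(1) r' hB hL H ge \<mu>])
  define Bt where "Bt = 2 * pi * (R' * B)"
  define \<sigma> where "\<sigma> = sqrt \<mu> / 2"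
  define \<kappa> where "\<kappa> = min (1 / (2 * CF.lip_residual)) (min 1 (\<sigma> / (2 * pi)) / (3 * Bt))"
  have \<sigma>: "\<sigma> > 0" using \<mu> by (simp add: \<sigma>_def)
  have Bt: "Bt > 0" using CF.nonneg(3) unfolding Bt_def by linarith
  have lip_residual: "CF.lip_residual > 0" by (rule CF.lip_pos)
  have \<kappa>: "\<kappa> > 0" using lip_residual Bt \<sigma> by (simp add: \<kappa>_def)
  have "filterlim (\<lambda>j. 4 ^ j :: nat) at_top sequentially"
    by (rule filterlim_subseq) (auto intro!: strict_monoI power_strict_increasing)
  from eventually_compose_filterlim[OF weight_bound_eventually[OF \<kappa>] this]
  have ev: "eventually (\<lambda>j. weight_bound (4 ^ j) \<kappa>) sequentially" by simp
  show ?thesis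
  proof (intro exI[of _ "Bt / \<sigma>"], use ev in eventually_elim)
    case (elim j)
    interpret SR: spectral_reduction C_inner G DG "2 * pi" 4 "2 * pi * (R' * B)" "(2 * pi)\<^sup>2 * (R' * L)" \<mu>
      "eigen j" "resolvent (4 ^ j)" \<kappa>
    proof (intro spectral_reduction.intro spectral_reduction_axioms.intro CF.constrained_functional_axioms)
      show "\<kappa> * CF.lip_residual \<le> 1 / 2"
      proof -
        have "\<kappa> * CF.lip_residual \<le> 1 / (2 * CF.lip_residual) * CF.lip_residual" using lip_residual by (intro mult_right_mono) (auto simp: \<kappa>_def)
        then show ?thesis using lip_residual by simp
      qed
      show "\<kappa> * (3 * (2 * pi * (R' * B))) \<le> min 1 (sqrt \<mu> / 2 / (2 * pi))"
      proof -
        have "\<kappa> * (3 * Bt) \<le> min 1 (\<sigma> / (2 * pi)) / (3 * Bt) * (3 * Bt)"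
          using Bt by (intro mult_right_mono) (auto simp: \<kappa>_def)
        also have "\<dots> = min 1 (\<sigma> / (2 * pi))" using Bt by simp
        finally show ?thesis unfolding \<sigma>_def Bt_def .
      qed
    qed (use \<kappa> elim in \<open>auto intro: eigen_linear eigen_inner eigen_bound resolvent_0 resolvent_bound
        resolvent_sym resolvent_orth\<close>)
    obtain a w c where a: "norm a = 1" and w: "norm w \<le> 1" and c: "\<bar>c\<bar> \<le> Bt / \<sigma>"
      and s: "0 \<le> CF.amplitude w" "CF.amplitude w \<le> sqrt \<mu>" and fn: "functional C_inner (CF.residual (eigen j) a w)"
      and fp: "resolvent (4 ^ j) (CF.residual (eigen j) a w) = w" and c_def: "c = CF.multiplier (eigen j) a w"
      and crit: "\<forall>x. DG (CF.state (eigen j) a w) (eigen j x) = c * CF.amplitude w * (x \<bullet> a)"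
      and mass: "C_inner (CF.state (eigen j) a w) (CF.state (eigen j) a w) = \<mu>"
      using SR.ex_constrained_critical_point unfolding Bt_def[symmetric] \<sigma>_def[symmetric]
      by (elim exE conjE)
    define u where "u = CF.state (eigen j) a w"
    define l where "l = 16 ^ j - c"
    have u: "u = CF.amplitude w *\<^sub>R eigen j a + w" by (simp add: u_def CF.state_def)
    have u_apply: "apply_bcontfun u z = CF.amplitude w * apply_bcontfun (eigen j a) z + apply_bcontfun w z" for z
      by (simp add: u plus_bcontfun.rep_eq scaleR_bcontfun.rep_eq)
    have u_bound: "\<bar>apply_bcontfun u z\<bar> \<le> M" for z
    proof -
      have "norm u \<le> CF.amplitude w * norm (eigen j a) + norm w"
        using norm_triangle_ineq[of "CF.amplitude w *\<^sub>R eigen j a" w] s by (simp add: u)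
      also have "\<dots> \<le> sqrt \<mu> * 4 + 1"
        using eigen_bound[of j a] s w a \<mu> by (intro add_mono mult_mono) auto
      finally show ?thesis using norm_bounded[of u z] by (simp add: M_def)
    qed
    define N where "N = (\<lambda>z. r z * odd_power p (apply_bcontfun u z))"
    \<comment> \<open>The bound by \<open>M\<close> makes the truncation invisible.\<close>
    have N: "DG u (hartley_C k) = coef N k" for k
      unfolding DG_def N_def h_def coef_def apply_hartley_C using clip_id[OF u_bound] by simp
    have w_coef: "coef (apply_bcontfun w) k = (coef N k - c * coef (apply_bcontfun w) k) * weight (4 ^ j) k" for k
    proof -
      have "CF.residual (eigen j) a w (hartley_C k) = coef N k - c * coef (apply_bcontfun w) k"
        unfolding CF.residual_def u_def[symmetric] c_def[symmetric] N by (simp add: coef_def apply_hartley_C)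
      then show ?thesis using coef_resolvent[OF fn elim, of k] by (simp only: fp)
    qed
    have u_coef: "coef (apply_bcontfun u) k
        = CF.amplitude w * coef (apply_bcontfun (eigen j a)) k + coef (apply_bcontfun w) k" for k
    proof -
      have "apply_bcontfun u = (\<lambda>z. CF.amplitude w * apply_bcontfun (eigen j a) z + apply_bcontfun w z)"
        by (rule ext) (rule u_apply)
      then show ?thesis
        unfolding coef_def by (simp add: L2_inner_add L2_inner_cmult square_integrable_cmult square_integrable_cfun square_integrable_hartley)
    qed
    have sq: "((4::real) ^ j)\<^sup>2 = 16 ^ j" by (simp add: power2_eq_square flip: power_mult_distrib)
    have eq: "(norm_sq k)\<^sup>2 * coef (apply_bcontfun u) k = l * coef (apply_bcontfun u) k + coef N k" for k
    \<comment> \<open>On the eigenspace the coefficients are those of \<open>E a\<close> and criticality applies; elsewhere they are those of \<open>w\<close>.\<close>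
    proof (cases "norm_sq k = 4 ^ j")
      case True
      then obtain i where k: "k = freq j i" by (rule norm_sq_eq_freq)
      have "coef (apply_bcontfun w) k = 0" using w_coef[of k] True by (simp add: weight_def)
      then have uk: "coef (apply_bcontfun u) k = CF.amplitude w * a $ i"
        by (simp add: u_coef coef_eigen k inv_f_f[OF inj_freq])
      have "coef N k = c * CF.amplitude w * (axis i 1 \<bullet> a)"
        using crit[rule_format, of "axis i 1"] by (simp only: N[symmetric] u_def eigen_axis k)
      then have "coef N k = c * (CF.amplitude w * a $ i)" by (simp add: inner_axis')
      then show ?thesis by (simp add: uk True sq l_def algebra_simps)
    next
      case False
      then have "k \<notin> range (freq j)" using norm_sq_freq by auto
      then have uw: "coef (apply_bcontfun u) k = coef (apply_bcontfun w) k" by (simp add: u_coef coef_eigen)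
      have "(norm_sq k)\<^sup>2 - 16 ^ j \<noteq> 0"
        using False norm_sq_nonneg[of k] sq power_eq_iff_eq_base[of 2 "norm_sq k" "4 ^ j"] by simp
      moreover have "coef (apply_bcontfun w) k
          = (coef N k - c * coef (apply_bcontfun w) k) / ((norm_sq k)\<^sup>2 - 16 ^ j)"
        using w_coef[of k] False by (simp add: weight_def sq)
      ultimately have "coef (apply_bcontfun w) k * ((norm_sq k)\<^sup>2 - 16 ^ j) = coef N k - c * coef (apply_bcontfun w) k"
        by (metis nonzero_eq_divide_eq)
      then show ?thesis by (simp add: uw l_def algebra_simps)
    qed
    have "(norm_sq k)\<^sup>2 * coef (apply_bcontfun u) k = coef (source p r l (apply_bcontfun u)) k" for k
      using eq[of k] coef_source(2)[OF p r, of "apply_bcontfun u" l k] by (simp add: N_def)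
    moreover have "periodic (apply_bcontfun u)"
      using periodic_eigen[of j a] periodic_resolvent[OF fn elim] unfolding fp
      by (simp add: periodic_def u_apply)
    moreover have "16 ^ j - Bt / \<sigma> \<le> l" using c by (simp add: l_def)
    ultimately show ?case using mass unfolding u_def[symmetric]
      by (intro exI[of _ l] exI[of _ u] conjI allI)
  qed
qed

section \<open>The sign change and the weak equation\<close>

text \<open>
  The source has mean zero. If \<open>e u \<ge> 0\<close> for a sign \<open>e\<close>, then \<open>e\<close> times the source is a sum of two nonnegative
  terms, so it vanishes almost everywhere, and its part \<open>l e u\<close> forces \<open>u = 0\<close>.
\<close>

lemma sign_changing_of_source:
  assumes p: "p > 2" and r: "r \<in> borel_measurable torus" "\<And>z. \<bar>r z\<bar> \<le> R" "\<And>z. r z \<ge> 0"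
    and u: "continuous_on UNIV u" "L2_inner u u \<noteq> 0" and l: "l > 0"
    and mean: "coef (source p r l u) 0 = 0"
  shows "sign_changing u"
proof -
  let ?f = "source p r l u"
  have f: "square_integrable ?f" by (rule coef_source(1)[OF p r(1,2) u(1)])
  have one: "hartley 0 = (\<lambda>z. 1 / (2 * pi))" by (simp add: hartley_def fun_eq_iff phase_simps)
  have int: "integrable torus ?f"
    using square_integrable_prod[OF f square_integrable_continuous[of "\<lambda>z. 1"]] by simp
  have "(\<integral>z. ?f z * (1 / (2 * pi)) \<partial>torus) = 0" using mean by (simp add: coef_def L2_inner_def one)
  then have zero: "(\<integral>z. ?f z \<partial>torus) = 0" by simp
  have no: "\<not> (AE z in torus. 0 \<le> e * u z)" if e: "e * e = 1" for e :: real
  proof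
    assume ae: "AE z in torus. 0 \<le> e * u z"
    have split: "e * ?f z = l * (e * u z) + r z * (\<bar>u z\<bar> powr (p - 2) * (e * u z))" for z
      by (simp add: source_def odd_power_def algebra_simps)
    have nn: "0 \<le> r z * (\<bar>u z\<bar> powr (p - 2) * (e * u z))" if "0 \<le> e * u z" for z
      using that by (intro mult_nonneg_nonneg[OF r(3) mult_nonneg_nonneg[OF powr_ge_zero]])
    have "AE z in torus. 0 \<le> e * ?f z"
      using ae
    proof eventually_elim
      case (elim z)
      show ?case
        unfolding split by (intro add_nonneg_nonneg mult_nonneg_nonneg[OF less_imp_le[OF l] elim] nn[OF elim])
    qed
    moreover have "(\<integral>z. e * ?f z \<partial>torus) = 0" using zero by simp
    ultimately have "AE z in torus. e * ?f z = 0"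
      using integral_nonneg_eq_0_iff_AE[of torus "\<lambda>z. e * ?f z"] int by simp
    then have "AE z in torus. u z * u z = 0"
      using ae
    proof eventually_elim
      case (elim z)
      then have "l * (e * u z) = 0"
        using nn[of z] split[of z] l mult_nonneg_nonneg[of l "e * u z"] by linarith
      then have "e * u z = 0" using l by simp
      then show ?case using e by auto
    qed
    then have "(\<integral>z. u z * u z \<partial>torus) = (\<integral>z. 0 \<partial>torus)"
      by (intro integral_cong_AE borel_measurable_times continuous_measurable_torus u) auto
    then show False using u(2) by (simp add: L2_inner_def)
  qed
  show ?thesis
    unfolding sign_changing_def
  proof
    show "\<not> (AE z in torus. max (u z) 0 = 0)"
    proof
      assume "AE z in torus. max (u z) 0 = 0"
      then have "AE z in torus. 0 \<le> - 1 * u z" by eventually_elim (simp add: max_def split: if_splits)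
      with no[of "- 1"] show False by simp
    qed
    show "\<not> (AE z in torus. max (- u z) 0 = 0)"
    proof
      assume "AE z in torus. max (- u z) 0 = 0"
      then have "AE z in torus. 0 \<le> 1 * u z" by eventually_elim (simp add: max_def split: if_splits)
      with no[of 1] show False by simp
    qed
  qed
qed

lemma weak_solution_of_coef:
  assumes p: "p > 2" and s: "s \<in> borel_measurable torus" "\<And>z. \<bar>s z\<bar> \<le> R"
    and r: "r \<in> borel_measurable torus" "AE z in torus. s z = r z"
    and u: "continuous_on UNIV u" "periodic u"
    and eq: "\<And>k. (norm_sq k)\<^sup>2 * coef u k = coef (source p s l u) k"
  shows "weak_solution p r l u"
  unfolding weak_solution_def
proof (intro conjI ballI)
  have f: "square_integrable (source p s l u)" by (rule coef_source(1)[OF p s u(1)])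
  have su: "square_integrable u" by (rule square_integrable_continuous[OF u(1)])
  show H2: "u \<in> H2_torus" by (rule H2_of_coef[OF su u(2) f eq])
  fix v assume v: "v \<in> H2_torus"
  have sv: "square_integrable v" using v by (simp add: H2_torus_def L2_torus_iff)
  have N: "square_integrable (\<lambda>z. s z * odd_power p (u z))" by (rule square_integrable_odd_power[OF p s u(1)])
  have [measurable]: "v \<in> borel_measurable torus" "u \<in> borel_measurable torus"
    using sv su by (auto simp: square_integrable_def)
  note [measurable] = r(1) s(1)
  have "(\<integral>z. laplacian u z * laplacian v z \<partial>torus) = L2_inner (source p s l u) v"
    using weak_equation_of_coef[OF H2 f eq v] by (simp add: L2_inner_def)
  also have "\<dots> = l * L2_inner u v + L2_inner (\<lambda>z. s z * odd_power p (u z)) v"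
    unfolding source_def[abs_def] using N su sv by (simp add: L2_inner_add L2_inner_cmult square_integrable_cmult)
  also have "L2_inner (\<lambda>z. s z * odd_power p (u z)) v = (\<integral>z. r z * \<bar>u z\<bar> powr (p - 2) * u z * v z \<partial>torus)"
    unfolding L2_inner_def
  proof (rule integral_cong_AE)
    show "(\<lambda>z. s z * odd_power p (u z) * v z) \<in> borel_measurable torus"
      unfolding odd_power_def by measurable
    show "(\<lambda>z. r z * \<bar>u z\<bar> powr (p - 2) * u z * v z) \<in> borel_measurable torus" by measurable
    show "AE z in torus. s z * odd_power p (u z) * v z = r z * \<bar>u z\<bar> powr (p - 2) * u z * v z"
      using r(2) by eventually_elim (simp add: odd_power_def)
  qed
  finally show "(\<integral>z. laplacian u z * laplacian v z \<partial>torus)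
      = l * (\<integral>z. u z * v z \<partial>torus) + (\<integral>z. r z * \<bar>u z\<bar> powr (p - 2) * u z * v z \<partial>torus)"
    by (simp add: L2_inner_def)
qed

text \<open>
  Essential bounds become bounds at every point after a change on a null set, which integrals do
  not notice.
\<close>

lemma bounded_positive_representative:
  assumes "r \<in> Linf_torus" "essinf torus (\<lambda>x. ereal (r x)) > 0"
  obtains s R where "s \<in> borel_measurable torus" "\<And>z. \<bar>s z\<bar> \<le> R" "\<And>z. s z \<ge> 0"
    "AE z in torus. s z = r z"
proof -
  define e where "e = esssup torus (\<lambda>x. ereal \<bar>r x\<bar>)"
  have r [measurable]: "r \<in> borel_measurable torus" and "e < \<infinity>"
    using assms(1) by (auto simp: Linf_torus_def e_def)
  have "\<exists>R. e \<le> ereal R" using \<open>e < \<infinity>\<close> by (cases e) auto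
  then obtain R where R: "e \<le> ereal R" ..
  have le: "AE z in torus. \<bar>r z\<bar> \<le> R"
    using esssup_AE[where M = torus and f = "\<lambda>x. ereal \<bar>r x\<bar>"]
  proof eventually_elim
    case (elim z)
    then have "ereal \<bar>r z\<bar> \<le> ereal R" using R unfolding e_def by (rule order_trans)
    then show ?case by simp
  qed
  have neg: "esssup torus (\<lambda>x. - ereal (r x)) < 0"
    using assms(2) by (simp add: essinf_def)
  have pos: "AE z in torus. 0 < r z"
    using esssup_AE[where M = torus and f = "\<lambda>x. - ereal (r x)"]
  proof eventually_elim
    case (elim z)
    then have "- ereal (r z) < 0" using neg by (rule le_less_trans)
    then show ?case by simp
  qed
  define s where "s z = max 0 (min (max R 0) (r z))" for z
  show ?thesis
  proof (rule that[of s "max R 0"])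
    show "s \<in> borel_measurable torus" unfolding s_def[abs_def] by measurable
    show "\<bar>s z\<bar> \<le> max R 0" "s z \<ge> 0" for z by (auto simp: s_def)
    show "AE z in torus. s z = r z" using le pos by eventually_elim (auto simp: s_def)
  qed
qed

theorem theorem1p4:
  fixes p \<mu> :: real and r :: "real \<times> real \<Rightarrow> real"
  assumes "p > 2"
    and "r \<in> Linf_torus"
    and "essinf torus (\<lambda>x. ereal (r x)) > 0"
    and "\<mu> > 0"
  shows "\<exists>(\<Lambda> :: nat \<Rightarrow> real) (u :: nat \<Rightarrow> real \<times> real \<Rightarrow> real).
      filterlim \<Lambda> at_top sequentially \<and>
      (\<forall>j. weak_solution p r (\<Lambda> j) (u j) \<and> sign_changing (u j) \<and>
           (L2_norm_torus (u j))\<^sup>2 = \<mu>)"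
proof -
  obtain s R where s: "s \<in> borel_measurable torus" "\<And>z. \<bar>s z\<bar> \<le> R" "\<And>z. s z \<ge> 0"
    "AE z in torus. s z = r z"
    by (rule bounded_positive_representative[OF assms(2,3)]) blast
  have r: "r \<in> borel_measurable torus" using assms(2) by (simp add: Linf_torus_def)
  obtain C where C: "\<forall>\<^sub>F j in sequentially. \<exists>l (u::cfun). 16 ^ j - C \<le> l \<and> periodic (apply_bcontfun u) \<and>
      C_inner u u = \<mu> \<and> (\<forall>k. (norm_sq k)\<^sup>2 * coef (apply_bcontfun u) k = coef (source p s l (apply_bcontfun u)) k)"
    using ex_normalized_solutions[OF assms(1) s(1,2) assms(4)] by (elim exE)
  have lim: "filterlim (\<lambda>j. (16::real) ^ j - C) at_top sequentially"
  proof (rule filterlim_at_top_mono)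
    show "filterlim (\<lambda>j. - C + real j) at_top sequentially"
      by (intro filterlim_tendsto_add_at_top[OF tendsto_const] filterlim_real_sequentially)
    have "real j \<le> 16 ^ j" for j
      using of_nat_less_two_power[of j, where ?'a = real] power_mono[of "2::real" 16 j] by linarith
    then show "\<forall>\<^sub>F j in sequentially. - C + real j \<le> 16 ^ j - C" by simp
  qed
  have "eventually (\<lambda>j. 0 < (16::real) ^ j - C) sequentially"
    using lim unfolding filterlim_at_top_dense by (rule spec)
  from eventually_conj[OF C this] obtain J where J: "\<forall>j\<ge>J. (\<exists>l (u::cfun). 16 ^ j - C \<le> l \<and>
      periodic (apply_bcontfun u) \<and> C_inner u u = \<mu> \<and>
      (\<forall>k. (norm_sq k)\<^sup>2 * coef (apply_bcontfun u) k = coef (source p s l (apply_bcontfun u)) k)) \<and> 0 < (16::real) ^ j - C"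
    unfolding eventually_sequentially by (elim exE)
  have "\<exists>l u. 16 ^ (J + j) - C \<le> l \<and> weak_solution p r l u \<and> sign_changing u \<and> (L2_norm_torus u)\<^sup>2 = \<mu>" for j
  proof -
    have "J \<le> J + j" by simp
    from J[THEN spec, THEN mp, OF this] obtain l and u :: cfun where l: "16 ^ (J + j) - C \<le> l" "0 < (16::real) ^ (J + j) - C"
      and per: "periodic (apply_bcontfun u)" and mass: "C_inner u u = \<mu>"
      and eq: "\<forall>k. (norm_sq k)\<^sup>2 * coef (apply_bcontfun u) k = coef (source p s l (apply_bcontfun u)) k"
      by (elim exE conjE)
    have cont: "continuous_on UNIV (apply_bcontfun u)" by auto
    have "weak_solution p r l (apply_bcontfun u)"
      by (rule weak_solution_of_coef[OF assms(1) s(1,2) r s(4) cont per]) (rule eq[rule_format])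
    moreover have "sign_changing (apply_bcontfun u)"
    proof (rule sign_changing_of_source[OF assms(1) s(1,2,3) cont])
      show "C_inner u u \<noteq> 0" using mass assms(4) by simp
      show "l > 0" using l by linarith
      show "coef (source p s l (apply_bcontfun u)) 0 = 0"
        using eq[rule_format, of 0] by (simp add: norm_sq_def)
    qed
    moreover have "(L2_norm_torus (apply_bcontfun u))\<^sup>2 = \<mu>"
      using mass assms(4) by (simp add: L2_norm_torus_def L2_inner_def power2_eq_square)
    ultimately show ?thesis using l by (intro exI[of _ l] exI[of _ "apply_bcontfun u"] conjI)
  qed
  then obtain \<Lambda> u where sol: "\<And>j. 16 ^ (J + j) - C \<le> \<Lambda> j" "\<And>j. weak_solution p r (\<Lambda> j) (u j)"
    "\<And>j. sign_changing (u j)" "\<And>j. (L2_norm_torus (u j))\<^sup>2 = \<mu>"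
    by metis
  have "16 ^ j - C \<le> \<Lambda> j" for j
    using sol(1)[of j] power_increasing[of j "J + j" "16::real"] by linarith
  then have "filterlim \<Lambda> at_top sequentially"
    by (intro filterlim_at_top_mono[OF lim]) simp
  then show ?thesis using sol(2-4) by (intro exI[of _ \<Lambda>] exI[of _ u] conjI allI)
qed

end
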